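(* Let $N\ge 3$, let $k$ be a positive integer with $k<N-2$, let $B=\{x\in\mathbb{R}^N:|x|<1\}$, and let $g$ be a non-negative, continuous, radially symmetric function on $B$ satisfying $g(x)\le K|x|^{-2+\sigma}$ for $|x|<1$, for some $\sigma,K>0$. For $\epsilon>0$ let $$\hat V_{k,\epsilon}(x)=\begin{cases}\epsilon g(x),&|x|<1,\\ \left(\frac{N-2}{2}\right)^2|x|^{-2}+\frac{1}{4|x|^2}\sum_{i=1}^kY_1^2(|x|)\cdots Y_i^2(|x|),&|x|>1,\end{cases}$$ and define $$\bar\epsilon_{k,0}=\inf_{u\in H^1(B)}\frac{\int_{B}|\nabla u|^2dx+\frac{N-2-k}{2}\int_{\partial B}u^2dS}{\int_{B}gu^2dx}.$$ Then $\bar\epsilon_{k,0}>0$, and for any $\epsilon\in(0,\bar\epsilon_{k,0})$ there is a constant $c>0$ such that $$\int_{\mathbb{R}^N}|\nabla u|^2dx-\int_{\mathbb{R}^N}\hat V_{k,\epsilon}u^2dx\ \ge\ c\left(\int_{\mathbb{R}^N}|u|^{\frac{2N}{N-2}}(\tilde Y_1\cdots\tilde Y_{k+1})^{\frac{2N-2}{N-2}}dx\right)^{\frac{N-2}{N}}\qquad\text{for all }u\in C^\infty_c(\mathbb{R}^N).$$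
   Context: $X_1(t)=(1-\log t)^{-1}$ and $X_{j+1}(t)=X_1(X_j(t))$, $j\ge1$, for $t\in(0,1)$. $Y_j(|x|)=X_j(1/|x|)$ for $|x|>1$; $\tilde Y_j=\tilde Y_j(|x|)$ equals $X_j(1/|x|)$ for $|x|>1$ and $1$ for $|x|<1$. The infimum defining $\bar\epsilon_{k,0}$ is over those $u$ with $\int_B gu^2dx>0$ (with value $+\infty$ if there are none). *)

theory Defs
  imports "HOL-Analysis.Analysis"
begin

section \<open>Smooth functions and test functions\<close>

fun iterated_partial :: "'a list \<Rightarrow> ('a::euclidean_space \<Rightarrow> real) \<Rightarrow> 'a \<Rightarrow> real" where
  "iterated_partial [] f = f"
| "iterated_partial (v # vs) f = (\<lambda>x. frechet_derivative (iterated_partial vs f) (at x) v)"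

text \<open>Differentiability of every iterated partial derivative already gives continuity of
  all of them, so this is the usual notion of a \<open>C\<^sup>\<infinity>\<close> function on the whole space.\<close>

definition smooth :: "('a::euclidean_space \<Rightarrow> real) \<Rightarrow> bool" where
  "smooth f \<longleftrightarrow> (\<forall>vs x. set vs \<subseteq> Basis \<longrightarrow> iterated_partial vs f differentiable (at x))"

definition test_functions :: "'a::euclidean_space set \<Rightarrow> ('a \<Rightarrow> real) set" where
  "test_functions \<Omega> = {f. smooth f \<and> compact (closure {x. f x \<noteq> 0}) \<and> closure {x. f x \<noteq> 0} \<subseteq> \<Omega>}"

definition gradient :: "('a::euclidean_space \<Rightarrow> real) \<Rightarrow> 'a \<Rightarrow> 'a" where
  "gradient f x = (\<Sum>i\<in>Basis. frechet_derivative f (at x) i *\<^sub>R i)"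

lemma GDERIV_gradient:
  assumes "f differentiable (at x)"
  shows "GDERIV f x :> gradient f x"
proof -
  have D: "(f has_derivative frechet_derivative f (at x)) (at x)"
    using assms frechet_derivative_works by blast
  then interpret bounded_linear "frechet_derivative f (at x)"
    by (rule has_derivative_bounded_linear)
  have "frechet_derivative f (at x) h = h \<bullet> gradient f x" for h
  proof -
    have "frechet_derivative f (at x) h
        = frechet_derivative f (at x) (\<Sum>i\<in>Basis. (h \<bullet> i) *\<^sub>R i)"
      by (simp add: euclidean_representation)
    also have "\<dots> = h \<bullet> gradient f x"
      by (simp add: sum scaleR gradient_def inner_sum_right mult.commute)
    finally show ?thesis .
  qed
  then have "frechet_derivative f (at x) = (\<lambda>h. h \<bullet> gradient f x)" by blast
  with D show ?thesis unfolding gderiv_def by simp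
qed

section \<open>The space \<open>H\<^sup>1\<close>\<close>

definition square_integrable :: "'b measure \<Rightarrow> ('b \<Rightarrow> 'c::euclidean_space) \<Rightarrow> bool" where
  "square_integrable M f \<longleftrightarrow> f \<in> borel_measurable M \<and> integrable M (\<lambda>x. (norm (f x))\<^sup>2)"

definition L2_dist_sq :: "'b measure \<Rightarrow> ('b \<Rightarrow> 'c::euclidean_space) \<Rightarrow> ('b \<Rightarrow> 'c) \<Rightarrow> ennreal" where
  "L2_dist_sq M f h = (\<integral>\<^sup>+x. ennreal ((norm (f x - h x))\<^sup>2) \<partial>M)"

definition has_L2_weak_gradient ::
    "'a::euclidean_space set \<Rightarrow> ('a \<Rightarrow> real) \<Rightarrow> ('a \<Rightarrow> 'a) \<Rightarrow> bool" where
  "has_L2_weak_gradient \<Omega> u U \<longleftrightarrow>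
     square_integrable (lebesgue_on \<Omega>) U \<and>
     (\<forall>\<phi>\<in>test_functions \<Omega>. \<forall>i\<in>Basis.
        (LINT x|lebesgue_on \<Omega>. u x * (gradient \<phi> x \<bullet> i))
          = - (LINT x|lebesgue_on \<Omega>. (U x \<bullet> i) * \<phi> x))"

definition H1 :: "'a::euclidean_space set \<Rightarrow> ('a \<Rightarrow> real) set" where
  "H1 \<Omega> = {u. square_integrable (lebesgue_on \<Omega>) u \<and> (\<exists>U. has_L2_weak_gradient \<Omega> u U)}"

section \<open>Surface measure and traces on the unit sphere\<close>

text \<open>The surface measure of a Borel subset \<open>A\<close> of the unit sphere in dimension \<open>N\<close> is
  \<open>N\<close> times the Lebesgue measure of the cone \<open>{r y | 0 < r < 1, y \<in> A}\<close>;
  note that \<open>sgn x = x / |x|\<close>.\<close>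

definition sphere_measure :: "'a::euclidean_space measure" where
  "sphere_measure = scale_measure (of_nat DIM('a))
     (distr (lebesgue_on (ball 0 1 - {0})) (restrict_space borel (sphere 0 1)) sgn)"

text \<open>The trace operator on the unit ball is the continuous extension to \<open>H\<^sup>1\<close>, with values in
  \<open>L\<^sup>2\<close> of the sphere, of the restriction map on functions smooth up to the boundary.
  The following relation is its graph: \<open>w\<close> is the trace of \<open>u\<close>.\<close>

definition has_trace :: "('a::euclidean_space \<Rightarrow> real) \<Rightarrow> ('a \<Rightarrow> real) \<Rightarrow> bool" where
  "has_trace u w \<longleftrightarrow>
     u \<in> H1 (ball 0 1) \<and> square_integrable sphere_measure w \<and>
     (\<exists>U \<phi>. has_L2_weak_gradient (ball 0 1) u U \<and> (\<forall>n::nat. smooth (\<phi> n)) \<and>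
        (\<lambda>n. L2_dist_sq (lebesgue_on (ball 0 1)) (\<phi> n) u) \<longlonglongrightarrow> 0 \<and>
        (\<lambda>n. L2_dist_sq (lebesgue_on (ball 0 1)) (gradient (\<phi> n)) U) \<longlonglongrightarrow> 0 \<and>
        (\<lambda>n. L2_dist_sq sphere_measure (\<phi> n) w) \<longlonglongrightarrow> 0)"

section \<open>Iterated logarithms and the potential\<close>

definition X_one :: "real \<Rightarrow> real" where
  "X_one t = 1 / (1 - ln t)"

text \<open>\<open>X j\<close> is meant for \<open>j \<ge> 1\<close>, with \<open>X 1 = X_one\<close>; \<open>X 0\<close> is the identity.\<close>

definition X :: "nat \<Rightarrow> real \<Rightarrow> real" where
  "X j t = (X_one ^^ j) t"

definition Y :: "nat \<Rightarrow> real \<Rightarrow> real" where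
  "Y j r = X j (1 / r)"

definition Y_tilde :: "nat \<Rightarrow> real \<Rightarrow> real" where
  "Y_tilde j r = (if r > 1 then X j (1 / r) else 1)"

text \<open>The value on the unit sphere, a null set, is irrelevant and set to \<open>0\<close>.\<close>

definition V_hat :: "nat \<Rightarrow> real \<Rightarrow> (real^'n \<Rightarrow> real) \<Rightarrow> real^'n \<Rightarrow> real" where
  "V_hat k \<epsilon> g x =
     (if norm x < 1 then \<epsilon> * g x
      else if norm x > 1 then
        ((real CARD('n) - 2) / 2)\<^sup>2 / (norm x)\<^sup>2
        + 1 / (4 * (norm x)\<^sup>2) * (\<Sum>i=1..k. \<Prod>j=1..i. (Y j (norm x))\<^sup>2)
      else 0)"

text \<open>The infimum is taken in \<open>[0, \<infinity>]\<close>, so it is \<open>\<infinity>\<close> over the empty set. The integrals do not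
  depend on the choice of the weak gradient \<open>U\<close> and the trace \<open>w\<close> of \<open>u\<close>, which are unique
  almost everywhere.\<close>

definition eps_bar :: "nat \<Rightarrow> (real^'n \<Rightarrow> real) \<Rightarrow> ennreal" where
  "eps_bar k g = Inf
     {((\<integral>\<^sup>+x. ennreal ((norm (U x))\<^sup>2) \<partial>lebesgue_on (ball 0 1))
        + ennreal ((real CARD('n) - 2 - real k) / 2) * (\<integral>\<^sup>+x. ennreal ((w x)\<^sup>2) \<partial>sphere_measure))
       / (\<integral>\<^sup>+x. ennreal (g x * (u x)\<^sup>2) \<partial>lebesgue_on (ball 0 1))
      | u U w. u \<in> H1 (ball 0 1) \<and> has_L2_weak_gradient (ball 0 1) u U \<and> has_trace u w \<and>
          (\<integral>\<^sup>+x. ennreal (g x * (u x)\<^sup>2) \<partial>lebesgue_on (ball 0 1)) > 0}"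

end

theory Submission
  imports Defs "HOL-Computational_Algebra.Polynomial"
begin

text \<open>Put \<open>d = N - 2\<close>. Outside the ball write \<open>u = \<phi> v\<close> with
  \<open>\<phi> = r\<^bsup>-d/2\<^esup> (Y\<^sub>1 \<dots> Y\<^sub>k)\<^bsup>-1/2\<^esup>\<close>, a positive solution of \<open>-\<Delta>\<phi> = V\<phi>\<close>. Since
  \<open>\<phi>'/\<phi> = -(N - 2 - k)/2\<close> on the unit sphere, the exterior energy is bounded below by
  \<open>(N - 2 - k)/2 \<integral> u\<^sup>2 dS\<close>, and the interior energy together with this boundary term dominates
  \<open>\<epsilon> \<integral> g u\<^sup>2\<close> with room to spare by definition of the infimum. For the Sobolev term one uses the new
  radial variable \<open>\<rho>\<close> with \<open>\<rho>\<^bsup>d\<^esup> = 1/Y\<^bsub>k+1\<^esub>\<close> on the exterior domain and the second solution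
  \<open>\<phi>/Y\<^bsub>k+1\<^esub>\<close>: the function \<open>W\<close> that equals \<open>u\<close> on the ball and \<open>u Y\<^bsub>k+1\<^esub>/\<phi>\<close>, as a function of \<open>\<rho>\<close>,
  outside is continuous, its Dirichlet integral is controlled by the left-hand side, and the
  weighted \<open>L\<^sup>p\<close> integral of \<open>u\<close> becomes the plain one of \<open>W\<close>, so that the Sobolev
  inequality on the whole space applies.\<close>

section \<open>The Sobolev inequality\<close>

lemma weighted_geometric_le_arithmetic_mean:
  fixes g w :: "'j \<Rightarrow> real"
  assumes fin: "finite J" and g: "\<And>j. j \<in> J \<Longrightarrow> 0 < g j"
    and w: "\<And>j. j \<in> J \<Longrightarrow> 0 \<le> w j" "(\<Sum>j\<in>J. w j) = 1"
  shows "(\<Prod>j\<in>J. g j powr w j) \<le> (\<Sum>j\<in>J. w j * g j)"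
proof -
  have ne: "J \<noteq> {}" using w(2) by auto
  have "(\<Prod>j\<in>J. g j powr w j) = (\<Prod>j\<in>J. exp (w j * ln (g j)))"
    by (intro prod.cong refl) (use g in \<open>force simp: powr_def\<close>)
  also have "\<dots> = exp (\<Sum>j\<in>J. w j *\<^sub>R ln (g j))"
    using fin by (simp add: exp_sum)
  also have "\<dots> \<le> (\<Sum>j\<in>J. w j * exp (ln (g j)))"
    by (rule convex_on_sum[OF fin ne exp_convex]) (use w in auto)
  also have "\<dots> = (\<Sum>j\<in>J. w j * g j)"
    by (intro sum.cong refl) (use g in force)
  finally show ?thesis .
qed

lemma Holder_prod:
  fixes F :: "'j \<Rightarrow> 'b \<Rightarrow> real"
  assumes M: "finite_measure M" "measure M (space M) > 0"
    and fin: "finite J"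
    and meas[measurable]: "\<And>j. j \<in> J \<Longrightarrow> F j \<in> borel_measurable M"
    and lo: "0 < lo"
    and bd: "\<And>j x. j \<in> J \<Longrightarrow> x \<in> space M \<Longrightarrow> lo \<le> F j x \<and> F j x \<le> hi"
    and w: "\<And>j. j \<in> J \<Longrightarrow> 0 \<le> w j" "(\<Sum>j\<in>J. w j) = 1"
  shows "(\<integral>x. (\<Prod>j\<in>J. F j x powr w j) \<partial>M) \<le> (\<Prod>j\<in>J. (\<integral>x. F j x \<partial>M) powr w j)"
proof -
  interpret finite_measure M by fact
  have int: "integrable M (F j)" if "j \<in> J" for j
    by (rule integrable_const_bound[where B=hi])
      (use that bd lo in \<open>fastforce intro!: AE_I2 meas\<close>)+
  define c where "c j = (\<integral>x. F j x \<partial>M)" for j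
  have c: "c j > 0" if "j \<in> J" for j
  proof -
    have "0 < (\<integral>x. lo \<partial>M)" using M lo by simp
    also have "\<dots> \<le> c j" unfolding c_def
      by (intro integral_mono int that integrable_const) (use bd that in auto)
    finally show ?thesis .
  qed
  have pw: "(\<Prod>j\<in>J. F j x powr w j) \<le> (\<Prod>j\<in>J. c j powr w j) * (\<Sum>j\<in>J. w j * (F j x / c j))"
    if x: "x \<in> space M" for x
  proof -
    have F: "F j x > 0" if "j \<in> J" for j using bd[OF that x] lo by linarith
    have "(\<Prod>j\<in>J. F j x powr w j) = (\<Prod>j\<in>J. c j powr w j * (F j x / c j) powr w j)"
      by (intro prod.cong refl) (metis F c less_eq_real_def nonzero_mult_div_cancel_left powr_mult
         times_divide_eq_right zero_le_divide_iff less_irrefl)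
    also have "\<dots> = (\<Prod>j\<in>J. c j powr w j) * (\<Prod>j\<in>J. (F j x / c j) powr w j)"
      by (simp add: prod.distrib)
    also have "\<dots> \<le> (\<Prod>j\<in>J. c j powr w j) * (\<Sum>j\<in>J. w j * (F j x / c j))"
      by (intro mult_left_mono weighted_geometric_le_arithmetic_mean fin w prod_nonneg)
        (use c F in auto)
    finally show ?thesis .
  qed
  have ir: "integrable M (\<lambda>x. (\<Prod>j\<in>J. c j powr w j) * (\<Sum>j\<in>J. w j * (F j x / c j)))"
    by (intro integrable_mult_right Bochner_Integration.integrable_sum integrable_divide int)
  have "(\<integral>x. (\<Prod>j\<in>J. F j x powr w j) \<partial>M) \<le> (\<integral>x. (\<Prod>j\<in>J. c j powr w j) * (\<Sum>j\<in>J. w j * (F j x / c j)) \<partial>M)"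
  proof (rule integral_mono[OF _ ir pw])
    show "integrable M (\<lambda>x. \<Prod>j\<in>J. F j x powr w j)"
    proof (rule Bochner_Integration.integrable_bound[OF ir])
      show "(\<lambda>x. \<Prod>j\<in>J. F j x powr w j) \<in> borel_measurable M" by measurable
      show "AE x in M. norm (\<Prod>j\<in>J. F j x powr w j)
          \<le> norm ((\<Prod>j\<in>J. c j powr w j) * (\<Sum>j\<in>J. w j * (F j x / c j)))"
        using pw by (intro AE_I2) (simp add: prod_nonneg abs_of_nonneg order_trans[OF _ abs_ge_self])
    qed
  qed
  also have "\<dots> = (\<Prod>j\<in>J. c j powr w j) * (\<Sum>j\<in>J. w j * (c j / c j))"
    by (subst integral_mult_right_zero, subst Bochner_Integration.integral_sum)
      (auto simp: c_def[symmetric] int simp del: divide_self_if intro!: integrable_divide)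
  also have "\<dots> = (\<Prod>j\<in>J. c j powr w j) * (\<Sum>j\<in>J. w j)"
    by (intro arg_cong2[where f="(*)"] sum.cong refl) (use c in force)
  finally show ?thesis using w by (simp add: c_def)
qed

lemma finite_measure_PiM:
  fixes M0 :: "'b measure"
  assumes M: "finite_measure M0" and I: "finite I"
  shows "finite_measure (PiM I (\<lambda>_. M0))"
    and "measure (PiM I (\<lambda>_. M0)) (space (PiM I (\<lambda>_. M0))) = measure M0 (space M0) ^ card I"
proof -
  interpret finite_measure M0 by fact
  interpret product_sigma_finite "\<lambda>_. M0" by standard
  have *: "emeasure (PiM I (\<lambda>_. M0)) (space (PiM I (\<lambda>_. M0))) = emeasure M0 (space M0) ^ card I"
    unfolding space_PiM by (subst emeasure_PiM) (use I in auto)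
  show "finite_measure (PiM I (\<lambda>_. M0))"
    by standard (simp add: * power_eq_top_ennreal_iff emeasure_eq_measure)
  show "measure (PiM I (\<lambda>_. M0)) (space (PiM I (\<lambda>_. M0))) = measure M0 (space M0) ^ card I"
    unfolding measure_def * by (simp add: emeasure_eq_measure ennreal_power)
qed

text \<open>The inductive step integrates out one coordinate with Hoelder's inequality.
  The lower bound on \<open>f\<close> is there because \<open>0 powr 0 = 0\<close>.\<close>

lemma grid_lines_inequality:
  fixes M0 :: "real measure" and p lo hi :: real
  assumes M: "finite_measure M0" "measure M0 (space M0) > 0" and sp: "space M0 = UNIV"
    and p: "0 \<le> p"
  shows "finite I \<Longrightarrow> f \<in> borel_measurable (PiM I (\<lambda>_. M0)) \<Longrightarrow>
    (\<And>x. x \<in> space (PiM I (\<lambda>_. M0)) \<Longrightarrow> lo \<le> f x \<and> f x \<le> hi) \<Longrightarrow> 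
    (real (card I) - 1) * p \<le> 1 \<Longrightarrow> lo > 0 \<Longrightarrow>
    (\<integral>x. f x powr (1 - (real (card I) - 1) * p) * (\<Prod>i\<in>I. (\<integral>t. f (x(i:=t)) \<partial>M0) powr p) \<partial>PiM I (\<lambda>_. M0))
      \<le> (\<integral>x. f x \<partial>PiM I (\<lambda>_. M0)) powr (1 + p)"
proof (induction I arbitrary: f lo hi rule: finite_induct)
  case empty
  interpret finite_measure M0 by fact
  interpret product_sigma_finite "\<lambda>_. M0" by standard
  show ?case by (simp add: PiM_empty lebesgue_integral_count_space_finite)
next
  case (insert i I f lo hi)
  interpret finite_measure M0 by fact
  interpret product_sigma_finite "\<lambda>_. M0" by standard
  define m where "m = real (card I)"
  define \<mu> where "\<mu> = measure M0 (space M0)"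
  have \<mu>: "\<mu> > 0" using M by (simp add: \<mu>_def)
  let ?P = "PiM I (\<lambda>_. M0)"
  let ?Q = "PiM (insert i I) (\<lambda>_. M0)"
  have cQ: "real (card (insert i I)) - 1 = m" using insert by (simp add: m_def)
  interpret P: finite_measure ?P by (rule finite_measure_PiM[OF M(1) insert(1)])
  interpret Q: finite_measure ?Q by (rule finite_measure_PiM[OF M(1)]) (use insert in auto)
  note fm[measurable] = insert.prems(1)
  have bd: "lo \<le> f x \<and> f x \<le> hi" if "x \<in> space ?Q" for x using insert.prems(2)[OF that] .
  have inQ: "x(i := t) \<in> space ?Q" if "x \<in> space ?P" for x t
    using that insert(2) by (auto simp: space_PiM sp PiE_def extensional_def)
  have inP: "x(j := t) \<in> space ?P" if "x \<in> space ?P" "j \<in> I" for x j t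
    using that by (auto simp: space_PiM sp PiE_def extensional_def)
  have inQ': "x(j := t) \<in> space ?Q" if "x \<in> space ?Q" "j \<in> insert i I" for x j t
    using that by (auto simp: space_PiM sp PiE_def extensional_def)
  define F where "F x = (\<integral>t. f (x(i:=t)) \<partial>M0)" for x
  have m1[measurable]: "(\<lambda>(x,t). f (x(i:=t))) \<in> borel_measurable (?P \<Otimes>\<^sub>M M0)"
    using measurable_compose[OF measurable_add_dim[of i I "\<lambda>_. M0"] fm] by (simp add: split_beta')
  have Fm[measurable]: "F \<in> borel_measurable ?P" unfolding F_def by measurable
  have Qi: "integrable ?Q f"
    by (rule Q.integrable_const_bound[where B=hi])
      (use bd insert.prems(4) in \<open>fastforce intro!: AE_I2\<close>)+
  have fi: "integrable M0 (\<lambda>t. f (x(i:=t)))" if x: "x \<in> space ?P" for x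
  proof (rule integrable_const_bound[where B=hi])
    show "AE t in M0. norm (f (x(i := t))) \<le> hi"
      using bd[OF inQ[OF x]] insert.prems(4) by (intro AE_I2) (smt (verit) real_norm_def)
    show "(\<lambda>t. f (x(i := t))) \<in> borel_measurable M0"
      using measurable_compose_Pair1[OF x m1] by simp
  qed
  have Fbd: "\<mu> * lo \<le> F x \<and> F x \<le> \<mu> * hi" if x: "x \<in> space ?P" for x
  proof -
    have "(\<integral>t. lo \<partial>M0) \<le> F x" "F x \<le> (\<integral>t. hi \<partial>M0)"
      unfolding F_def by (intro integral_mono fi x integrable_const; use bd[OF inQ[OF x]] in simp)+
    then show ?thesis by (simp add: \<mu>_def mult.commute)
  qed
  have IH: "(\<integral>x. F x powr (1 - (m - 1) * p) * (\<Prod>j\<in>I. (\<integral>t. F (x(j:=t)) \<partial>M0) powr p) \<partial>?P)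
      \<le> (\<integral>x. F x \<partial>?P) powr (1 + p)"
    unfolding m_def
  proof (rule insert.IH[OF Fm Fbd])
    have "(real (card I) - 1) * p \<le> real (card I) * p"
      using p by (intro mult_right_mono) auto
    then show "(real (card I) - 1) * p \<le> 1" using insert.prems(3) cQ m_def by auto
    show "0 < \<mu> * lo" using \<mu> insert.prems(4) by simp
  qed
  have FQ: "(\<integral>x. F x \<partial>?P) = (\<integral>x. f x \<partial>?Q)"
    unfolding F_def using product_integral_insert[OF insert(1,2) Qi] by simp
  have upd[measurable]: "(\<lambda>(x,t). f (x(j:=t))) \<in> borel_measurable (?Q \<Otimes>\<^sub>M M0)" if "j \<in> insert i I" for j
  proof -
    have "(\<lambda>z. (fst z)(j := snd z)) \<in> measurable (?Q \<Otimes>\<^sub>M M0) ?Q"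
      by (rule measurable_fun_upd[where J="insert i I"]) (use that in auto)
    from measurable_compose[OF this fm] show ?thesis by (simp add: split_beta' fun_upd_def)
  qed
  define G where "G j x = (\<integral>t. f (x(j:=t)) \<partial>M0)" for j x
  have Gm[measurable]: "G j \<in> borel_measurable ?Q" if "j \<in> insert i I" for j
    unfolding G_def using upd[OF that] by measurable
  have fji: "integrable M0 (\<lambda>t. f (x(j:=t)))" if x: "x \<in> space ?Q" and j: "j \<in> insert i I" for x j
  proof (rule integrable_const_bound[where B=hi])
    show "AE t in M0. norm (f (x(j := t))) \<le> hi"
      using bd[OF inQ'[OF x j]] insert.prems(4) by (intro AE_I2) (smt (verit) real_norm_def)
    show "(\<lambda>t. f (x(j := t))) \<in> borel_measurable M0"
      using measurable_compose_Pair1[OF x upd[OF j]] by simp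
  qed
  have Gbd: "\<mu> * lo \<le> G j x \<and> G j x \<le> \<mu> * hi" if x: "x \<in> space ?Q" and j: "j \<in> insert i I" for x j
  proof -
    have "(\<integral>t. lo \<partial>M0) \<le> G j x" "G j x \<le> (\<integral>t. hi \<partial>M0)"
      unfolding G_def by (intro integral_mono fji x j integrable_const; use bd[OF inQ'[OF x j]] in simp)+
    then show ?thesis by (simp add: \<mu>_def mult.commute)
  qed
  define H where "H x = f x powr (1 - m * p) * (\<Prod>j\<in>insert i I. G j x powr p)" for x
  have Hm[measurable]: "H \<in> borel_measurable ?Q" unfolding H_def by measurable
  have mp: "m * p \<le> 1" using insert.prems(3) cQ by auto
  have m0: "0 \<le> m * p" using p by (simp add: m_def)
  define B where "B = hi powr (1 - m * p) * (\<Prod>j\<in>insert i I. (\<mu> * hi) powr p)"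
  have HB: "0 \<le> H x \<and> H x \<le> B" if x: "x \<in> space ?Q" for x
  proof
    show "0 \<le> H x" by (simp add: H_def prod_nonneg)
    have "0 \<le> G j x" if "j \<in> insert i I" for j
      using Gbd[OF x that] \<mu> insert.prems(4) by (smt (verit) mult_pos_pos)
    then show "H x \<le> B" unfolding H_def B_def
      using bd[OF x] Gbd[OF x] mp insert.prems(4)
      by (intro mult_mono prod_mono conjI powr_mono2 p prod_nonneg) auto
  qed
  have Hi: "integrable ?Q H"
    by (rule Q.integrable_const_bound[where B=B]) (use HB in \<open>auto intro!: AE_I2\<close>)
  have hold: "(\<integral>t. H (x(i:=t)) \<partial>M0) \<le> F x powr (1 - (m - 1) * p) * (\<Prod>j\<in>I. (\<integral>t. F (x(j:=t)) \<partial>M0) powr p)"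
    if x: "x \<in> space ?P" for x
  proof -
    have Gi: "G i (x(i:=t)) = F x" for t by (simp add: G_def F_def)
    define g where "g j t = (if j = i then f (x(i:=t)) else G j (x(i:=t)))" for j t
    define w where "w j = (if j = i then 1 - m * p else p)" for j
    have gi: "g i = (\<lambda>t. f (x(i:=t)))" by (simp add: g_def fun_eq_iff)
    have ins: "(\<Prod>j\<in>I. g j t powr w j) = (\<Prod>j\<in>I. G j (x(i:=t)) powr p)" for t
      by (intro prod.cong refl) (use insert(2) in \<open>auto simp: g_def w_def\<close>)
    have ins2: "(\<Prod>j\<in>I. (\<integral>t. g j t \<partial>M0) powr w j) = (\<Prod>j\<in>I. (\<integral>t. G j (x(i:=t)) \<partial>M0) powr p)"
      by (intro prod.cong refl) (use insert(2) in \<open>auto simp: g_def w_def\<close>)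
    have cm: "(\<lambda>t. x(i:=t)) \<in> measurable M0 ?Q"
      using measurable_compose_Pair1[OF x measurable_add_dim[of i I "\<lambda>_. M0"]] by simp
    have eqH: "H (x(i:=t)) = F x powr p * (\<Prod>j\<in>insert i I. g j t powr w j)" for t
      unfolding H_def using insert(1,2) Gi by (simp add: ins) (simp add: g_def w_def)
    have "(\<integral>t. (\<Prod>j\<in>insert i I. g j t powr w j) \<partial>M0) \<le> (\<Prod>j\<in>insert i I. (\<integral>t. g j t \<partial>M0) powr w j)"
    proof (rule Holder_prod[OF M, where lo="min lo (\<mu> * lo)" and hi="max hi (\<mu> * hi)"])
      show "g j \<in> borel_measurable M0" if "j \<in> insert i I" for j
        unfolding g_def using measurable_compose[OF cm fm] measurable_compose[OF cm Gm[OF that]]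
        by (cases "j = i") (simp_all add: fun_upd_def)
      show "0 < min lo (\<mu> * lo)" using \<mu> insert.prems(4) by simp
      show "min lo (\<mu> * lo) \<le> g j t \<and> g j t \<le> max hi (\<mu> * hi)" if "j \<in> insert i I" for j t
        using bd[OF inQ[OF x]] Gbd[OF inQ[OF x] that] unfolding g_def
        by (auto simp: min_le_iff_disj le_max_iff_disj)
      show "(\<Sum>j\<in>insert i I. w j) = 1"
      proof -
        have "(\<Sum>j\<in>I. w j) = (\<Sum>j\<in>I. p)" by (intro sum.cong refl) (use insert(2) in \<open>auto simp: w_def\<close>)
        then show ?thesis using insert(1,2) by (simp add: w_def m_def)
      qed
    qed (use insert mp p in \<open>auto simp: w_def\<close>)
    also have "\<dots> = F x powr (1 - m * p) * (\<Prod>j\<in>I. (\<integral>t. G j (x(i:=t)) \<partial>M0) powr p)"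
      using insert(1,2) gi by (simp add: ins2) (simp add: w_def F_def)
    finally have "(\<integral>t. H (x(i:=t)) \<partial>M0) \<le> F x powr p * (F x powr (1 - m * p) * (\<Prod>j\<in>I. (\<integral>t. G j (x(i:=t)) \<partial>M0) powr p))"
      unfolding eqH by (simp add: mult_left_mono)
    also have "\<dots> = F x powr (1 - (m - 1) * p) * (\<Prod>j\<in>I. (\<integral>t. G j (x(i:=t)) \<partial>M0) powr p)"
      by (simp add: mult.assoc[symmetric] powr_add[symmetric] algebra_simps)
    also have "(\<Prod>j\<in>I. (\<integral>t. G j (x(i:=t)) \<partial>M0) powr p) = (\<Prod>j\<in>I. (\<integral>t. F (x(j:=t)) \<partial>M0) powr p)"
    proof (intro prod.cong refl arg_cong[where f="\<lambda>z. z powr p"])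
      fix j assume j: "j \<in> I"
      then have ij: "i \<noteq> j" using insert(2) by auto
      interpret pair_sigma_finite M0 M0 by standard
      interpret MM: finite_measure "M0 \<Otimes>\<^sub>M M0" by (rule finite_measure_pair_measure) unfold_locales
      have mm: "(\<lambda>(s,t). f (x(j:=s,i:=t))) \<in> borel_measurable (M0 \<Otimes>\<^sub>M M0)"
      proof -
        have "(\<lambda>z. (x(i := snd z))) \<in> measurable (M0 \<Otimes>\<^sub>M M0) ?Q"
          using measurable_compose[OF measurable_snd cm] .
        then have "(\<lambda>z. (x(i := snd z))(j := fst z)) \<in> measurable (M0 \<Otimes>\<^sub>M M0) ?Q"
          by (rule measurable_fun_upd[rotated]) (use j in auto)
        moreover have "x(j := s, i := t) = x(i := t, j := s)" for s t
          by (rule fun_upd_twist) (use ij in auto)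
        ultimately show ?thesis using measurable_compose[OF _ fm] by (simp add: split_beta')
      qed
      have ii: "integrable (M0 \<Otimes>\<^sub>M M0) (\<lambda>(s,t). f (x(j:=s,i:=t)))"
      proof (rule MM.integrable_const_bound[where B=hi, OF AE_I2 mm])
        fix z :: "real \<times> real"
        have "lo \<le> f (x(j := fst z, i := snd z)) \<and> f (x(j := fst z, i := snd z)) \<le> hi"
          by (rule bd[OF inQ[OF inP[OF x j]]])
        then show "norm (case z of (s, t) \<Rightarrow> f (x(j := s, i := t))) \<le> hi"
          using insert.prems(4) by (simp add: split_beta')
      qed
      have "(\<integral>t. G j (x(i:=t)) \<partial>M0) = (\<integral>t. (\<integral>s. f (x(j:=s,i:=t)) \<partial>M0) \<partial>M0)"
        unfolding G_def using ij by (simp add: fun_upd_twist)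
      also have "\<dots> = (\<integral>s. (\<integral>t. f (x(j:=s,i:=t)) \<partial>M0) \<partial>M0)"
        by (rule Fubini_integral[OF ii])
      finally show "(\<integral>t. G j (x(i:=t)) \<partial>M0) = (\<integral>t. F (x(j:=t)) \<partial>M0)" by (simp add: F_def)
    qed
    finally show ?thesis .
  qed
  have "(\<integral>x. H x \<partial>?Q) = (\<integral>x. (\<integral>t. H (x(i:=t)) \<partial>M0) \<partial>?P)"
    by (rule product_integral_insert[OF insert(1,2) Hi])
  also have "\<dots> \<le> (\<integral>x. F x powr (1 - (m - 1) * p) * (\<Prod>j\<in>I. (\<integral>t. F (x(j:=t)) \<partial>M0) powr p) \<partial>?P)"
  proof (rule integral_mono_AE')
    let ?R = "\<lambda>x. F x powr (1 - (m - 1) * p) * (\<Prod>j\<in>I. (\<integral>t. F (x(j:=t)) \<partial>M0) powr p)"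
    have updP: "(\<lambda>(x,t). F (x(j:=t))) \<in> borel_measurable (?P \<Otimes>\<^sub>M M0)" if "j \<in> I" for j
    proof -
      have "(\<lambda>z. (fst z)(j := snd z)) \<in> measurable (?P \<Otimes>\<^sub>M M0) ?P"
        by (rule measurable_fun_upd[where J="I"]) (use that in auto)
      from measurable_compose[OF this Fm] show ?thesis by (simp add: split_beta' fun_upd_def)
    qed
    have updP'[measurable]: "(\<lambda>x. (\<integral>t. F (x(j:=t)) \<partial>M0)) \<in> borel_measurable ?P" if "j \<in> I" for j
      using updP[OF that] by measurable
    have FF: "0 \<le> (\<integral>t. F (x(j:=t)) \<partial>M0) \<and> (\<integral>t. F (x(j:=t)) \<partial>M0) \<le> \<mu> * (\<mu> * hi)"
      if x: "x \<in> space ?P" and j: "j \<in> I" for x j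
    proof -
      have pos: "0 \<le> F (x(j:=t))" "F (x(j:=t)) \<le> \<mu> * hi" for t
        using Fbd[OF inP[OF x j]] \<mu> insert.prems(4) by (smt (verit) mult_pos_pos)+
      have "integrable M0 (\<lambda>t. F (x(j:=t)))"
      proof (rule integrable_const_bound[where B="\<mu> * hi"])
        show "(\<lambda>t. F (x(j := t))) \<in> borel_measurable M0"
          using measurable_compose_Pair1[OF x updP[OF j]] by simp
      qed (use pos in auto)
      then have "(\<integral>t. F (x(j:=t)) \<partial>M0) \<le> (\<integral>t. \<mu> * hi \<partial>M0)"
        by (intro integral_mono integrable_const) (use pos in auto)
      then show ?thesis using pos by (auto intro!: integral_nonneg_AE AE_I2 simp: \<mu>_def mult.commute)
    qed
    have ex: "1 - (m - 1) * p \<ge> 0" using mp p by (simp add: algebra_simps)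
    show "integrable ?P ?R"
    proof (rule P.integrable_const_bound[where B="(\<mu> * hi) powr (1 - (m - 1) * p) * (\<Prod>j\<in>I. (\<mu> * (\<mu> * hi)) powr p)"])
      show "?R \<in> borel_measurable ?P" by measurable
      show "AE x in ?P. norm (?R x) \<le> (\<mu> * hi) powr (1 - (m - 1) * p) * (\<Prod>j\<in>I. (\<mu> * (\<mu> * hi)) powr p)"
      proof (rule AE_I2)
        fix x assume x: "x \<in> space ?P"
        have "0 \<le> F x" using Fbd[OF x] \<mu> insert.prems(4) by (smt (verit) mult_pos_pos)
        then have "?R x \<le> (\<mu> * hi) powr (1 - (m - 1) * p) * (\<Prod>j\<in>I. (\<mu> * (\<mu> * hi)) powr p)"
          using Fbd[OF x] FF[OF x] ex by (intro mult_mono prod_mono conjI powr_mono2 p prod_nonneg) auto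
        moreover have "0 \<le> ?R x" by (simp add: prod_nonneg)
        ultimately show "norm (?R x) \<le> (\<mu> * hi) powr (1 - (m - 1) * p) * (\<Prod>j\<in>I. (\<mu> * (\<mu> * hi)) powr p)"
          by simp
      qed
    qed
    show "AE x in ?P. (\<integral>t. H (x(i:=t)) \<partial>M0) \<le> ?R x" using hold by (intro AE_I2) auto
    show "AE x in ?P. 0 \<le> ?R x" by (simp add: prod_nonneg)
  qed
  also note IH
  finally show ?case unfolding FQ H_def G_def cQ .
qed

lemma interval_measure_facts:
  fixes R :: real
  assumes "R > 0"
  defines "M0 \<equiv> density lborel (\<lambda>t. ennreal (indicator {-R..R} t))"
  shows "finite_measure M0" "measure M0 (space M0) > 0" "space M0 = UNIV" "sets M0 = sets borel"
proof -
  have e: "emeasure M0 (space M0) = ennreal (2 * R)"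
  proof -
    have "emeasure M0 (space M0) = (\<integral>\<^sup>+t. indicator {-R..R} t \<partial>lborel)"
      unfolding M0_def by (simp add: emeasure_density ennreal_indicator)
    also have "\<dots> = emeasure lborel {-R..R}" by (rule nn_integral_indicator) simp
    finally show ?thesis using assms by simp
  qed
  show "finite_measure M0" by (rule finite_measureI) (simp add: e)
  show "measure M0 (space M0) > 0" unfolding measure_def e using assms by simp
  show "space M0 = UNIV" "sets M0 = sets borel" by (simp_all add: M0_def)
qed

lemma integral_PiM_interval:
  fixes h :: "'a::euclidean_space \<Rightarrow> real"
  assumes R: "R > 0" and h[measurable]: "h \<in> borel_measurable borel"
  defines "M0 \<equiv> density lborel (\<lambda>t. ennreal (indicator {-R..R} t))"
  shows "(\<lambda>f. h (\<Sum>b\<in>Basis. f b *\<^sub>R b)) \<in> borel_measurable (PiM Basis (\<lambda>_. M0))"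
    and "(\<And>x b. b \<in> Basis \<Longrightarrow> \<bar>x \<bullet> b\<bar> > R \<Longrightarrow> h x = 0) \<Longrightarrow>
      (\<integral>f. h (\<Sum>b\<in>Basis. f b *\<^sub>R b) \<partial>PiM Basis (\<lambda>_. M0)) = (\<integral>x. h x \<partial>lborel)"
proof -
  interpret fm: finite_measure M0 unfolding M0_def by (rule interval_measure_facts[OF R])
  have sM0[measurable_cong]: "sets M0 = sets borel" by (simp add: M0_def)
  interpret product_sigma_finite "\<lambda>_::'a. M0" by standard
  interpret L: product_sigma_finite "\<lambda>_::'a. lborel :: real measure" by standard
  let ?L = "PiM (Basis :: 'a set) (\<lambda>_. lborel :: real measure)"
  define D where "D f = (\<Prod>b\<in>(Basis :: 'a set). indicator {-R..R} (f b) :: real)" for f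
  have Dm[measurable]: "D \<in> borel_measurable ?L" unfolding D_def by measurable
  have eq: "density ?L (\<lambda>f. ennreal (D f)) = PiM Basis (\<lambda>_. M0)"
  proof (rule PiM_eqI)
    show "sets (density ?L (\<lambda>f. ennreal (D f))) = sets (PiM Basis (\<lambda>_. M0))"
      by (simp add: sM0 cong: sets_PiM_cong)
    fix A :: "'a \<Rightarrow> real set" assume A: "\<And>i. i \<in> Basis \<Longrightarrow> A i \<in> sets M0"
    then have A'[measurable]: "i \<in> Basis \<Longrightarrow> A i \<in> sets borel" for i by (simp add: sM0)
    have PA: "Pi\<^sub>E Basis A \<in> sets ?L" by (rule sets_PiM_I_finite) (use A' in auto)
    have "emeasure (density ?L (\<lambda>f. ennreal (D f))) (Pi\<^sub>E Basis A) = (\<integral>\<^sup>+f. ennreal (D f) * indicator (Pi\<^sub>E Basis A) f \<partial>?L)"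
      by (rule emeasure_density) (use PA in auto)
    also have "\<dots> = (\<integral>\<^sup>+f. indicator (Pi\<^sub>E Basis (\<lambda>b. A b \<inter> {-R..R})) f \<partial>?L)"
    proof (rule nn_integral_cong)
      fix f assume f: "f \<in> space ?L"
      show "ennreal (D f) * indicator (Pi\<^sub>E Basis A) f = indicator (Pi\<^sub>E Basis (\<lambda>b. A b \<inter> {-R..R})) f"
      proof (cases "\<forall>b\<in>Basis. f b \<in> {-R..R}")
        case True
        then show ?thesis by (auto simp: D_def split: split_indicator)
      next
        case False
        then have "D f = 0" unfolding D_def by (subst prod_zero_iff) (auto simp: indicator_def)
        then show ?thesis using False by (auto split: split_indicator)
      qed
    qed
    also have "\<dots> = emeasure ?L (Pi\<^sub>E Basis (\<lambda>b. A b \<inter> {-R..R}))"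
      by (rule nn_integral_indicator) (rule sets_PiM_I_finite, use A' in auto)
    also have "\<dots> = (\<Prod>b\<in>Basis. emeasure lborel (A b \<inter> {-R..R}))"
      by (rule L.emeasure_PiM) (use A' in auto)
    also have "\<dots> = (\<Prod>i\<in>Basis. emeasure M0 (A i))"
    proof (rule prod.cong[OF refl])
      fix b :: 'a assume b: "b \<in> Basis"
      have "emeasure M0 (A b) = (\<integral>\<^sup>+t. indicator {-R..R} t * indicator (A b) t \<partial>lborel)"
        unfolding M0_def using A'[OF b] by (simp add: emeasure_density ennreal_indicator)
      also have "\<dots> = (\<integral>\<^sup>+t. indicator (A b \<inter> {-R..R}) t \<partial>lborel)"
        by (intro nn_integral_cong) (auto split: split_indicator)
      also have "\<dots> = emeasure lborel (A b \<inter> {-R..R})" by (rule nn_integral_indicator) (use A'[OF b] in auto)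
      finally show "emeasure lborel (A b \<inter> {-R..R}) = emeasure M0 (A b)" by simp
    qed
    finally show "emeasure (density ?L (\<lambda>f. ennreal (D f))) (Pi\<^sub>E Basis A) = (\<Prod>i\<in>Basis. emeasure M0 (A i))" .
  qed simp
  have psi: "(\<lambda>f. \<Sum>b\<in>Basis. f b *\<^sub>R b :: 'a) \<in> measurable ?L borel" by measurable
  have m: "(\<lambda>f. h (\<Sum>b\<in>Basis. f b *\<^sub>R b)) \<in> borel_measurable ?L" using psi by measurable
  then show "(\<lambda>f. h (\<Sum>b\<in>Basis. f b *\<^sub>R b)) \<in> borel_measurable (PiM Basis (\<lambda>_. M0))"
    unfolding eq[symmetric] by simp
  assume z: "\<And>x b. b \<in> Basis \<Longrightarrow> \<bar>x \<bullet> b\<bar> > R \<Longrightarrow> h x = 0"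
  have co: "(\<Sum>b\<in>Basis. f b *\<^sub>R b) \<bullet> c = f c" if "c \<in> Basis" for f :: "'a \<Rightarrow> real" and c
    using that by (simp add: inner_sum_left inner_Basis if_distrib cong: if_cong)
  have D1: "D f *\<^sub>R h (\<Sum>b\<in>Basis. f b *\<^sub>R b) = h (\<Sum>b\<in>Basis. f b *\<^sub>R b)" for f
  proof (cases "\<forall>b\<in>Basis. f b \<in> {-R..R}")
    case True
    then have "D f = 1" by (auto simp: D_def)
    then show ?thesis by simp
  next
    case False
    then obtain b where "b \<in> Basis" "\<bar>f b\<bar> > R" by force
    then have "h (\<Sum>b\<in>Basis. f b *\<^sub>R b) = 0" using z[of b "\<Sum>b\<in>Basis. f b *\<^sub>R b"] co by auto
    then show ?thesis by simp
  qed
  have "(\<integral>f. h (\<Sum>b\<in>Basis. f b *\<^sub>R b) \<partial>PiM Basis (\<lambda>_. M0)) = (\<integral>f. D f *\<^sub>R h (\<Sum>b\<in>Basis. f b *\<^sub>R b) \<partial>?L)"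
    unfolding eq[symmetric] by (rule integral_density[OF m Dm]) (auto simp: D_def prod_nonneg)
  also have "\<dots> = (\<integral>f. h (\<Sum>b\<in>Basis. f b *\<^sub>R b) \<partial>?L)" by (simp only: D1)
  also have "\<dots> = (\<integral>x. h x \<partial>distr ?L borel (\<lambda>f. \<Sum>b\<in>Basis. f b *\<^sub>R b))"
    by (rule integral_distr[OF psi h, symmetric])
  also have "\<dots> = (\<integral>x. h x \<partial>lborel)" by (subst lborel_eq) simp
  finally show "(\<integral>f. h (\<Sum>b\<in>Basis. f b *\<^sub>R b) \<partial>PiM Basis (\<lambda>_. M0)) = (\<integral>x. h x \<partial>lborel)" .
qed

lemma Gagliardo_Nirenberg_lines:
  fixes h f :: "'a::euclidean_space \<Rightarrow> real"
  assumes R: "R > 0" and N: "DIM('a) \<ge> 2"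
    and [measurable]: "h \<in> borel_measurable borel" "f \<in> borel_measurable borel"
    and h0: "\<And>x. 0 \<le> h x" and f: "\<And>x. 0 \<le> f x" "\<And>x. f x \<le> C"
    and z: "\<And>x b. b \<in> Basis \<Longrightarrow> \<bar>x \<bullet> b\<bar> > R \<Longrightarrow> h x = 0 \<and> f x = 0"
    and line: "\<And>x b. b \<in> Basis \<Longrightarrow> h x \<le> (\<integral>t. indicator {-R..R} t * f (x + (t - x \<bullet> b) *\<^sub>R b) \<partial>lborel)"
  shows "(\<integral>x. h x powr (real DIM('a) / (real DIM('a) - 1)) \<partial>lborel)
     \<le> (\<integral>x. f x \<partial>lborel) powr (real DIM('a) / (real DIM('a) - 1))"
proof -
  define M0 where "M0 = density lborel (\<lambda>t. ennreal (indicator {-R..R} t))"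
  note MF = interval_measure_facts[OF R, folded M0_def]
  interpret M0: finite_measure M0 by (rule MF)
  let ?P = "PiM (Basis :: 'a set) (\<lambda>_. M0)"
  interpret P: finite_measure ?P by (rule finite_measure_PiM[OF MF(1)]) simp
  define \<psi> where "\<psi> f = (\<Sum>b\<in>(Basis::'a set). f b *\<^sub>R b)" for f :: "'a \<Rightarrow> real"
  define n where "n = real DIM('a)"
  define p where "p = 1 / (n - 1)"
  define \<mu> where "\<mu> = measure ?P (space ?P)"
  have n2: "n \<ge> 2" using N by (simp add: n_def)
  have p: "p > 0" "(n - 1) * p = 1" "1 + p = n / (n - 1)" "p * n = n / (n - 1)"
    using n2 by (auto simp: p_def field_simps)
  have co: "\<psi> f \<bullet> c = f c" if "c \<in> Basis" for f c
    using that by (simp add: \<psi>_def inner_sum_left inner_Basis if_distrib cong: if_cong)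
  have upd: "\<psi> (x(b := t)) = \<psi> x + (t - \<psi> x \<bullet> b) *\<^sub>R b" if "b \<in> Basis" for x b t
    by (rule euclidean_eqI) (use that in \<open>auto simp: co inner_simps inner_Basis\<close>)
  have C: "0 \<le> C" using f order_trans by blast
  have fm[measurable]: "(\<lambda>x. f (\<psi> x)) \<in> borel_measurable ?P" and hm[measurable]: "(\<lambda>x. h (\<psi> x)) \<in> borel_measurable ?P"
    unfolding \<psi>_def M0_def by (auto intro!: integral_PiM_interval R assms)
  have fi: "integrable ?P (\<lambda>x. f (\<psi> x))"
    by (rule P.integrable_const_bound[where B=C]) (use f in auto)
  have key: "(\<integral>x. h x powr (n / (n - 1)) \<partial>lborel) \<le> ((\<integral>x. f x \<partial>lborel) + e * \<mu>) powr (1 + p)" if e: "e > 0" for e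
  proof -
    have fe: "(\<lambda>x. f (\<psi> x) + e) \<in> borel_measurable ?P" by measurable
    have "(\<integral>x. h x powr (n / (n - 1)) \<partial>lborel) = (\<integral>x. h (\<psi> x) powr (n / (n - 1)) \<partial>?P)"
      unfolding \<psi>_def M0_def by (rule integral_PiM_interval(2)[symmetric, OF R]) (use z in auto)
    also have "\<dots> \<le> (\<integral>x. (f (\<psi> x) + e) powr (1 - (real DIM('a) - 1) * p) * (\<Prod>b\<in>Basis. (\<integral>t. f (\<psi> (x(b:=t))) + e \<partial>M0) powr p) \<partial>?P)"
    proof (rule integral_mono_AE')
      let ?B = "measure M0 (space M0) * (C + e)"
      have upm: "(\<lambda>(x,t). f (\<psi> (x(b:=t))) + e) \<in> borel_measurable (?P \<Otimes>\<^sub>M M0)" if "b \<in> Basis" for b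
      proof -
        have "(\<lambda>z. (fst z)(b := snd z)) \<in> measurable (?P \<Otimes>\<^sub>M M0) ?P"
          by (rule measurable_fun_upd[where J="Basis"]) (use that in auto)
        from measurable_compose[OF this fm] show ?thesis by (simp add: split_beta' fun_upd_def)
      qed
      have upm'[measurable]: "(\<lambda>x. (\<integral>t. f (\<psi> (x(b:=t))) + e \<partial>M0)) \<in> borel_measurable ?P" if "b \<in> Basis" for b
        using upm[OF that] by measurable
      have fib: "integrable M0 (\<lambda>t. f (\<psi> (x(b:=t))) + e)" if x: "x \<in> space ?P" and b: "b \<in> Basis" for x b
      proof (rule M0.integrable_const_bound[where B="C+e"])
        show "(\<lambda>t. f (\<psi> (x(b := t))) + e) \<in> borel_measurable M0"
          using measurable_compose_Pair1[OF x upm[OF b]] by simp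
      qed (use f e in auto)
      have ub: "(\<integral>t. f (\<psi> (x(b:=t))) + e \<partial>M0) \<le> ?B" "0 \<le> (\<integral>t. f (\<psi> (x(b:=t))) + e \<partial>M0)"
         "h (\<psi> x) \<le> (\<integral>t. f (\<psi> (x(b:=t))) + e \<partial>M0)"
        if x: "x \<in> space ?P" and b: "b \<in> Basis" for x b
      proof -
        have "(\<integral>t. f (\<psi> (x(b:=t))) + e \<partial>M0) \<le> (\<integral>t. C + e \<partial>M0)"
          by (intro integral_mono fib x b) (use f in auto)
        then show "(\<integral>t. f (\<psi> (x(b:=t))) + e \<partial>M0) \<le> ?B" by simp
        show "0 \<le> (\<integral>t. f (\<psi> (x(b:=t))) + e \<partial>M0)" using f e by (intro integral_nonneg_AE AE_I2) auto
        have mm: "(\<lambda>t. f (\<psi> x + (t - \<psi> x \<bullet> b) *\<^sub>R b)) \<in> borel_measurable borel" by measurable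
        have "h (\<psi> x) \<le> (\<integral>t. indicator {-R..R} t * f (\<psi> x + (t - \<psi> x \<bullet> b) *\<^sub>R b) \<partial>lborel)"
          by (rule line[OF b])
        also have "\<dots> = (\<integral>t. f (\<psi> (x(b:=t))) \<partial>M0)"
          unfolding M0_def using mm by (subst integral_density) (auto simp: upd[OF b])
        also have "\<dots> \<le> (\<integral>t. f (\<psi> (x(b:=t))) + e \<partial>M0)"
          by (rule integral_mono_AE'[OF fib[OF x b]]) (use f e in auto)
        finally show "h (\<psi> x) \<le> (\<integral>t. f (\<psi> (x(b:=t))) + e \<partial>M0)" .
      qed
      have one: "(f (\<psi> x) + e) powr (1 - (real DIM('a) - 1) * p) = 1" for x
        using p(2) f(1)[of "\<psi> x"] e by (simp add: n_def)
      show "integrable ?P (\<lambda>x. (f (\<psi> x) + e) powr (1 - (real DIM('a) - 1) * p) * (\<Prod>b\<in>Basis. (\<integral>t. f (\<psi> (x(b:=t))) + e \<partial>M0) powr p))"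
      proof (rule P.integrable_const_bound[where B="\<Prod>b\<in>(Basis::'a set). ?B powr p"])
        show "AE x in ?P. norm ((f (\<psi> x) + e) powr (1 - (real DIM('a) - 1) * p) * (\<Prod>b\<in>Basis. (\<integral>t. f (\<psi> (x(b:=t))) + e \<partial>M0) powr p)) \<le> (\<Prod>b\<in>(Basis::'a set). ?B powr p)"
          unfolding one using ub p(1)
          by (intro AE_I2) (auto simp: abs_of_nonneg prod_nonneg simp del: prod_constant intro!: prod_mono powr_mono2)
      qed measurable
      show "AE x in ?P. h (\<psi> x) powr (n / (n - 1)) \<le> (f (\<psi> x) + e) powr (1 - (real DIM('a) - 1) * p) * (\<Prod>b\<in>Basis. (\<integral>t. f (\<psi> (x(b:=t))) + e \<partial>M0) powr p)"
      proof (rule AE_I2)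
        fix x assume x: "x \<in> space ?P"
        have "h (\<psi> x) powr (n / (n - 1)) = (\<Prod>b\<in>(Basis::'a set). h (\<psi> x) powr p)"
          by (simp only: p(4)[symmetric] prod_constant) (simp add: n_def powr_powr[symmetric] powr_realpow')
        also have "\<dots> \<le> (\<Prod>b\<in>Basis. (\<integral>t. f (\<psi> (x(b:=t))) + e \<partial>M0) powr p)"
          using h0 ub(3)[OF x] p(1) by (intro prod_mono conjI powr_mono2) auto
        finally show "h (\<psi> x) powr (n / (n - 1)) \<le> (f (\<psi> x) + e) powr (1 - (real DIM('a) - 1) * p) * (\<Prod>b\<in>Basis. (\<integral>t. f (\<psi> (x(b:=t))) + e \<partial>M0) powr p)"
          by (simp only: one mult_1)
      qed
      show "AE x in ?P. 0 \<le> (f (\<psi> x) + e) powr (1 - (real DIM('a) - 1) * p) * (\<Prod>b\<in>Basis. (\<integral>t. f (\<psi> (x(b:=t))) + e \<partial>M0) powr p)"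
        by (simp add: prod_nonneg)
    qed
    also have "\<dots> \<le> (\<integral>x. f (\<psi> x) + e \<partial>?P) powr (1 + p)"
      by (rule grid_lines_inequality[OF MF(1-3) _ _ fe, where lo=e and hi="C + e"]) (use e f p in \<open>auto simp: n_def\<close>)
    also have "(\<integral>x. f (\<psi> x) + e \<partial>?P) = (\<integral>x. f (\<psi> x) \<partial>?P) + e * \<mu>"
      by (subst Bochner_Integration.integral_add[OF fi]) (auto simp: \<mu>_def)
    also have "(\<integral>x. f (\<psi> x) \<partial>?P) = (\<integral>x. f x \<partial>lborel)"
      unfolding \<psi>_def M0_def by (rule integral_PiM_interval(2)[OF R]) (use z in auto)
    finally show ?thesis .
  qed
  have f0: "0 \<le> (\<integral>x. f x \<partial>lborel)" using f by (intro integral_nonneg_AE) auto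
  have "((\<lambda>e. ((\<integral>x. f x \<partial>lborel) + e * \<mu>) powr (1 + p)) \<longlongrightarrow> ((\<integral>x. f x \<partial>lborel) + 0 * \<mu>) powr (1 + p)) (at_right 0)"
    using p(1) f0 by (intro tendsto_powr2 tendsto_intros tendsto_const)
      (auto intro!: tendsto_eq_intros eventually_at_right_less simp: eventually_at_filter \<mu>_def)
  then have "(\<integral>x. h x powr (n / (n - 1)) \<partial>lborel) \<le> ((\<integral>x. f x \<partial>lborel) + 0 * \<mu>) powr (1 + p)"
    by (rule tendsto_lowerbound) (auto simp: eventually_at_right_field intro!: exI[of _ 1] key)
  then show ?thesis using p(3) by (simp add: n_def)
qed

lemma has_real_derivative_abs_powr:
  assumes \<gamma>: "\<gamma> > 1"
  shows "((\<lambda>y. \<bar>y\<bar> powr \<gamma>) has_real_derivative \<gamma> * \<bar>y\<bar> powr (\<gamma> - 1) * sgn y) (at y)"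
proof (cases y "0::real" rule: linorder_cases)
  case greater
  have "((\<lambda>y. y powr \<gamma>) has_real_derivative \<gamma> * \<bar>y\<bar> powr (\<gamma> - 1) * sgn y) (at y)"
    using greater by (auto intro!: derivative_eq_intros)
  moreover have "\<forall>\<^sub>F x in nhds y. x powr \<gamma> = \<bar>x\<bar> powr \<gamma>"
    using eventually_nhds_in_open[of "{0<..}" y] greater by (auto elim!: eventually_mono)
  ultimately show ?thesis by (subst DERIV_cong_ev[OF refl _ refl, symmetric]) auto
next
  case less
  have "((\<lambda>y. (-y) powr \<gamma>) has_real_derivative \<gamma> * \<bar>y\<bar> powr (\<gamma> - 1) * sgn y) (at y)"
    using less by (auto intro!: derivative_eq_intros)
  moreover have "\<forall>\<^sub>F x in nhds y. (-x) powr \<gamma> = \<bar>x\<bar> powr \<gamma>"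
    using eventually_nhds_in_open[of "{..<0}" y] less by (auto elim!: eventually_mono)
  ultimately show ?thesis by (subst DERIV_cong_ev[OF refl _ refl, symmetric]) auto
next
  case equal
  have "((\<lambda>h. \<bar>h\<bar> powr (\<gamma> - 1)) \<longlongrightarrow> 0) (at (0::real))"
    using \<gamma> by (intro tendsto_zero_powrI[where b="\<gamma> - 1"]) (auto intro!: tendsto_eq_intros)
  then have "((\<lambda>h. \<bar>\<bar>h\<bar> powr \<gamma> / h\<bar>) \<longlongrightarrow> 0) (at (0::real))"
  proof (rule Lim_transform_eventually)
    show "\<forall>\<^sub>F h in at (0::real). \<bar>h\<bar> powr (\<gamma> - 1) = \<bar>\<bar>h\<bar> powr \<gamma> / h\<bar>"
      by (auto simp: eventually_at_filter powr_diff)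
  qed
  then have "((\<lambda>h. \<bar>h\<bar> powr \<gamma> / h) \<longlongrightarrow> 0) (at (0::real))"
    by (rule tendsto_rabs_zero_cancel)
  then show ?thesis using equal \<gamma> by (simp add: DERIV_def)
qed

lemma line_meets_sphere_finite:
  fixes x b :: "'a::euclidean_space"
  assumes b: "b \<in> Basis"
  shows "finite {t. norm (x + (t - x \<bullet> b) *\<^sub>R b) = 1}"
proof -
  define y where "y = x - (x \<bullet> b) *\<^sub>R b"
  have yb: "y \<bullet> b = 0" using b by (simp add: y_def inner_simps)
  have "{t. norm (x + (t - x \<bullet> b) *\<^sub>R b) = 1} \<subseteq> {sqrt (1 - (norm y)\<^sup>2), - sqrt (1 - (norm y)\<^sup>2)}"
  proof
    fix t assume "t \<in> {t. norm (x + (t - x \<bullet> b) *\<^sub>R b) = 1}"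
    then have "norm (y + t *\<^sub>R b) = 1" by (simp add: y_def algebra_simps)
    then have "(y + t *\<^sub>R b) \<bullet> (y + t *\<^sub>R b) = 1" by (simp add: norm_eq_sqrt_inner)
    then have "y \<bullet> y + t * t = 1" using b yb by (simp add: inner_simps inner_commute)
    then have "t\<^sup>2 = 1 - (norm y)\<^sup>2" using power2_norm_eq_inner[of y] power2_eq_square[of t] by linarith
    then have "\<bar>t\<bar> = sqrt (1 - (norm y)\<^sup>2)" by (metis real_sqrt_abs)
    then show "t \<in> {sqrt (1 - (norm y)\<^sup>2), - sqrt (1 - (norm y)\<^sup>2)}" by auto
  qed
  then show ?thesis by (rule finite_subset) simp
qed

lemma abs_powr_le_line_integral:
  fixes u :: "'a::euclidean_space \<Rightarrow> real" and G :: "'a \<Rightarrow> 'a"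
  assumes \<gamma>: "\<gamma> > 1" and b: "b \<in> Basis" and R: "R > 0"
    and cont: "continuous_on UNIV u" and supp: "\<And>x. norm x \<ge> R \<Longrightarrow> u x = 0"
    and der: "\<And>x. norm x \<noteq> 1 \<Longrightarrow> (u has_derivative (\<lambda>v. G x \<bullet> v)) (at x)"
    and Gm[measurable]: "G \<in> borel_measurable borel"
    and bd: "\<And>x. \<gamma> * \<bar>u x\<bar> powr (\<gamma> - 1) * norm (G x) \<le> C"
  shows "\<bar>u x\<bar> powr \<gamma> \<le> (\<integral>t. indicator {-R..R} t * (\<gamma> * \<bar>u (x + (t - x \<bullet> b) *\<^sub>R b)\<bar> powr (\<gamma> - 1)
      * norm (G (x + (t - x \<bullet> b) *\<^sub>R b))) \<partial>lborel)"
proof -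
  define l where "l t = x + (t - x \<bullet> b) *\<^sub>R b" for t
  define F where "F t = \<gamma> * \<bar>u (l t)\<bar> powr (\<gamma> - 1) * norm (G (l t))" for t
  have [measurable]: "u \<in> borel_measurable borel" using cont by (rule borel_measurable_continuous_onI)
  have lm[measurable]: "l \<in> borel_measurable borel" unfolding l_def by measurable
  have Fm[measurable]: "F \<in> borel_measurable borel" unfolding F_def by measurable
  have F0: "0 \<le> F t" for t using \<gamma> by (simp add: F_def)
  have FC: "F t \<le> C" for t using bd by (simp add: F_def)
  have lb: "l t \<bullet> b = t" for t using b by (simp add: l_def inner_simps)
  have lx: "l (x \<bullet> b) = x" by (simp add: l_def)
  have int: "set_integrable lborel {c..d} F" for c d
    unfolding set_integrable_def real_scaleR_def
    by (rule Bochner_Integration.integrable_bound[where f="\<lambda>t. C * indicator {c..d} t"])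
      (use F0 FC in \<open>auto split: split_indicator intro!: integrable_real_indicator simp: emeasure_lborel_Icc_eq order_trans[OF F0 FC]\<close>)
  have rhs: "(\<integral>t. indicator {-R..R} t * F t \<partial>lborel) = integral {-R..R} F"
    using set_borel_integral_eq_integral(2)[OF int] by (simp add: set_lebesgue_integral_def)
  show ?thesis
  proof (cases "x \<bullet> b \<in> {-R..R}")
    case False
    then have "\<bar>x \<bullet> b\<bar> > R" by auto
    then have "norm x \<ge> R" using Basis_le_norm[OF b, of x] by linarith
    then show ?thesis using supp F0 \<gamma>
      by (simp add: F_def[symmetric] l_def[symmetric] integral_nonneg_AE)
  next
    case True
    let ?S = "{t. norm (l t) = 1}"
    define \<phi> where "\<phi> t = \<gamma> * \<bar>u (l t)\<bar> powr (\<gamma> - 1) * sgn (u (l t)) * (G (l t) \<bullet> b)" for t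
    have clc: "continuous_on A l" for A unfolding l_def by (intro continuous_intros)
    have uc: "continuous_on A (\<lambda>t. u (l t))" for A
      by (rule continuous_on_compose2[OF cont clc]) auto
    have "(\<phi> has_integral \<bar>u (l (x \<bullet> b))\<bar> powr \<gamma> - \<bar>u (l (-R))\<bar> powr \<gamma>) {-R..x \<bullet> b}"
    proof (rule fundamental_theorem_of_calculus_interior_strong)
      show "finite ?S" unfolding l_def by (rule line_meets_sphere_finite[OF b])
      show "-R \<le> x \<bullet> b" using True by simp
      show "continuous_on {-R..x \<bullet> b} (\<lambda>t. \<bar>u (l t)\<bar> powr \<gamma>)"
        by (rule continuous_on_powr') (use \<gamma> in \<open>auto intro!: continuous_intros uc\<close>)
      fix t assume t: "t \<in> {-R<..<x \<bullet> b} - ?S"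
      have dl: "(l has_derivative (\<lambda>s. s *\<^sub>R b)) (at t)"
        unfolding l_def by (auto intro!: derivative_eq_intros)
      have "((\<lambda>t. u (l t)) has_derivative (\<lambda>s. G (l t) \<bullet> (s *\<^sub>R b))) (at t)"
        using diff_chain_at[OF dl der[of "l t"]] t by (simp add: o_def)
      then have "((\<lambda>t. u (l t)) has_real_derivative G (l t) \<bullet> b) (at t)"
        by (simp add: has_field_derivative_def mult.commute[of _ "G (l t) \<bullet> b"] mult_commute_abs)
      from DERIV_chain2[OF has_real_derivative_abs_powr[OF \<gamma>] this]
      show "((\<lambda>t. \<bar>u (l t)\<bar> powr \<gamma>) has_vector_derivative \<phi> t) (at t)"
        unfolding \<phi>_def has_real_derivative_iff_has_vector_derivative .
    qed
    moreover have "norm (l (-R)) \<ge> R" using Basis_le_norm[OF b, of "l (-R)"] R by (simp add: lb)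
    ultimately have I1: "(\<phi> has_integral \<bar>u x\<bar> powr \<gamma>) {-R..x \<bullet> b}" using supp \<gamma> lx by simp
    have I2: "(F has_integral integral {-R..x \<bullet> b} F) {-R..x \<bullet> b}"
      by (rule integrable_integral) (rule set_borel_integral_eq_integral(1)[OF int])
    have "\<bar>u x\<bar> powr \<gamma> \<le> integral {-R..x \<bullet> b} F"
    proof (rule has_integral_le[OF I1 I2])
      fix t
      have "\<phi> t \<le> \<bar>\<phi> t\<bar>" by simp
      also have "\<dots> = \<gamma> * \<bar>u (l t)\<bar> powr (\<gamma> - 1) * \<bar>sgn (u (l t))\<bar> * \<bar>G (l t) \<bullet> b\<bar>"
        using \<gamma> by (simp add: \<phi>_def abs_mult)
      also have "\<dots> \<le> \<gamma> * \<bar>u (l t)\<bar> powr (\<gamma> - 1) * 1 * norm (G (l t))"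
        by (intro mult_mono) (use \<gamma> Basis_le_norm[OF b] in \<open>auto simp: abs_sgn_eq\<close>)
      finally show "\<phi> t \<le> F t" by (simp add: F_def)
    qed
    also have "\<dots> \<le> integral {-R..R} F"
      by (rule integral_subset_le) (use True F0 set_borel_integral_eq_integral(1)[OF int] in auto)
    finally show ?thesis using rhs by (simp add: F_def l_def)
  qed
qed

lemma integral_mult_le_sqrt:
  fixes f g :: "'b \<Rightarrow> real"
  assumes f: "integrable M (\<lambda>x. (f x)\<^sup>2)" and g: "integrable M (\<lambda>x. (g x)\<^sup>2)"
    and fg: "integrable M (\<lambda>x. f x * g x)"
  shows "(\<integral>x. f x * g x \<partial>M) \<le> sqrt (\<integral>x. (f x)\<^sup>2 \<partial>M) * sqrt (\<integral>x. (g x)\<^sup>2 \<partial>M)"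
proof -
  define A where "A = (\<integral>x. (f x)\<^sup>2 \<partial>M)"
  define B where "B = (\<integral>x. (g x)\<^sup>2 \<partial>M)"
  define D where "D = (\<integral>x. f x * g x \<partial>M)"
  have AB: "0 \<le> A" "0 \<le> B" by (auto simp: A_def B_def)
  have q: "2 * D * t \<le> A + B * t\<^sup>2" for t
  proof -
    have "(\<integral>x. 2 * t * (f x * g x) \<partial>M) \<le> (\<integral>x. (f x)\<^sup>2 + t\<^sup>2 * (g x)\<^sup>2 \<partial>M)"
    proof (intro integral_mono)
      fix x
      have "0 \<le> (f x - t * g x)\<^sup>2" by simp
      then show "2 * t * (f x * g x) \<le> (f x)\<^sup>2 + t\<^sup>2 * (g x)\<^sup>2"
        by (simp add: power2_eq_square algebra_simps)
    qed (use f g fg in auto)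
    also have "\<dots> = A + t\<^sup>2 * B" unfolding A_def B_def using f g by simp
    also have "(\<integral>x. 2 * t * (f x * g x) \<partial>M) = 2 * t * D"
      unfolding D_def by (rule integral_mult_right_zero)
    finally show ?thesis by (simp add: mult_ac)
  qed
  have "D\<^sup>2 \<le> A * B"
  proof (cases "B = 0")
    case True
    have "D = 0"
    proof (rule ccontr)
      assume "D \<noteq> 0"
      have "2 * D * ((A + 1) / D) \<le> A" using q[of "(A + 1) / D"] True by simp
      then show False using \<open>D \<noteq> 0\<close> AB by simp
    qed
    then show ?thesis using AB by simp
  next
    case False
    then have "B > 0" using AB by simp
    then show ?thesis using q[of "D / B"] by (simp add: power2_eq_square field_simps)
  qed
  then have "D \<le> sqrt (A * B)" by (rule real_le_rsqrt)
  then show ?thesis by (simp add: A_def B_def D_def real_sqrt_mult)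
qed

theorem Sobolev_inequality:
  fixes u :: "'a::euclidean_space \<Rightarrow> real" and G :: "'a \<Rightarrow> 'a"
  assumes N: "DIM('a) \<ge> 3" and R: "R > 0"
    and cont: "continuous_on UNIV u" and supp: "\<And>x. norm x \<ge> R \<Longrightarrow> u x = 0 \<and> G x = 0"
    and der: "\<And>x. norm x \<noteq> 1 \<Longrightarrow> (u has_derivative (\<lambda>v. G x \<bullet> v)) (at x)"
    and Gm[measurable]: "G \<in> borel_measurable borel"
    and GB: "\<And>x. norm (G x) \<le> B"
  defines "n \<equiv> real DIM('a)"
  shows "(\<integral>x. \<bar>u x\<bar> powr (2 * n / (n - 2)) \<partial>lborel) powr ((n - 2) / n)
    \<le> (2 * (n - 1) / (n - 2))\<^sup>2 * (\<integral>x. (norm (G x))\<^sup>2 \<partial>lborel)"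
    and "integrable lborel (\<lambda>x. \<bar>u x\<bar> powr (2 * n / (n - 2)))"
    and "integrable lborel (\<lambda>x. (norm (G x))\<^sup>2)"
proof -
  define \<gamma> where "\<gamma> = 2 * (n - 1) / (n - 2)"
  define q where "q = 2 * n / (n - 2)"
  have n3: "n \<ge> 3" using N by (simp add: n_def)
  have \<gamma>: "\<gamma> > 1" "2 * (\<gamma> - 1) = q"
    using n3 by (auto simp: \<gamma>_def q_def field_simps)
  have \<gamma>3: "\<gamma> * (n / (n - 1)) = q"
    using n3 by (simp add: \<gamma>_def q_def del: right_diff_distrib_numeral)
  have q: "q > 0" using n3 by (simp add: q_def)
  have um[measurable]: "u \<in> borel_measurable borel" using cont by (rule borel_measurable_continuous_onI)
  obtain U where U: "\<And>x. \<bar>u x\<bar> \<le> U"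
  proof -
    have "compact (u ` cball 0 R)" by (intro compact_continuous_image continuous_on_subset[OF cont]) auto
    then obtain U where "\<forall>y\<in>u ` cball 0 R. norm y \<le> U"
      using compact_imp_bounded bounded_iff by metis
    then have "\<bar>u x\<bar> \<le> U" if "x \<in> cball 0 R" for x using that by auto
    moreover have "0 \<le> U" using calculation[of 0] R by (smt (verit) centre_in_cball)
    ultimately have "\<bar>u x\<bar> \<le> U" for x using supp[of x] by (cases "norm x \<ge> R") auto
    then show ?thesis by (rule that)
  qed
  have U0: "0 \<le> U" using U[of 0] by simp
  have B0: "0 \<le> B" using GB[of 0] norm_ge_zero order_trans by blast
  have bint: "integrable lborel g"
    if [measurable]: "g \<in> borel_measurable borel" and "\<And>x. norm (g x) \<le> D" "\<And>x. norm x \<ge> R \<Longrightarrow> g x = 0"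
    for g :: "'a \<Rightarrow> real" and D
  proof (rule Bochner_Integration.integrable_bound[where f="\<lambda>x. D * indicator (cball 0 R) x"])
    show "integrable lborel (\<lambda>x. D * indicator (cball (0::'a) R) x)"
      using emeasure_bounded_finite[of "cball (0::'a) R"] by (intro integrable_mult_right integrable_real_indicator) auto
    show "AE x in lborel. norm (g x) \<le> norm (D * indicator (cball 0 R) x)"
    proof (intro AE_I2)
      fix x :: 'a
      show "norm (g x) \<le> norm (D * indicator (cball 0 R) x)"
        using that(2)[of x] that(3)[of x] by (cases "norm x \<ge> R") (auto simp: indicator_def)
    qed
  qed simp
  define f where "f x = \<gamma> * \<bar>u x\<bar> powr (\<gamma> - 1) * norm (G x)" for x
  have [measurable]: "f \<in> borel_measurable borel" unfolding f_def by measurable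
  have fC: "f x \<le> \<gamma> * U powr (\<gamma> - 1) * B" for x
    unfolding f_def using \<gamma> U GB U0 by (intro mult_mono powr_mono2) auto
  have f0: "0 \<le> f x" for x using \<gamma> by (simp add: f_def)
  define A where "A = (\<integral>x. \<bar>u x\<bar> powr q \<partial>lborel)"
  define E where "E = (\<integral>x. (norm (G x))\<^sup>2 \<partial>lborel)"
  show i1: "integrable lborel (\<lambda>x. \<bar>u x\<bar> powr (2 * n / (n - 2)))"
    unfolding q_def[symmetric] using q
    by (intro bint[where D="U powr q"]) (use U U0 q supp in \<open>auto intro!: powr_mono2\<close>)
  show i2: "integrable lborel (\<lambda>x. (norm (G x))\<^sup>2)"
    by (intro bint[where D="B\<^sup>2"]) (use GB B0 supp in \<open>auto intro!: power_mono\<close>)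
  have "(\<integral>x. (\<bar>u x\<bar> powr \<gamma>) powr (n / (n - 1)) \<partial>lborel) \<le> (\<integral>x. f x \<partial>lborel) powr (n / (n - 1))"
    unfolding n_def
  proof (rule Gagliardo_Nirenberg_lines[OF R _ _ _ _ f0 fC])
    show "DIM('a) \<ge> 2" using N by simp
    show "\<bar>u x\<bar> powr \<gamma> \<le> (\<integral>t. indicator {-R..R} t * f (x + (t - x \<bullet> b) *\<^sub>R b) \<partial>lborel)"
      if "b \<in> Basis" for x b
      unfolding f_def
      by (rule abs_powr_le_line_integral[OF \<gamma>(1) that R cont _ der Gm])
        (use supp fC in \<open>auto simp: f_def\<close>)
    show "\<bar>u x\<bar> powr \<gamma> = 0 \<and> f x = 0" if "b \<in> Basis" "\<bar>x \<bullet> b\<bar> > R" for x b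
      using Basis_le_norm[OF that(1), of x] that(2) supp[of x] by (simp add: f_def)
  qed auto
  then have A1: "A \<le> (\<integral>x. f x \<partial>lborel) powr (n / (n - 1))"
    by (simp only: powr_powr \<gamma>3 A_def)
  have e: "(\<lambda>x. (\<bar>u x\<bar> powr (\<gamma> - 1))\<^sup>2) = (\<lambda>x. \<bar>u x\<bar> powr q)"
  proof
    fix x
    have "(\<bar>u x\<bar> powr (\<gamma> - 1))\<^sup>2 = (\<bar>u x\<bar> powr (\<gamma> - 1)) powr 2" by simp
    then show "(\<bar>u x\<bar> powr (\<gamma> - 1))\<^sup>2 = \<bar>u x\<bar> powr q"
      by (simp only: powr_powr \<gamma>(2)[symmetric] mult.commute)
  qed
  have "(\<integral>x. f x \<partial>lborel) = \<gamma> * (\<integral>x. \<bar>u x\<bar> powr (\<gamma> - 1) * norm (G x) \<partial>lborel)"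
    unfolding f_def by (simp add: mult.assoc)
  also have "\<dots> \<le> \<gamma> * (sqrt (\<integral>x. (\<bar>u x\<bar> powr (\<gamma> - 1))\<^sup>2 \<partial>lborel) * sqrt E)"
  proof (intro mult_left_mono, unfold E_def, rule integral_mult_le_sqrt)
    show "integrable lborel (\<lambda>x. (\<bar>u x\<bar> powr (\<gamma> - 1))\<^sup>2)" unfolding e using i1 by (simp add: q_def)
    show "integrable lborel (\<lambda>x. \<bar>u x\<bar> powr (\<gamma> - 1) * norm (G x))"
      by (rule bint[where D="U powr (\<gamma> - 1) * B"]) (use supp U U0 GB \<gamma> in \<open>auto intro!: mult_mono powr_mono2\<close>)
  qed (use i2 \<gamma> in auto)
  also note e
  finally have F: "(\<integral>x. f x \<partial>lborel) \<le> \<gamma> * (sqrt A * sqrt E)" by (simp add: A_def)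
  have A0: "0 \<le> A" and E0: "0 \<le> E" by (auto simp: A_def E_def)
  have "A powr ((n - 2) / n) \<le> \<gamma>\<^sup>2 * E"
  proof (cases "A = 0")
    case True
    then show ?thesis using E0 by simp
  next
    case False
    then have Ap: "A > 0" using A0 by simp
    have f00: "0 \<le> (\<integral>x. f x \<partial>lborel)" using f0 by (intro integral_nonneg_AE) auto
    have e2: "n / (n - 1) * (2 * (n - 1) / n) = 2"
      using n3 by (simp del: right_diff_distrib_numeral)
    have "A powr (2 * (n - 1) / n) \<le> ((\<integral>x. f x \<partial>lborel) powr (n / (n - 1))) powr (2 * (n - 1) / n)"
      using A1 n3 Ap by (intro powr_mono2) auto
    also have "\<dots> = (\<integral>x. f x \<partial>lborel)\<^sup>2"
      by (simp only: powr_powr e2) (simp add: f00)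
    also have "\<dots> \<le> (\<gamma> * (sqrt A * sqrt E))\<^sup>2" using F f00 by (intro power_mono) auto
    also have "\<dots> = A * (\<gamma>\<^sup>2 * E)" using A0 E0 by (simp add: power_mult_distrib)
    finally have "A powr (2 * (n - 1) / n) \<le> A * (\<gamma>\<^sup>2 * E)" .
    moreover have "A powr (2 * (n - 1) / n) = A * A powr ((n - 2) / n)"
    proof -
      have "2 * (n - 1) / n = 1 + (n - 2) / n" using n3 by (simp add: field_simps)
      then show ?thesis using Ap by (simp add: powr_add)
    qed
    ultimately show ?thesis using Ap by simp
  qed
  then show "(\<integral>x. \<bar>u x\<bar> powr (2 * n / (n - 2)) \<partial>lborel) powr ((n - 2) / n)
    \<le> (2 * (n - 1) / (n - 2))\<^sup>2 * (\<integral>x. (norm (G x))\<^sup>2 \<partial>lborel)"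
    by (simp add: A_def E_def q_def \<gamma>_def)
qed

section \<open>Polar coordinates\<close>

lemma emeasure_lborel_scaleR_image:
  fixes A :: "'a::euclidean_space set"
  assumes c: "c > 0" and A: "A \<in> sets borel"
  shows "(\<lambda>x. c *\<^sub>R x) -` A \<in> sets borel"
    and "emeasure lborel A = ennreal (c ^ DIM('a)) * emeasure lborel ((\<lambda>x. c *\<^sub>R x) -` A)"
proof -
  have m: "(\<lambda>x::'a. c *\<^sub>R x) \<in> borel_measurable borel" by simp
  show v: "(\<lambda>x. c *\<^sub>R x) -` A \<in> sets borel" using measurable_sets[OF m A] by simp
  have "emeasure lborel A = emeasure (density (distr lborel borel (\<lambda>x. 0 + c *\<^sub>R x)) (\<lambda>_. \<bar>c\<bar>^DIM('a))) A"
    using lborel_affine[of c "0::'a"] c by simp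
  also have "\<dots> = ennreal (c ^ DIM('a)) * emeasure lborel ((\<lambda>x. c *\<^sub>R x) -` A)"
    using A c m by (simp add: emeasure_density emeasure_distr nn_integral_cmult_indicator)
  finally show "emeasure lborel A = ennreal (c ^ DIM('a)) * emeasure lborel ((\<lambda>x. c *\<^sub>R x) -` A)" .
qed

lemma sgn_measurable_sphere: "sgn \<in> measurable (lebesgue_on (ball 0 1 - {0})) (restrict_space borel (sphere (0::'a::euclidean_space) 1))"
proof (rule measurable_restrict_space2)
  show "sgn \<in> space (lebesgue_on (ball 0 1 - {0})) \<rightarrow> sphere (0::'a) 1"
    by (auto simp: norm_sgn)
  have "(sgn::'a\<Rightarrow>'a) \<in> borel_measurable lebesgue" by (intro measurable_completion) simp
  then show "(sgn::'a\<Rightarrow>'a) \<in> borel_measurable (lebesgue_on (ball 0 1 - {0}))"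
    by (rule measurable_restrict_space1)
qed

lemma space_sphere_measure [simp]: "space (sphere_measure :: 'a::euclidean_space measure) = sphere 0 1"
  by (simp add: sphere_measure_def space_restrict_space space_scale_measure)

lemma sets_sphere_measure [simp, measurable_cong]:
  "sets (sphere_measure :: 'a::euclidean_space measure) = sets (restrict_space borel (sphere 0 1))"
  by (simp add: sphere_measure_def)

lemma emeasure_sphere_measure:
  fixes B :: "'a::euclidean_space set"
  assumes B: "B \<in> sets (restrict_space borel (sphere (0::'a) 1))"
  shows "emeasure sphere_measure B = of_nat DIM('a) * emeasure lborel ((ball 0 1 - {0}) \<inter> sgn -` B)"
    and "(ball 0 1 - {0}) \<inter> sgn -` B \<in> sets borel"
proof -
  have B': "B \<in> sets borel" "B \<subseteq> sphere 0 1" using B by (auto simp: sets_restrict_space)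
  have "sgn -` B \<inter> space borel \<in> sets borel"
    by (rule measurable_sets[OF _ B'(1)]) simp
  then show *: "(ball 0 1 - {0}) \<inter> sgn -` B \<in> sets borel" by auto
  have eq: "sgn -` B \<inter> space (lebesgue_on (ball 0 1 - {0})) = (ball 0 1 - {0}) \<inter> sgn -` B" by auto
  have "emeasure sphere_measure B = of_nat DIM('a) * emeasure (lebesgue_on (ball 0 1 - {0})) ((ball 0 1 - {0}) \<inter> sgn -` B)"
    unfolding sphere_measure_def emeasure_scale_measure
    by (subst emeasure_distr[OF sgn_measurable_sphere B]) (simp only: eq)
  also have "emeasure (lebesgue_on (ball 0 1 - {0})) ((ball 0 1 - {0}) \<inter> sgn -` B) = emeasure lebesgue ((ball 0 1 - {0}) \<inter> sgn -` B)"
    by (rule emeasure_restrict_space) auto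
  also have "\<dots> = emeasure lborel ((ball 0 1 - {0}) \<inter> sgn -` B)"
    using * by simp
  finally show "emeasure sphere_measure B = of_nat DIM('a) * emeasure lborel ((ball 0 1 - {0}) \<inter> sgn -` B)" .
qed

lemma finite_measure_sphere_measure: "finite_measure (sphere_measure :: 'a::euclidean_space measure)"
proof (rule finite_measureI)
  have sp: "sphere (0::'a) 1 \<in> sets (restrict_space borel (sphere (0::'a) 1))"
    by (auto simp: sets_restrict_space)
  have "emeasure lborel ((ball (0::'a) 1 - {0}) \<inter> sgn -` sphere 0 1) \<le> emeasure lborel (ball (0::'a) 1)"
    by (rule emeasure_mono) auto
  also have "\<dots> < \<infinity>" using emeasure_bounded_finite[of "ball (0::'a) 1"] by simp
  finally show "emeasure (sphere_measure :: 'a measure) (space sphere_measure) \<noteq> \<infinity>"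
    unfolding space_sphere_measure emeasure_sphere_measure[OF sp]
    by (simp add: ennreal_mult_eq_top_iff)
qed

definition radial_measure :: "nat \<Rightarrow> real measure" where
  "radial_measure n = density lborel (\<lambda>r. ennreal (r ^ (n - 1)) * indicator {0<..} r)"

lemma sets_radial_measure[simp, measurable_cong]: "sets (radial_measure n) = sets borel"
  by (simp add: radial_measure_def)

lemma space_radial_measure[simp]: "space (radial_measure n) = UNIV"
  by (simp add: radial_measure_def)

lemma emeasure_radial_measure_Iic:
  assumes "b \<ge> 0" "n > 0" shows "emeasure (radial_measure n) {..b} = ennreal (b ^ n / n)"
proof -
  have "emeasure (radial_measure n) {..b} = (\<integral>\<^sup>+r. ennreal (r ^ (n - 1)) * indicator {0<..} r * indicator {..b} r \<partial>lborel)"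
    by (simp add: radial_measure_def emeasure_density)
  also have "\<dots> = (\<integral>\<^sup>+r. ennreal (r ^ (n - 1)) * indicator {0..b} r \<partial>lborel)"
  proof (rule nn_integral_cong_AE)
    have "AE r in lborel. r \<noteq> (0::real)" by (rule AE_lborel_singleton)
    then show "AE r in lborel. ennreal (r ^ (n - 1)) * indicator {0<..} r * indicator {..b} r
        = ennreal (r ^ (n - 1)) * indicator {0..b} r"
      by eventually_elim (auto split: split_indicator)
  qed
  also have "\<dots> = ennreal (b ^ n / n - 0 ^ n / n)"
  proof (rule nn_integral_FTC_Icc)
    show "((\<lambda>x. x ^ n / n) has_real_derivative x ^ (n - 1)) (at x)" for x
      using assms by (auto intro!: derivative_eq_intros)
  qed (use assms in auto)
  finally show ?thesis using assms by (simp add: zero_power)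
qed

lemma sigma_finite_radial_measure:
  assumes n: "n > 0" shows "sigma_finite_measure (radial_measure n)"
proof (unfold sigma_finite_measure_def)
  let ?A = "range (\<lambda>i::nat. {..real i})"
  have "\<Union> ?A = space (radial_measure n)"
    using real_arch_simple by auto
  moreover have "\<forall>a\<in>?A. emeasure (radial_measure n) a \<noteq> \<infinity>"
    using emeasure_radial_measure_Iic[OF _ n] by auto
  moreover have "countable ?A" "?A \<subseteq> sets (radial_measure n)" by auto
  ultimately show "\<exists>A. countable A \<and> A \<subseteq> sets (radial_measure n) \<and> \<Union> A = space (radial_measure n)
      \<and> (\<forall>a\<in>A. emeasure (radial_measure n) a \<noteq> \<infinity>)"
    by blast
qed

text \<open>Both sides are determined by their values on the sets \<open>{x. |x| \<le> b, x/|x| \<in> B}\<close>,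
  which are dilated cones.\<close>

lemma polar_measure:
  "radial_measure DIM('a) \<Otimes>\<^sub>M (sphere_measure :: 'a::euclidean_space measure)
     = distr lborel (borel \<Otimes>\<^sub>M restrict_space borel (sphere 0 1)) (\<lambda>x. (norm x, if x = 0 then SOME b. b \<in> Basis else sgn x))"
proof (rule pair_measure_eqI)
  define e :: 'a where "e = (SOME b. b \<in> Basis)"
  have eB: "e \<in> Basis" unfolding e_def by (rule someI_ex) (use nonempty_Basis in blast)
  define sg where "sg x = (if x = 0 then e else sgn x)" for x :: 'a
  interpret S: finite_measure "sphere_measure :: 'a measure" by (rule finite_measure_sphere_measure)
  show "sigma_finite_measure (sphere_measure :: 'a measure)" by unfold_locales
  show sfr: "sigma_finite_measure (radial_measure DIM('a))" by (rule sigma_finite_radial_measure) simp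
  show "sets (radial_measure DIM('a) \<Otimes>\<^sub>M (sphere_measure :: 'a measure)) =
    sets (distr lborel (borel \<Otimes>\<^sub>M restrict_space borel (sphere 0 1)) (\<lambda>x::'a. (norm x, if x = 0 then SOME b. b \<in> Basis else sgn x)))"
    by (simp cong: sets_pair_measure_cong)
  have sgm[measurable]: "sg \<in> measurable borel (restrict_space borel (sphere 0 1))"
    by (rule measurable_restrict_space2) (auto simp: norm_sgn eB sg_def[abs_def])
  fix A :: "real set" and B :: "'a set"
  assume A: "A \<in> sets (radial_measure DIM('a))" and B: "B \<in> sets (sphere_measure :: 'a measure)"
  have A[measurable]: "A \<in> sets borel" and B[measurable]: "B \<in> sets (restrict_space borel (sphere 0 1))" using A B by simp_all
  define \<nu> where "\<nu> = distr (restrict_space lborel (sg -` B)) borel (norm :: 'a \<Rightarrow> real)"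
  have sgB[measurable]: "sg -` B \<in> sets borel" using measurable_sets[OF sgm B] by simp
  have \<nu>: "emeasure \<nu> A = emeasure lborel (norm -` A \<inter> sg -` B)" if [measurable]: "A \<in> sets borel" for A
  proof -
    have "emeasure \<nu> A = emeasure (restrict_space lborel (sg -` B)) (norm -` A \<inter> sg -` B)"
      unfolding \<nu>_def by (subst emeasure_distr) (auto simp: space_restrict_space measurable_restrict_space1)
    also have "\<dots> = emeasure lborel (norm -` A \<inter> sg -` B)"
      by (rule emeasure_restrict_space) auto
    finally show ?thesis .
  qed
  define \<mu> where "\<mu> = scale_measure (emeasure sphere_measure B) (radial_measure DIM('a))"
  have N: "real DIM('a) > 0" by simp
  have eqb: "emeasure \<nu> {..b} = emeasure \<mu> {..b}" for b
  proof (cases "b > 0")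
    case False
    then have "(norm :: 'a \<Rightarrow> real) -` {..b} \<inter> sg -` B \<subseteq> {0}"
      by (force simp: not_less dest: order_trans)
    then have "emeasure lborel ((norm :: 'a \<Rightarrow> real) -` {..b} \<inter> sg -` B) \<le> emeasure lborel {0::'a}"
      by (intro emeasure_mono) auto
    then have "emeasure \<nu> {..b} = 0" by (simp add: \<nu>)
    moreover have "emeasure (radial_measure DIM('a)) {..b} \<le> emeasure (radial_measure DIM('a)) {..0}"
      using False by (intro emeasure_mono) auto
    then have "emeasure \<mu> {..b} = 0" unfolding \<mu>_def using emeasure_radial_measure_Iic[of 0 "DIM('a)"] by (simp add: power_0_left)
    ultimately show ?thesis by simp
  next
    case True
    let ?S = "(norm :: 'a \<Rightarrow> real) -` {..b} \<inter> sg -` B"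
    have [measurable]: "?S \<in> sets borel" by measurable
    have "emeasure \<nu> {..b} = emeasure lborel ?S" by (simp add: \<nu>)
    also have "\<dots> = ennreal (b ^ DIM('a)) * emeasure lborel ((\<lambda>x. b *\<^sub>R x) -` ?S)"
      by (rule emeasure_lborel_scaleR_image[OF True]) simp
    also have "emeasure lborel ((\<lambda>x. b *\<^sub>R x) -` ?S) = emeasure lborel ((ball 0 1 - {0}) \<inter> sgn -` B)"
    proof (rule emeasure_eq_AE)
      have "AE x in lborel. x \<noteq> (0::'a)" by (rule AE_lborel_singleton)
      moreover have "sphere (0::'a) 1 \<in> null_sets lborel"
        using negligible_sphere[of "0::'a" 1] by (simp add: negligible_iff_null_sets null_sets_completion_iff)
      then have "AE x in lborel. x \<notin> sphere (0::'a) 1" by (rule AE_not_in)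
      ultimately show "AE x in lborel. (x \<in> (\<lambda>x. b *\<^sub>R x) -` ?S) = (x \<in> (ball 0 1 - {0}) \<inter> sgn -` B)"
      proof eventually_elim
        case (elim x)
        have "sg (b *\<^sub>R x) = sgn x" using elim True by (simp add: sg_def sgn_scaleR)
        moreover have "norm (b *\<^sub>R x) \<le> b \<longleftrightarrow> norm x < 1"
          using elim True by (simp add: mult_le_cancel_left1 less_le)
        ultimately show ?case using elim by auto
      qed
      show "(\<lambda>x. b *\<^sub>R x) -` ?S \<in> sets lborel"
        using emeasure_lborel_scaleR_image(1)[OF True, of ?S] by simp
      show "(ball 0 1 - {0}) \<inter> sgn -` B \<in> sets lborel"
        using emeasure_sphere_measure(2)[OF B] by simp
    qed
    also have "ennreal (b ^ DIM('a)) * emeasure lborel ((ball 0 1 - {0}) \<inter> sgn -` B) =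
        (of_nat DIM('a) * emeasure lborel ((ball 0 1 - {0}) \<inter> sgn -` B)) * ennreal (b ^ DIM('a) / DIM('a))"
    proof -
      have "ennreal (b ^ DIM('a)) = ennreal (real DIM('a) * (b ^ DIM('a) / DIM('a)))" by simp
      also have "\<dots> = of_nat DIM('a) * ennreal (b ^ DIM('a) / DIM('a))"
        using True by (subst ennreal_mult) (auto simp: ennreal_of_nat_eq_real_of_nat)
      finally show ?thesis by (simp add: mult_ac)
    qed
    also have "\<dots> = emeasure \<mu> {..b}"
      unfolding \<mu>_def emeasure_scale_measure emeasure_sphere_measure(1)[OF B] using emeasure_radial_measure_Iic[of b "DIM('a)"] True by simp
    finally show ?thesis .
  qed
  have "\<nu> = \<mu>"
  proof (rule measure_eqI_generator_eq[where E="range (\<lambda>b::real. {..b})" and \<Omega>=UNIV and A="\<lambda>i::nat. {..real i}"])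
    show "Int_stable (range (\<lambda>b::real. {..b}))" by (auto simp: Int_stable_def)
    show "emeasure \<nu> X = emeasure \<mu> X" if "X \<in> range (\<lambda>b::real. {..b})" for X using that eqb by auto
    show "sets \<nu> = sigma_sets UNIV (range (\<lambda>b::real. {..b}))"
      unfolding \<nu>_def by (simp add: borel_eq_atMost)
    show "sets \<mu> = sigma_sets UNIV (range (\<lambda>b::real. {..b}))"
      unfolding \<mu>_def by (simp add: borel_eq_atMost)
    show "(\<Union>i::nat. {..real i}) = UNIV" using real_arch_simple by auto
    show "emeasure \<nu> {..real i} \<noteq> \<infinity>" for i :: nat
      unfolding eqb unfolding \<mu>_def emeasure_scale_measure using S.emeasure_finite[of B]
        emeasure_radial_measure_Iic[of "real i" "DIM('a)"]
      by (simp add: ennreal_mult_eq_top_iff)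
  qed auto
  then have "emeasure \<mu> A = emeasure \<nu> A" by simp
  also have "\<dots> = emeasure lborel ((\<lambda>x. (norm x, sg x)) -` (A \<times> B))"
    unfolding \<nu>[OF \<open>A \<in> sets borel\<close>] by (rule arg_cong[where f="emeasure lborel"]) auto
  also have "\<dots> = emeasure (distr lborel (borel \<Otimes>\<^sub>M restrict_space borel (sphere 0 1)) (\<lambda>x. (norm x, sg x))) (A \<times> B)"
    by (subst emeasure_distr) auto
  finally show "emeasure (radial_measure DIM('a)) A * emeasure sphere_measure B =
     emeasure (distr lborel (borel \<Otimes>\<^sub>M restrict_space borel (sphere 0 1))
       (\<lambda>x. (norm x, if x = 0 then SOME b. b \<in> Basis else sgn x))) (A \<times> B)"
    unfolding sg_def e_def by (simp add: \<mu>_def mult.commute)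
qed

lemma nn_integral_polar:
  fixes f :: "'a::euclidean_space \<Rightarrow> ennreal"
  assumes [measurable]: "f \<in> borel_measurable borel"
  shows "(\<integral>\<^sup>+x. f x \<partial>lborel)
    = (\<integral>\<^sup>+\<omega>. (\<integral>\<^sup>+r. ennreal (r ^ (DIM('a) - 1)) * indicator {0<..} r * f (r *\<^sub>R \<omega>) \<partial>lborel) \<partial>sphere_measure)"
proof -
  define e :: 'a where "e = (SOME b. b \<in> Basis)"
  have eB: "e \<in> Basis" unfolding e_def by (rule someI_ex) (use nonempty_Basis in blast)
  define sg where "sg x = (if x = 0 then e else sgn x)" for x :: 'a
  have sgm[measurable]: "sg \<in> measurable borel (restrict_space borel (sphere 0 1))"
    by (rule measurable_restrict_space2) (auto simp: norm_sgn eB sg_def[abs_def])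
  interpret S: finite_measure "sphere_measure :: 'a measure" by (rule finite_measure_sphere_measure)
  interpret R: sigma_finite_measure "radial_measure DIM('a)" by (rule sigma_finite_radial_measure) simp
  interpret RS: pair_sigma_finite "radial_measure DIM('a)" "sphere_measure :: 'a measure" by standard
  have [measurable]: "(\<lambda>\<omega>. \<omega>) \<in> measurable (restrict_space borel (sphere (0::'a) 1)) borel"
    by (rule measurable_restrict_space1) simp
  have [measurable]: "(\<lambda>z. f (fst z *\<^sub>R snd z)) \<in> borel_measurable (borel \<Otimes>\<^sub>M restrict_space borel (sphere (0::'a) 1))"
    by measurable
  have "(\<integral>\<^sup>+x. f x \<partial>lborel) = (\<integral>\<^sup>+x. f (norm x *\<^sub>R sg x) \<partial>lborel)"
    by (intro nn_integral_cong) (auto simp: sg_def sgn_div_norm)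
  also have "\<dots> = (\<integral>\<^sup>+z. f (fst z *\<^sub>R snd z) \<partial>distr lborel (borel \<Otimes>\<^sub>M restrict_space borel (sphere 0 1)) (\<lambda>x. (norm x, sg x)))"
    by (subst nn_integral_distr) auto
  also have "\<dots> = (\<integral>\<^sup>+z. f (fst z *\<^sub>R snd z) \<partial>(radial_measure DIM('a) \<Otimes>\<^sub>M sphere_measure))"
    unfolding polar_measure sg_def e_def ..
  also have "\<dots> = (\<integral>\<^sup>+\<omega>. (\<integral>\<^sup>+r. f (r *\<^sub>R \<omega>) \<partial>radial_measure DIM('a)) \<partial>sphere_measure)"
    by (subst RS.nn_integral_snd[symmetric]) (auto cong: measurable_cong_sets sets_pair_measure_cong)
  also have "\<dots> = (\<integral>\<^sup>+\<omega>. (\<integral>\<^sup>+r. ennreal (r ^ (DIM('a) - 1)) * indicator {0<..} r * f (r *\<^sub>R \<omega>) \<partial>lborel) \<partial>sphere_measure)"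
    unfolding radial_measure_def by (subst nn_integral_density) auto
  finally show ?thesis .
qed

section \<open>Smooth functions and weak gradients\<close>

lemma iterated_partial_snoc:
  "iterated_partial (vs @ [v]) f = iterated_partial vs (iterated_partial [v] f)"
  by (induction vs) auto

lemma smooth_differentiable: "smooth f \<Longrightarrow> f differentiable (at x)"
  unfolding smooth_def by (metis empty_set empty_subsetI iterated_partial.simps(1))

lemma smooth_partial:
  assumes "smooth f" "b \<in> Basis"
  shows "smooth (\<lambda>x. frechet_derivative f (at x) b)"
  unfolding smooth_def
proof (intro allI impI)
  fix vs :: "'a list" and x
  assume "set vs \<subseteq> Basis"
  then have "iterated_partial (vs @ [b]) f differentiable (at x)"
    using assms unfolding smooth_def by auto
  then show "iterated_partial vs (\<lambda>x. frechet_derivative f (at x) b) differentiable (at x)"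
    by (simp add: iterated_partial_snoc)
qed

lemma smooth_continuous: "smooth f \<Longrightarrow> continuous_on A f"
  by (meson smooth_differentiable differentiable_imp_continuous_within continuous_at_imp_continuous_on)

lemma continuous_on_gradient: "smooth f \<Longrightarrow> continuous_on A (gradient f)"
  unfolding gradient_def[abs_def]
  by (intro continuous_on_sum continuous_on_scaleR continuous_on_const smooth_continuous smooth_partial) auto

lemma smooth_has_derivative: "smooth f \<Longrightarrow> (f has_derivative (\<lambda>v. gradient f x \<bullet> v)) (at x)"
  using GDERIV_gradient[OF smooth_differentiable] by (simp add: gderiv_def inner_commute)

lemma gradient_eq:
  assumes "(f has_derivative (\<lambda>v. G \<bullet> v)) (at x)" shows "gradient f x = G"
proof -
  have "frechet_derivative f (at x) = (\<lambda>v. G \<bullet> v)"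
    using assms by (metis frechet_derivative_at)
  then show ?thesis by (simp add: gradient_def euclidean_representation)
qed

lemma test_functions_bounded_support:
  assumes "f \<in> test_functions \<Omega>"
  obtains R where "R > 0" "\<And>x. norm x \<ge> R \<Longrightarrow> f x = 0"
proof -
  have "bounded (closure {x. f x \<noteq> 0})"
    using assms by (auto simp: test_functions_def compact_imp_bounded)
  then obtain B where B: "\<And>x. x \<in> closure {x. f x \<noteq> 0} \<Longrightarrow> norm x \<le> B" by (auto simp: bounded_iff)
  have "f x = 0" if "norm x \<ge> \<bar>B\<bar> + 1" for x
  proof (rule ccontr)
    assume "f x \<noteq> 0"
    then have "x \<in> closure {x. f x \<noteq> 0}" using closure_subset[of "{x. f x \<noteq> 0}"] by blast
    from B[OF this] that show False by linarith
  qed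
  then show ?thesis by (intro that[of "\<bar>B\<bar> + 1"]) auto
qed

lemma gradient_zero_outside:
  fixes f :: "'a::euclidean_space \<Rightarrow> real"
  assumes der: "\<And>x. (f has_derivative (\<lambda>v. G x \<bullet> v)) (at x)" and supp: "\<And>x. norm x \<ge> R \<Longrightarrow> f x = 0"
    and x: "norm x > R"
  shows "G x = 0"
proof -
  have "((\<lambda>_. 0) has_derivative (\<lambda>v. G x \<bullet> v)) (at x)"
  proof (rule has_derivative_transform_within_open[OF der])
    show "open {y::'a. norm y > R}" by (intro open_Collect_less continuous_intros)
  qed (use x supp in auto)
  then have "(\<lambda>v. G x \<bullet> v) = (\<lambda>_. 0)" by (metis has_derivative_unique has_derivative_const)
  then have "G x \<bullet> G x = 0" by metis
  then show ?thesis by simp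
qed

lemma continuous_bounded_support_bounded:
  fixes G :: "'a::euclidean_space \<Rightarrow> 'b::real_normed_vector"
  assumes "continuous_on UNIV G" "\<And>x. norm x > R \<Longrightarrow> G x = 0"
  obtains B where "B \<ge> 0" "\<And>x. norm (G x) \<le> B"
proof -
  have "compact (G ` cball 0 R)" by (intro compact_continuous_image continuous_on_subset[OF assms(1)]) auto
  then obtain B where "\<forall>y\<in>G ` cball 0 R. norm y \<le> B" using compact_imp_bounded bounded_iff by metis
  then have "norm (G x) \<le> \<bar>B\<bar>" for x using assms(2)[of x] by (cases "norm x \<le> R") force+
  then show ?thesis by (intro that[of "\<bar>B\<bar>"]) auto
qed

lemma integrable_bounded_support:
  fixes g :: "'a::euclidean_space \<Rightarrow> real"
  assumes "g \<in> borel_measurable borel" "\<And>x. \<bar>g x\<bar> \<le> D" "\<And>x. norm x > R \<Longrightarrow> g x = 0"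
  shows "integrable lborel g"
proof (rule Bochner_Integration.integrable_bound[where f="\<lambda>x. D * indicator (cball 0 R) x"])
  show "integrable lborel (\<lambda>x. D * indicator (cball (0::'a) R) x)"
    using emeasure_bounded_finite[of "cball (0::'a) R"] by (intro integrable_mult_right integrable_real_indicator) auto
  show "AE x in lborel. norm (g x) \<le> norm (D * indicator (cball 0 R) x)"
  proof (intro AE_I2)
    fix x :: 'a
    show "norm (g x) \<le> norm (D * indicator (cball 0 R) x)"
      using assms(2)[of x] assms(3)[of x] by (cases "norm x > R") (auto simp: indicator_def)
  qed
qed (use assms in simp)

text \<open>By translation invariance the difference quotients have integral zero.\<close>

lemma integral_partial_derivative_zero:
  fixes f :: "'a::euclidean_space \<Rightarrow> real"
  assumes der: "\<And>x. (f has_derivative (\<lambda>v. G x \<bullet> v)) (at x)" and cont: "continuous_on UNIV G"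
    and supp: "\<And>x. norm x \<ge> R \<Longrightarrow> f x = 0" and b: "b \<in> Basis"
  shows "(\<integral>x. G x \<bullet> b \<partial>lborel) = 0" "integrable lborel (\<lambda>x. G x \<bullet> b)"
proof -
  have G0: "G x = 0" if "norm x > R" for x by (rule gradient_zero_outside[OF der supp that])
  obtain B where B: "B \<ge> 0" "\<And>x. norm (G x) \<le> B"
    using continuous_bounded_support_bounded[OF cont G0] by metis
  have fc: "continuous_on UNIV f"
    by (meson der has_derivative_continuous continuous_at_imp_continuous_on)
  have [measurable]: "f \<in> borel_measurable borel" "G \<in> borel_measurable borel"
    using fc cont by (auto intro: borel_measurable_continuous_onI)
  show "integrable lborel (\<lambda>x. G x \<bullet> b)"
    by (rule integrable_bounded_support[where D=B and R=R])
      (use B G0 Cauchy_Schwarz_ineq2 b in \<open>auto intro: order_trans[OF Basis_le_norm[OF b]]\<close>)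
  have lip: "\<bar>f y - f x\<bar> \<le> B * norm (y - x)" for x y
  proof -
    have "norm (f y - f x) \<le> B * norm (y - x)"
    proof (rule differentiable_bound[OF convex_UNIV])
      show "(f has_derivative (\<lambda>v. G x \<bullet> v)) (at x within UNIV)" for x using der by simp
      show "onorm (\<lambda>v. G x \<bullet> v) \<le> B" for x
      proof (rule onorm_le)
        fix v
        have "norm (G x \<bullet> v) \<le> norm (G x) * norm v" using Cauchy_Schwarz_ineq2[of "G x" v] by simp
        also have "\<dots> \<le> B * norm v" by (intro mult_right_mono B norm_ge_zero)
        finally show "norm (G x \<bullet> v) \<le> B * norm v" .
      qed
    qed auto
    then show ?thesis by simp
  qed
  define D where "D n x = real (Suc n) * (f (x + (1 / real (Suc n)) *\<^sub>R b) - f x)" for n x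
  obtain Fb where Fb: "\<And>x. norm (f x) \<le> Fb"
    using continuous_bounded_support_bounded[OF fc, of R] supp by (metis less_imp_le)
  have fi: "integrable lborel f"
    by (rule integrable_bounded_support[where D=Fb and R=R]) (use Fb supp in auto)
  have trans: "(\<integral>x. f (x + c) \<partial>lborel) = (\<integral>x. f x \<partial>lborel)" "integrable lborel (\<lambda>x. f (x + c))" for c
  proof -
    have "(\<integral>x. f x \<partial>lborel) = (\<integral>x. f x \<partial>distr lborel borel ((+) c))" by (simp add: lborel_distr_plus)
    also have "\<dots> = (\<integral>x. f (c + x) \<partial>lborel)" by (subst integral_distr) auto
    finally show "(\<integral>x. f (x + c) \<partial>lborel) = (\<integral>x. f x \<partial>lborel)" by (simp add: add.commute)
    have "integrable (distr lborel borel ((+) c)) f" using fi by (simp add: lborel_distr_plus)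
    then show "integrable lborel (\<lambda>x. f (x + c))" by (subst (asm) integrable_distr_eq) (auto simp: add.commute)
  qed
  have D0: "(\<integral>x. D n x \<partial>lborel) = 0" for n
    unfolding D_def using trans fi by simp
  have "(\<lambda>n. \<integral>x. D n x \<partial>lborel) \<longlonglongrightarrow> (\<integral>x. G x \<bullet> b \<partial>lborel)"
  proof (rule integral_dominated_convergence)
    show "integrable lborel (\<lambda>x. B * indicator (cball (0::'a) (R + 1)) x)"
      using emeasure_bounded_finite[of "cball (0::'a) (R + 1)"] by (intro integrable_mult_right integrable_real_indicator) auto
    show "AE x in lborel. norm (D n x) \<le> B * indicator (cball 0 (R + 1)) x" for n
    proof (rule AE_I2)
      fix x :: 'a
      show "norm (D n x) \<le> B * indicator (cball 0 (R + 1)) x"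
      proof (cases "norm x \<le> R + 1")
        case True
        have "\<bar>f (x + (1 / real (Suc n)) *\<^sub>R b) - f x\<bar> \<le> B * (1 / real (Suc n))"
          using lip[of "x + (1 / real (Suc n)) *\<^sub>R b" x] b by simp
        then have "\<bar>D n x\<bar> \<le> real (Suc n) * (B * (1 / real (Suc n)))"
          unfolding D_def abs_mult by (intro mult_mono) auto
        then show ?thesis using True by simp
      next
        case False
        have "norm x - norm ((1 / real (Suc n)) *\<^sub>R b) \<le> norm (x + (1 / real (Suc n)) *\<^sub>R b)"
          by (rule norm_diff_ineq)
        moreover have "norm ((1 / real (Suc n)) *\<^sub>R b) \<le> 1" using b by simp
        ultimately have "R \<le> norm (x + (1 / real (Suc n)) *\<^sub>R b)" "R \<le> norm x"
          using False by linarith+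
        then have "f (x + (1 / real (Suc n)) *\<^sub>R b) = 0" "f x = 0" by (auto intro: supp)
        then show ?thesis using B by (simp add: D_def)
      qed
    qed
    show "AE x in lborel. (\<lambda>n. D n x) \<longlonglongrightarrow> G x \<bullet> b"
    proof (rule AE_I2)
      fix x :: 'a
      have "((\<lambda>t. f (x + t *\<^sub>R b)) has_derivative (\<lambda>t. G x \<bullet> (t *\<^sub>R b))) (at 0)"
      proof -
        have "((\<lambda>t. x + t *\<^sub>R b) has_derivative (\<lambda>t. t *\<^sub>R b)) (at (0::real))"
          by (auto intro!: derivative_eq_intros)
        from diff_chain_at[OF this, of f "\<lambda>v. G x \<bullet> v"] der[of x] show ?thesis by (simp add: o_def)
      qed
      then have "((\<lambda>t. f (x + t *\<^sub>R b)) has_real_derivative (G x \<bullet> b)) (at 0)"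
        by (simp add: has_field_derivative_def mult_commute_abs)
      then have "((\<lambda>h. (f (x + h *\<^sub>R b) - f x) / h) \<longlongrightarrow> G x \<bullet> b) (at 0)"
        by (simp add: DERIV_def)
      moreover have "filterlim (\<lambda>n. 1 / real (Suc n)) (at 0) sequentially"
        unfolding filterlim_at using lim_inverse_n' LIMSEQ_Suc[of "\<lambda>n. 1 / real n" 0]
        by (auto intro!: always_eventually simp: lim_1_over_n)
      ultimately have "(\<lambda>n. (f (x + (1 / real (Suc n)) *\<^sub>R b) - f x) / (1 / real (Suc n))) \<longlonglongrightarrow> G x \<bullet> b"
        by (rule filterlim_compose)
      then show "(\<lambda>n. D n x) \<longlonglongrightarrow> G x \<bullet> b" by (simp add: D_def mult.commute)
    qed
  qed (unfold D_def, measurable)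
  then show "(\<integral>x. G x \<bullet> b \<partial>lborel) = 0" by (simp add: D0 LIMSEQ_const_iff)
qed

lemma integral_on_ball_eq:
  fixes f :: "'a::euclidean_space \<Rightarrow> real"
  assumes "f \<in> borel_measurable borel" "\<And>x. x \<notin> ball 0 1 \<Longrightarrow> f x = 0"
  shows "(LINT x|lebesgue_on (ball 0 1). f x) = (\<integral>x. f x \<partial>lborel)"
proof -
  have "(LINT x|lebesgue_on (ball 0 1). f x) = (LINT x|lebesgue. indicator (ball 0 1) x *\<^sub>R f x)"
    by (rule integral_restrict_space) simp
  also have "(\<lambda>x. indicator (ball 0 1) x *\<^sub>R f x) = f"
    using assms(2) by (intro ext) (simp split: split_indicator)
  also have "(LINT x|lebesgue. f x) = (\<integral>x. f x \<partial>lborel)" by (rule integral_completion) (use assms in simp)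
  finally show ?thesis .
qed

lemma finite_measure_lebesgue_on_ball: "finite_measure (lebesgue_on (ball (0::'a::euclidean_space) 1))"
proof (rule finite_measureI)
  have "emeasure (lebesgue_on (ball (0::'a) 1)) (ball 0 1) = emeasure lborel (ball (0::'a) 1)"
    by (subst emeasure_restrict_space) auto
  then show "emeasure (lebesgue_on (ball (0::'a) 1)) (space (lebesgue_on (ball 0 1))) \<noteq> \<infinity>"
    using emeasure_bounded_finite[of "ball (0::'a) 1"] by (simp add: space_restrict_space)
qed

lemma square_integrable_on_ball:
  fixes f :: "'a::euclidean_space \<Rightarrow> 'b::euclidean_space"
  assumes "continuous_on UNIV f"
  shows "square_integrable (lebesgue_on (ball 0 1)) f"
proof -
  interpret finite_measure "lebesgue_on (ball (0::'a) 1)" by (rule finite_measure_lebesgue_on_ball)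
  have fm: "f \<in> borel_measurable (lebesgue_on (ball 0 1))"
    using assms by (intro measurable_restrict_space1 measurable_completion) (auto intro: borel_measurable_continuous_onI)
  have "compact (f ` cball 0 1)" by (intro compact_continuous_image continuous_on_subset[OF assms]) auto
  then obtain B where B: "\<forall>y\<in>f ` cball 0 1. norm y \<le> B" using compact_imp_bounded bounded_iff by metis
  have "integrable (lebesgue_on (ball 0 1)) (\<lambda>x. (norm (f x))\<^sup>2)"
  proof (rule integrable_const_bound[where B="B\<^sup>2"])
    show "AE x in lebesgue_on (ball 0 1). norm ((norm (f x))\<^sup>2) \<le> B\<^sup>2"
      using B by (intro AE_I2) (auto simp: space_restrict_space intro!: power_mono)
  qed (use fm in measurable)
  then show ?thesis using fm by (simp add: square_integrable_def)
qed

lemma smooth_has_L2_weak_gradient: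
  fixes u :: "'a::euclidean_space \<Rightarrow> real"
  assumes u: "smooth u"
  shows "has_L2_weak_gradient (ball 0 1) u (gradient u)"
  unfolding has_L2_weak_gradient_def
proof (intro conjI ballI)
  show "square_integrable (lebesgue_on (ball 0 1)) (gradient u)"
    by (rule square_integrable_on_ball[OF continuous_on_gradient[OF u]])
  fix \<phi> :: "'a \<Rightarrow> real" and b :: 'a assume \<phi>: "\<phi> \<in> test_functions (ball 0 1)" and b: "b \<in> Basis"
  have s\<phi>: "smooth \<phi>" using \<phi> by (simp add: test_functions_def)
  have out: "x \<notin> closure {x. \<phi> x \<noteq> 0}" if "x \<notin> ball 0 1" for x using \<phi> that by (auto simp: test_functions_def)
  have \<phi>0: "\<phi> x = 0" if "x \<notin> ball 0 1" for x
    using out[OF that] closure_subset[of "{x. \<phi> x \<noteq> 0}"] by blast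
  have g\<phi>0: "gradient \<phi> x = 0" if x: "x \<notin> ball 0 1" for x
  proof (rule gradient_eq)
    show "(\<phi> has_derivative (\<lambda>v. 0 \<bullet> v)) (at x)"
    proof (rule has_derivative_transform_within_open)
      show "((\<lambda>_. 0) has_derivative (\<lambda>v. 0 \<bullet> v)) (at x)" by simp
      show "open (- closure {x. \<phi> x \<noteq> 0})" by (intro open_Compl closed_closure)
      show "\<And>y. y \<in> - closure {x. \<phi> x \<noteq> 0} \<Longrightarrow> 0 = \<phi> y"
        using closure_subset[of "{x. \<phi> x \<noteq> 0}"] by auto
    qed (use out[OF x] in auto)
  qed
  define G where "G x = \<phi> x *\<^sub>R gradient u x + u x *\<^sub>R gradient \<phi> x" for x
  have cG: "continuous_on UNIV G" unfolding G_def
    by (intro continuous_intros smooth_continuous continuous_on_gradient u s\<phi>)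
  have der: "((\<lambda>x. u x * \<phi> x) has_derivative (\<lambda>v. G x \<bullet> v)) (at x)" for x
    unfolding G_def
    by (rule has_derivative_eq_rhs[OF has_derivative_mult[OF smooth_has_derivative[OF u] smooth_has_derivative[OF s\<phi>]]])
      (auto simp: inner_simps fun_eq_iff)
  have z: "(\<integral>x. G x \<bullet> b \<partial>lborel) = 0"
    by (rule integral_partial_derivative_zero(1)[OF der cG _ b, of 1]) (use \<phi>0 in auto)
  have mu: "u \<in> borel_measurable borel" "\<phi> \<in> borel_measurable borel"
     "gradient u \<in> borel_measurable borel" "gradient \<phi> \<in> borel_measurable borel"
    using u s\<phi> by (auto intro!: borel_measurable_continuous_onI smooth_continuous continuous_on_gradient)
  note [measurable] = mu
  have c1: "continuous_on UNIV (\<lambda>x. u x * (gradient \<phi> x \<bullet> b))" "continuous_on UNIV (\<lambda>x. (gradient u x \<bullet> b) * \<phi> x)"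
    by (intro continuous_intros smooth_continuous continuous_on_gradient u s\<phi>)+
  have i: "integrable lborel (\<lambda>x. u x * (gradient \<phi> x \<bullet> b))"
  proof -
    have "u x * (gradient \<phi> x \<bullet> b) = 0" if "norm x > 1" for x using that g\<phi>0[of x] by simp
    from continuous_bounded_support_bounded[OF c1(1) this]
    obtain B where "\<And>x. norm (u x * (gradient \<phi> x \<bullet> b)) \<le> B" by blast
    then show ?thesis by (intro integrable_bounded_support[where D=B and R=1]) (use g\<phi>0 in auto)
  qed
  have i2: "integrable lborel (\<lambda>x. (gradient u x \<bullet> b) * \<phi> x)"
  proof -
    have "(gradient u x \<bullet> b) * \<phi> x = 0" if "norm x > 1" for x using that \<phi>0[of x] by simp
    from continuous_bounded_support_bounded[OF c1(2) this]
    obtain B where "\<And>x. norm ((gradient u x \<bullet> b) * \<phi> x) \<le> B" by blast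
    then show ?thesis by (intro integrable_bounded_support[where D=B and R=1]) (use \<phi>0 in auto)
  qed
  have "(\<integral>x. G x \<bullet> b \<partial>lborel) = (\<integral>x. (gradient u x \<bullet> b) * \<phi> x + u x * (gradient \<phi> x \<bullet> b) \<partial>lborel)"
    by (simp add: G_def inner_simps mult.commute)
  also have "\<dots> = (\<integral>x. (gradient u x \<bullet> b) * \<phi> x \<partial>lborel) + (\<integral>x. u x * (gradient \<phi> x \<bullet> b) \<partial>lborel)"
    by (rule Bochner_Integration.integral_add[OF i2 i])
  finally have "(\<integral>x. u x * (gradient \<phi> x \<bullet> b) \<partial>lborel) + (\<integral>x. (gradient u x \<bullet> b) * \<phi> x \<partial>lborel) = 0"
    unfolding z by (metis add.commute)
  then have a: "(\<integral>x. u x * (gradient \<phi> x \<bullet> b) \<partial>lborel) = - (\<integral>x. (gradient u x \<bullet> b) * \<phi> x \<partial>lborel)"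
    unfolding eq_neg_iff_add_eq_0 .
  have z1: "u x * (gradient \<phi> x \<bullet> b) = 0" if "x \<notin> ball 0 1" for x
    using g\<phi>0[OF that] by simp
  have z2: "(gradient u x \<bullet> b) * \<phi> x = 0" if "x \<notin> ball 0 1" for x
    using \<phi>0[OF that] by simp
  have b: "(LINT x|lebesgue_on (ball 0 1). u x * (gradient \<phi> x \<bullet> b)) = (\<integral>x. u x * (gradient \<phi> x \<bullet> b) \<partial>lborel)"
    by (rule integral_on_ball_eq[OF borel_measurable_continuous_onI[OF c1(1)]]) (rule z1)
  have c: "(LINT x|lebesgue_on (ball 0 1). (gradient u x \<bullet> b) * \<phi> x) = (\<integral>x. (gradient u x \<bullet> b) * \<phi> x \<partial>lborel)"
    by (rule integral_on_ball_eq[OF borel_measurable_continuous_onI[OF c1(2)]]) (rule z2)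
  show "(LINT x|lebesgue_on (ball 0 1). u x * (gradient \<phi> x \<bullet> b)) = - (LINT x|lebesgue_on (ball 0 1). (gradient u x \<bullet> b) * \<phi> x)"
    unfolding b c by (rule a)
qed

lemma smooth_in_H1:
  assumes "smooth u" shows "u \<in> H1 (ball 0 1)"
  unfolding H1_def
proof (intro CollectI conjI exI)
  show "square_integrable (lebesgue_on (ball 0 1)) u"
    by (intro square_integrable_on_ball smooth_continuous assms)
  show "has_L2_weak_gradient (ball 0 1) u (gradient u)"
    by (rule smooth_has_L2_weak_gradient[OF assms])
qed

definition flat :: "real poly \<Rightarrow> real \<Rightarrow> real" where
  "flat p t = (if t > 0 then poly p (1 / t) * exp (- 1 / t) else 0)"

lemma tendsto_poly_div_exp: "((\<lambda>x. poly p x / exp x) \<longlongrightarrow> (0::real)) at_top"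
proof -
  have "((\<lambda>x. \<Sum>i\<le>degree p. coeff p i * (x ^ i / exp x)) \<longlongrightarrow> (\<Sum>i\<le>degree p. coeff p i * 0)) at_top"
    by (intro tendsto_sum tendsto_mult tendsto_const tendsto_power_div_exp_0)
  then show ?thesis by (simp add: poly_altdef sum_divide_distrib)
qed

lemma flat_tendsto_0: "(flat p \<longlongrightarrow> 0) (at 0)"
proof -
  have "((\<lambda>t. poly p (1 / t) / exp (1 / t)) \<longlongrightarrow> 0) (at_right (0::real))"
    by (rule filterlim_compose[OF tendsto_poly_div_exp])
      (simp add: divide_inverse filterlim_inverse_at_top_right)
  moreover have "\<forall>\<^sub>F t in at_right (0::real). poly p (1 / t) / exp (1 / t) = flat p t"
    by (auto simp: eventually_at_filter flat_def exp_minus divide_inverse)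
  ultimately have r: "(flat p \<longlongrightarrow> 0) (at_right 0)" by (rule Lim_transform_eventually)
  have "\<forall>\<^sub>F t in at_left (0::real). 0 = flat p t"
    by (auto simp: eventually_at_filter flat_def)
  then have "(flat p \<longlongrightarrow> 0) (at_left 0)" by (rule Lim_transform_eventually[OF tendsto_const])
  with r show ?thesis by (simp add: filterlim_at_split)
qed

lemma flat_has_real_derivative:
  "(flat p has_real_derivative flat (monom 1 2 * (p - pderiv p)) t) (at t)"
proof (cases t "0::real" rule: linorder_cases)
  case less
  have "((\<lambda>_. 0) has_real_derivative 0) (at t)" by simp
  then have "(flat p has_real_derivative 0) (at t)"
    by (rule has_field_derivative_transform_within_open[where S="{..<0}"])
      (use less in \<open>auto simp: flat_def\<close>)
  then show ?thesis using less by (simp add: flat_def)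
next
  case greater
  have "((\<lambda>t. poly p (1 / t) * exp (- 1 / t)) has_real_derivative flat (monom 1 2 * (p - pderiv p)) t) (at t)"
    using greater
    by (auto intro!: derivative_eq_intros DERIV_chain2[OF poly_DERIV]
      simp: flat_def poly_monom power2_eq_square field_simps)
  then show ?thesis
    by (rule has_field_derivative_transform_within_open[where S="{0<..}"])
      (use greater in \<open>auto simp: flat_def\<close>)
next
  case equal
  have "\<forall>\<^sub>F h in at (0::real). flat (monom 1 1 * p) h = (flat p (0 + h) - flat p 0) / h"
    by (auto simp: eventually_at_filter flat_def poly_monom)
  from Lim_transform_eventually[OF flat_tendsto_0 this]
  show ?thesis using equal by (simp add: DERIV_def flat_def)
qed

text \<open>A class of smooth functions that contains the bump functions and is closed under
  differentiation.\<close>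

inductive elementary_smooth :: "('a::euclidean_space \<Rightarrow> real) \<Rightarrow> bool" where
  const: "elementary_smooth (\<lambda>_. c)"
| flat: "elementary_smooth (\<lambda>x. flat p (c * (x \<bullet> b) + d))"
| add: "elementary_smooth f \<Longrightarrow> elementary_smooth g \<Longrightarrow> elementary_smooth (\<lambda>x. f x + g x)"
| mult: "elementary_smooth f \<Longrightarrow> elementary_smooth g \<Longrightarrow> elementary_smooth (\<lambda>x. f x * g x)"

lemma elementary_smooth_derivative:
  "elementary_smooth f \<Longrightarrow>
    \<exists>D. (\<forall>x. (f has_derivative D x) (at x)) \<and> (\<forall>v. elementary_smooth (\<lambda>x. D x v))"
proof (induction rule: elementary_smooth.induct)
  case (const c)
  show ?case using elementary_smooth.const[of 0] by (intro exI[of _ "\<lambda>x v. 0"]) simp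
next
  case (flat p c b d)
  let ?q = "monom 1 2 * (p - pderiv p)"
  show ?case
  proof (intro exI[of _ "\<lambda>x v. flat ?q (c * (x \<bullet> b) + d) * (c * (v \<bullet> b))"] conjI allI)
    fix x :: 'a
    have 1: "((\<lambda>x. c * (x \<bullet> b) + d) has_derivative (\<lambda>v. c * (v \<bullet> b))) (at x)"
      by (auto intro!: derivative_eq_intros)
    have 2: "(flat p has_derivative (\<lambda>h. flat ?q (c * (x \<bullet> b) + d) * h)) (at (c * (x \<bullet> b) + d))"
      using flat_has_real_derivative[of p] by (simp add: has_field_derivative_def)
    show "((\<lambda>x. flat p (c * (x \<bullet> b) + d)) has_derivative (\<lambda>v. flat ?q (c * (x \<bullet> b) + d) * (c * (v \<bullet> b)))) (at x)"
      using diff_chain_at[OF 1 2] by (simp add: o_def)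
  next
    fix v :: 'a
    show "elementary_smooth (\<lambda>x. flat ?q (c * (x \<bullet> b) + d) * (c * (v \<bullet> b)))"
      by (rule elementary_smooth.mult[OF elementary_smooth.flat elementary_smooth.const])
  qed
next
  case (add f g)
  then obtain D E where "\<forall>x. (f has_derivative D x) (at x)" "\<forall>v. elementary_smooth (\<lambda>x. D x v)"
    "\<forall>x. (g has_derivative E x) (at x)" "\<forall>v. elementary_smooth (\<lambda>x. E x v)" by blast
  then show ?case
    by (intro exI[of _ "\<lambda>x v. D x v + E x v"] conjI allI has_derivative_add elementary_smooth.add) blast+
next
  case (mult f g)
  then obtain D E where "\<forall>x. (f has_derivative D x) (at x)" "\<forall>v. elementary_smooth (\<lambda>x. D x v)"
    "\<forall>x. (g has_derivative E x) (at x)" "\<forall>v. elementary_smooth (\<lambda>x. E x v)" by blast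
  with mult.hyps show ?case
    by (intro exI[of _ "\<lambda>x v. f x * E x v + D x v * g x"] conjI allI has_derivative_mult
        elementary_smooth.add[OF elementary_smooth.mult elementary_smooth.mult]) blast+
qed

lemma elementary_smooth_smooth:
  assumes "elementary_smooth f" shows "smooth f"
proof -
  have frechet: "f differentiable (at x) \<and> elementary_smooth (\<lambda>x. frechet_derivative f (at x) v)"
    if es: "elementary_smooth f" for f :: "'a \<Rightarrow> real" and x v
  proof -
    obtain D where D: "\<And>x. (f has_derivative D x) (at x)" "\<And>v. elementary_smooth (\<lambda>x. D x v)"
      using elementary_smooth_derivative[OF es] by blast
    have "frechet_derivative f (at x) = D x" for x using D(1) by (metis frechet_derivative_at)
    then show ?thesis using D by (auto simp: differentiable_def)
  qed
  have "elementary_smooth (iterated_partial vs f)" for vs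
    using assms frechet by (induction vs) auto
  then show ?thesis using frechet unfolding smooth_def by blast
qed

text \<open>The shift by \<open>1\<close> keeps the support at distance \<open>1/n\<close> from the faces of the box.\<close>

definition box_bump :: "'a::euclidean_space \<Rightarrow> 'a \<Rightarrow> nat \<Rightarrow> 'a \<Rightarrow> real" where
  "box_bump l u n x = (\<Prod>b\<in>Basis. flat 1 (real n * (real n * (x \<bullet> b - l \<bullet> b) - 1))
      * flat 1 (real n * (real n * (u \<bullet> b - x \<bullet> b) - 1)))"

lemma flat_1_bounds: "0 \<le> flat 1 t" "flat 1 t \<le> 1"
  by (auto simp: flat_def)

lemma box_bump_bounds: "0 \<le> box_bump l u n x" "box_bump l u n x \<le> 1"
  unfolding box_bump_def by (auto intro!: prod_nonneg prod_le_1 mult_le_one simp: flat_1_bounds)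

lemma smooth_box_bump: "smooth (box_bump l u n)"
proof -
  have *: "elementary_smooth (\<lambda>x. flat 1 (real n * (real n * (x \<bullet> b - l \<bullet> b) - 1))
      * flat 1 (real n * (real n * (u \<bullet> b - x \<bullet> b) - 1)))" for b
  proof (rule elementary_smooth.mult)
    have "(\<lambda>x. flat 1 (real n * (real n * (x \<bullet> b - l \<bullet> b) - 1)))
       = (\<lambda>x. flat 1 ((real n * real n) * (x \<bullet> b) + (- real n * real n * (l \<bullet> b) - real n)))"
      by (simp add: algebra_simps)
    then show "elementary_smooth (\<lambda>x. flat 1 (real n * (real n * (x \<bullet> b - l \<bullet> b) - 1)))"
      by (simp only: elementary_smooth.flat)
    have "(\<lambda>x. flat 1 (real n * (real n * (u \<bullet> b - x \<bullet> b) - 1)))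
       = (\<lambda>x. flat 1 ((- real n * real n) * (x \<bullet> b) + (real n * real n * (u \<bullet> b) - real n)))"
      by (simp add: algebra_simps)
    then show "elementary_smooth (\<lambda>x. flat 1 (real n * (real n * (u \<bullet> b - x \<bullet> b) - 1)))"
      by (simp only: elementary_smooth.flat)
  qed
  have "elementary_smooth (\<lambda>x. \<Prod>b\<in>S. flat 1 (real n * (real n * (x \<bullet> b - l \<bullet> b) - 1))
      * flat 1 (real n * (real n * (u \<bullet> b - x \<bullet> b) - 1)))" if "finite S" for S
    using that
  proof induction
    case empty
    show ?case using elementary_smooth.const[of 1] by simp
  next
    case (insert b S)
    show ?case unfolding prod.insert[OF insert(1,2)] by (rule elementary_smooth.mult[OF * insert(3)])
  qed
  from elementary_smooth_smooth[OF this[OF finite_Basis]] show ?thesis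
    by (simp add: box_bump_def[abs_def])
qed

lemma box_bump_test_function:
  assumes n: "n > 0" and box: "box l u \<subseteq> \<Omega>"
  shows "box_bump l u n \<in> test_functions \<Omega>"
proof -
  let ?C = "cbox (l + (1 / real n) *\<^sub>R One) (u - (1 / real n) *\<^sub>R One)"
  have "{x. box_bump l u n x \<noteq> 0} \<subseteq> ?C"
  proof
    fix x assume "x \<in> {x. box_bump l u n x \<noteq> 0}"
    then have "flat 1 (real n * (real n * (x \<bullet> b - l \<bullet> b) - 1)) \<noteq> 0 \<and> flat 1 (real n * (real n * (u \<bullet> b - x \<bullet> b) - 1)) \<noteq> 0"
      if "b \<in> Basis" for b
      using that by (auto simp: box_bump_def prod_zero_iff)
    then have "real n * (x \<bullet> b - l \<bullet> b) > 1 \<and> real n * (u \<bullet> b - x \<bullet> b) > 1" if "b \<in> Basis" for b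
      using that n by (force simp: flat_def zero_less_mult_iff split: if_splits)
    then have "x \<bullet> b - l \<bullet> b \<ge> 1 / real n \<and> u \<bullet> b - x \<bullet> b \<ge> 1 / real n" if "b \<in> Basis" for b
      using that n by (simp add: divide_le_eq mult.commute less_imp_le)
    then show "x \<in> ?C" by (force simp: mem_box inner_simps)
  qed
  then have cl: "closure {x. box_bump l u n x \<noteq> 0} \<subseteq> ?C"
    by (intro closure_minimal closed_cbox)
  have "?C \<subseteq> box l u"
  proof
    fix x assume "x \<in> ?C"
    then have *: "l \<bullet> b + 1 / real n \<le> x \<bullet> b \<and> x \<bullet> b \<le> u \<bullet> b - 1 / real n" if "b \<in> Basis" for b
      using that by (simp add: mem_box inner_simps)
    have "1 / real n > 0" using n by simp
    then have "l \<bullet> b < x \<bullet> b \<and> x \<bullet> b < u \<bullet> b" if "b \<in> Basis" for b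
      using *[OF that] by linarith
    then show "x \<in> box l u" by (simp add: mem_box)
  qed
  with cl box have "closure {x. box_bump l u n x \<noteq> 0} \<subseteq> \<Omega>" by blast
  moreover have "compact (closure {x. box_bump l u n x \<noteq> 0})"
    using cl by (metis bounded_cbox bounded_subset closed_closure compact_eq_bounded_closed)
  ultimately show ?thesis by (simp add: test_functions_def smooth_box_bump)
qed

lemma flat_tendsto_step: "(\<lambda>n. flat 1 (real n * (real n * y - 1))) \<longlonglongrightarrow> (if y > 0 then 1 else 0)"
proof (cases "y > 0")
  case True
  have "filterlim (\<lambda>n. -1 + y * real n) at_top sequentially"
    by (rule filterlim_tendsto_add_at_top[OF tendsto_const
          filterlim_tendsto_pos_mult_at_top[OF tendsto_const True filterlim_real_sequentially]])
  from filterlim_at_top_mult_at_top[OF filterlim_real_sequentially this]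
  have f: "filterlim (\<lambda>n. real n * (real n * y - 1)) at_top sequentially"
    by (simp add: mult.commute)
  then have "(\<lambda>n. exp (- (inverse (real n * (real n * y - 1))))) \<longlonglongrightarrow> exp (- 0)"
    by (intro tendsto_intros tendsto_inverse_0_at_top)
  moreover have "\<forall>\<^sub>F n in sequentially. exp (- (inverse (real n * (real n * y - 1)))) = flat 1 (real n * (real n * y - 1))"
    using filterlim_at_top_dense[THEN iffD1, OF f, rule_format, of 0]
    by eventually_elim (simp add: flat_def divide_inverse)
  ultimately show ?thesis using True by (auto intro: Lim_transform_eventually)
next
  case False
  have "real n * (real n * y - 1) \<le> 0" for n
    using False by (intro mult_nonneg_nonpos) (auto simp: mult_nonneg_nonpos intro: order_trans[of _ 0])
  then have "flat 1 (real n * (real n * y - 1)) = 0" for n using not_less by (auto simp: flat_def)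
  then show ?thesis using False by simp
qed

lemma box_bump_tendsto: "(\<lambda>n. box_bump l u n x) \<longlonglongrightarrow> indicator (box l u) x"
proof -
  have "(\<lambda>n. box_bump l u n x) \<longlonglongrightarrow> (\<Prod>b\<in>Basis. (if x \<bullet> b - l \<bullet> b > 0 then 1 else 0) * (if u \<bullet> b - x \<bullet> b > 0 then 1 else 0))"
    unfolding box_bump_def by (intro tendsto_prod tendsto_mult flat_tendsto_step)
  also have "(\<Prod>b\<in>Basis. (if x \<bullet> b - l \<bullet> b > 0 then 1 else 0) * (if u \<bullet> b - x \<bullet> b > 0 then 1 else 0)) = (indicator (box l u) x :: real)"
  proof (cases "x \<in> box l u")
    case True
    then show ?thesis by (simp add: mem_box)
  next
    case False
    then show ?thesis by (subst prod_zero) (auto simp: mem_box)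
  qed
  finally show ?thesis .
qed

lemma AE_zero_of_box_integrals:
  fixes f :: "'a::euclidean_space \<Rightarrow> real"
  assumes f: "integrable lborel f" and z: "\<And>l u. (\<integral>x. f x * indicator (box l u) x \<partial>lborel) = 0"
  shows "AE x in lborel. f x = 0"
proof -
  have fm[measurable]: "f \<in> borel_measurable borel" using f by auto
  have fin: "(\<integral>\<^sup>+x. ennreal (f x) \<partial>lborel) < \<infinity>"
    using f by (auto simp: real_integrable_def less_top[symmetric])
  have eq: "(\<integral>\<^sup>+x. ennreal (f x) * indicator (box l u) x \<partial>lborel) = (\<integral>\<^sup>+x. ennreal (- f x) * indicator (box l u) x \<partial>lborel)" for l u
  proof -
    have i: "integrable lborel (\<lambda>x. f x * indicator (box l u) x)"
      by (rule integrable_real_mult_indicator) (use f in auto)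
    have a: "(\<integral>\<^sup>+x. ennreal (g x) * indicator (box l u) x \<partial>lborel) = (\<integral>\<^sup>+x. ennreal (g x * indicator (box l u) x) \<partial>lborel)" for g :: "'a \<Rightarrow> real"
      by (intro nn_integral_cong) (auto split: split_indicator)
    have p: "(\<integral>\<^sup>+x. ennreal (f x * indicator (box l u) x) \<partial>lborel) < \<infinity>" "(\<integral>\<^sup>+x. ennreal (- (f x * indicator (box l u) x)) \<partial>lborel) < \<infinity>"
      using i by (auto simp: real_integrable_def less_top[symmetric])
    let ?p = "\<integral>\<^sup>+x. ennreal (f x * indicator (box l u) x) \<partial>lborel"
    let ?n = "\<integral>\<^sup>+x. ennreal (- (f x * indicator (box l u) x)) \<partial>lborel"
    have "(\<integral>x. f x * indicator (box l u) x \<partial>lborel) = enn2real ?p - enn2real ?n"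
      by (rule real_lebesgue_integral_def[OF i])
    then have "enn2real ?p = enn2real ?n" unfolding z by (rule eq_iff_diff_eq_0[THEN iffD2, OF sym])
    then have "?p = ?n"
      using ennreal_enn2real[OF p(1)[unfolded infinity_ennreal_def]]
        ennreal_enn2real[OF p(2)[unfolded infinity_ennreal_def]] by metis
    then show ?thesis unfolding a by simp
  qed
  have "density lborel (\<lambda>x. ennreal (f x)) = density lborel (\<lambda>x. ennreal (- f x))"
  proof (rule measure_eqI_generator_eq)
    let ?E = "range (\<lambda>(a, b). box a b::'a set)"
    let ?A = "\<lambda>n::nat. box (- (real n *\<^sub>R One)) (real n *\<^sub>R One) :: 'a set"
    show "Int_stable ?E" by (auto simp: Int_stable_def box_Int_box)
    show "?E \<subseteq> Pow UNIV" "sets (density lborel (\<lambda>x. ennreal (f x))) = sigma_sets UNIV ?E"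
      "sets (density lborel (\<lambda>x. ennreal (- f x))) = sigma_sets UNIV ?E"
      by (simp_all add: borel_eq_box)
    show "range ?A \<subseteq> ?E" "(\<Union>i. ?A i) = UNIV" unfolding UN_box_eq_UNIV by auto
    show "emeasure (density lborel (\<lambda>x. ennreal (f x))) (?A i) \<noteq> \<infinity>" for i
    proof -
      have "emeasure (density lborel (\<lambda>x. ennreal (f x))) (?A i) \<le> (\<integral>\<^sup>+x. ennreal (f x) \<partial>lborel)"
        by (subst emeasure_density) (auto intro!: nn_integral_mono split: split_indicator)
      then show ?thesis using fin by auto
    qed
    fix X assume "X \<in> ?E"
    then obtain l u where "X = box l u" by auto
    then show "emeasure (density lborel (\<lambda>x. ennreal (f x))) X = emeasure (density lborel (\<lambda>x. ennreal (- f x))) X"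
      using eq by (simp add: emeasure_density)
  qed
  then have "AE x in lborel. ennreal (f x) = ennreal (- f x)"
    by (intro sigma_finite_measure.density_unique[OF sigma_finite_lborel]) auto
  then show ?thesis
  proof eventually_elim
    case (elim x)
    then show "f x = 0" by (cases "f x" "0::real" rule: linorder_cases) (auto simp: ennreal_neg ennreal_eq_0_iff)
  qed
qed

lemma AE_zero_of_test_functions:
  fixes f :: "'a::euclidean_space \<Rightarrow> real"
  assumes f: "integrable lborel f" and op: "open \<Omega>" and out: "\<And>x. x \<notin> \<Omega> \<Longrightarrow> f x = 0"
    and z: "\<And>\<phi>. \<phi> \<in> test_functions \<Omega> \<Longrightarrow> (\<integral>x. f x * \<phi> x \<partial>lborel) = 0"
  shows "AE x in lborel. f x = 0"
proof -
  have fm[measurable]: "f \<in> borel_measurable borel" using f by auto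
  have bm[measurable]: "box_bump l u n \<in> borel_measurable borel" for l u :: 'a and n
    by (rule borel_measurable_continuous_onI[OF smooth_continuous[OF smooth_box_bump]])
  have box0: "(\<integral>x. f x * indicator (box l u) x \<partial>lborel) = 0" if "box l u \<subseteq> \<Omega>" for l u
  proof -
    have "(\<lambda>n. \<integral>x. f x * box_bump l u (Suc n) x \<partial>lborel) \<longlonglongrightarrow> (\<integral>x. f x * indicator (box l u) x \<partial>lborel)"
    proof (rule integral_dominated_convergence[where w="\<lambda>x. \<bar>f x\<bar>"])
      show "AE x in lborel. (\<lambda>n. f x * box_bump l u (Suc n) x) \<longlonglongrightarrow> f x * indicator (box l u) x"
        by (intro AE_I2 tendsto_mult tendsto_const LIMSEQ_Suc box_bump_tendsto)
      show "AE x in lborel. norm (f x * box_bump l u (Suc n) x) \<le> \<bar>f x\<bar>" for n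
        using box_bump_bounds[of l u "Suc n"] by (intro AE_I2) (auto simp: abs_mult mult_left_le)
    qed (use f in auto)
    moreover have "(\<integral>x. f x * box_bump l u (Suc n) x \<partial>lborel) = 0" for n
      by (rule z[OF box_bump_test_function[OF _ that]]) simp
    ultimately show ?thesis by (simp add: LIMSEQ_const_iff)
  qed
  have loc: "AE x in lborel. x \<in> box a b \<longrightarrow> f x = 0" if ab: "box a b \<subseteq> \<Omega>" for a b
  proof -
    have "AE x in lborel. f x * indicator (box a b) x = 0"
    proof (rule AE_zero_of_box_integrals)
      show "integrable lborel (\<lambda>x. f x * indicator (box a b) x)"
        by (rule integrable_real_mult_indicator) (use f in auto)
      fix l u :: 'a
      obtain c d where cd: "box a b \<inter> box l u = box c d" using box_Int_box by blast
      have "(\<integral>x. f x * indicator (box a b) x * indicator (box l u) x \<partial>lborel) = (\<integral>x. f x * indicator (box c d) x \<partial>lborel)"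
        by (simp add: cd[symmetric] indicator_inter_arith mult.assoc)
      also have "\<dots> = 0" using cd ab by (intro box0) auto
      finally show "(\<integral>x. f x * indicator (box a b) x * indicator (box l u) x \<partial>lborel) = 0" .
    qed
    then show ?thesis by eventually_elim auto
  qed
  obtain D where D: "countable D" "D \<subseteq> Pow \<Omega>" "\<And>X. X \<in> D \<Longrightarrow> \<exists>a b. X = box a b" "\<Union>D = \<Omega>"
    using open_countable_Union_open_box[OF op] by metis
  have "AE x in lborel. \<forall>X\<in>D. x \<in> X \<longrightarrow> f x = 0"
  proof (rule AE_ball_countable'[OF _ D(1)])
    fix X assume X: "X \<in> D"
    then obtain a b where "X = box a b" using D(3) by blast
    then show "AE x in lborel. x \<in> X \<longrightarrow> f x = 0" using loc X D(2) by auto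
  qed
  then show ?thesis
  proof eventually_elim
    case (elim x)
    then show ?case using out[of x] D(4) by (cases "x \<in> \<Omega>") auto
  qed
qed

section \<open>Hardy inequalities on the ball\<close>

lemma nn_integral_continuous_Icc:
  fixes f :: "real \<Rightarrow> real"
  assumes "continuous_on {a..b} f" "\<And>x. x \<in> {a..b} \<Longrightarrow> 0 \<le> f x"
  shows "(\<integral>\<^sup>+x. ennreal (f x) * indicator {a..b} x \<partial>lborel) = ennreal (integral {a..b} f)"
  using assms(2) integrable_integral[OF integrable_continuous_real[OF assms(1)]]
  by (rule nn_integral_has_integral_lebesgue')

lemma nn_integral_polar_ball:
  fixes f :: "'a::euclidean_space \<Rightarrow> ennreal"
  assumes [measurable]: "f \<in> borel_measurable borel"
  shows "(\<integral>\<^sup>+x. f x * indicator (ball 0 1) x \<partial>lborel)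
    = (\<integral>\<^sup>+\<omega>. (\<integral>\<^sup>+r. ennreal (r ^ (DIM('a) - 1)) * f (r *\<^sub>R \<omega>) * indicator {0..1} r \<partial>lborel) \<partial>sphere_measure)"
proof -
  have [measurable]: "ball (0::'a) 1 \<in> sets borel" by simp
  have ae: "AE r in lborel. r \<noteq> (0::real) \<and> r \<noteq> 1"
    using AE_lborel_singleton[of "0::real"] AE_lborel_singleton[of "1::real"] by eventually_elim auto
  have "(\<integral>\<^sup>+x. f x * indicator (ball 0 1) x \<partial>lborel)
    = (\<integral>\<^sup>+\<omega>. (\<integral>\<^sup>+r. ennreal (r ^ (DIM('a) - 1)) * indicator {0<..} r * (f (r *\<^sub>R \<omega>) * indicator (ball 0 1) (r *\<^sub>R \<omega>)) \<partial>lborel) \<partial>sphere_measure)"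
    by (rule nn_integral_polar) measurable
  also have "\<dots> = (\<integral>\<^sup>+\<omega>. (\<integral>\<^sup>+r. ennreal (r ^ (DIM('a) - 1)) * f (r *\<^sub>R \<omega>) * indicator {0..1} r \<partial>lborel) \<partial>sphere_measure)"
  proof (rule nn_integral_cong, rule nn_integral_cong_AE)
    fix \<omega> :: 'a assume "\<omega> \<in> space sphere_measure"
    then have \<omega>: "norm \<omega> = 1" by simp
    show "AE r in lborel. ennreal (r ^ (DIM('a) - 1)) * indicator {0<..} r * (f (r *\<^sub>R \<omega>) * indicator (ball 0 1) (r *\<^sub>R \<omega>))
      = ennreal (r ^ (DIM('a) - 1)) * f (r *\<^sub>R \<omega>) * indicator {0..1} r"
      using ae by eventually_elim (auto simp: \<omega> split: split_indicator)
  qed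
  finally show ?thesis .
qed

lemma nn_integral_polar_exterior:
  fixes f :: "'a::euclidean_space \<Rightarrow> ennreal"
  assumes [measurable]: "f \<in> borel_measurable borel"
  shows "(\<integral>\<^sup>+x. f x * indicator {x. norm x > 1} x \<partial>lborel)
    = (\<integral>\<^sup>+\<omega>. (\<integral>\<^sup>+r. ennreal (r ^ (DIM('a) - 1)) * f (r *\<^sub>R \<omega>) * indicator {1..} r \<partial>lborel) \<partial>sphere_measure)"
proof -
  have ae: "AE r in lborel. r \<noteq> (1::real)" by (rule AE_lborel_singleton)
  have "(\<integral>\<^sup>+x. f x * indicator {x. norm x > 1} x \<partial>lborel)
    = (\<integral>\<^sup>+\<omega>. (\<integral>\<^sup>+r. ennreal (r ^ (DIM('a) - 1)) * indicator {0<..} r * (f (r *\<^sub>R \<omega>) * indicator {x. norm x > 1} (r *\<^sub>R \<omega>)) \<partial>lborel) \<partial>sphere_measure)"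
    by (rule nn_integral_polar) measurable
  also have "\<dots> = (\<integral>\<^sup>+\<omega>. (\<integral>\<^sup>+r. ennreal (r ^ (DIM('a) - 1)) * f (r *\<^sub>R \<omega>) * indicator {1..} r \<partial>lborel) \<partial>sphere_measure)"
  proof (rule nn_integral_cong, rule nn_integral_cong_AE)
    fix \<omega> :: 'a assume "\<omega> \<in> space sphere_measure"
    then have \<omega>: "norm \<omega> = 1" by simp
    show "AE r in lborel. ennreal (r ^ (DIM('a) - 1)) * indicator {0<..} r * (f (r *\<^sub>R \<omega>) * indicator {x. norm x > 1} (r *\<^sub>R \<omega>))
      = ennreal (r ^ (DIM('a) - 1)) * f (r *\<^sub>R \<omega>) * indicator {1..} r"
      using ae by eventually_elim (auto simp: \<omega> split: split_indicator)
  qed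
  finally show ?thesis .
qed

lemma borel_measurable_sphere_radial:
  fixes f :: "'a::euclidean_space \<Rightarrow> ennreal" and h :: "real \<Rightarrow> ennreal"
  assumes [measurable]: "f \<in> borel_measurable borel" "h \<in> borel_measurable borel"
  shows "(\<lambda>\<omega>. \<integral>\<^sup>+r. h r * f (r *\<^sub>R \<omega>) \<partial>lborel) \<in> borel_measurable sphere_measure"
proof -
  have [measurable]: "(\<lambda>\<omega>. \<omega>) \<in> measurable sphere_measure (borel :: 'a measure)"
    by (subst measurable_cong_sets[OF sets_sphere_measure refl]) (simp add: measurable_restrict_space1)
  show ?thesis by measurable
qed

lemma borel_measurable_sphere:
  fixes f :: "'a::euclidean_space \<Rightarrow> 'b::topological_space"
  assumes "f \<in> borel_measurable borel"
  shows "f \<in> borel_measurable sphere_measure"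
  using assms by (subst measurable_cong_sets[OF sets_sphere_measure refl]) (simp add: measurable_restrict_space1)

lemma nn_integral_on_ball:
  "(\<integral>\<^sup>+x. f x \<partial>lebesgue_on (ball (0::'a::euclidean_space) 1)) = (\<integral>\<^sup>+x. f x * indicator (ball 0 1) x \<partial>lborel)"
  by (subst nn_integral_restrict_space) (auto simp: nn_integral_completion)

definition ray_derivative :: "('a::euclidean_space \<Rightarrow> real) \<Rightarrow> 'a \<Rightarrow> real \<Rightarrow> real" where
  "ray_derivative u \<omega> r = gradient u (r *\<^sub>R \<omega>) \<bullet> \<omega>"

lemma ray_has_derivative:
  assumes "smooth u"
  shows "((\<lambda>r. u (r *\<^sub>R \<omega>)) has_real_derivative ray_derivative u \<omega> r) (at r)"
proof -
  have "((\<lambda>r. r *\<^sub>R \<omega>) has_derivative (\<lambda>t. t *\<^sub>R \<omega>)) (at r)" by (auto intro!: derivative_eq_intros)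
  from diff_chain_at[OF this, of u "\<lambda>v. gradient u (r *\<^sub>R \<omega>) \<bullet> v"] smooth_has_derivative[OF assms]
  show ?thesis by (simp add: o_def has_field_derivative_def ray_derivative_def mult_commute_abs)
qed

lemma continuous_on_ray:
  assumes "smooth u"
  shows "continuous_on A (\<lambda>r. u (r *\<^sub>R \<omega>))" "continuous_on A (ray_derivative u \<omega>)"
    "continuous_on A (\<lambda>r. gradient u (r *\<^sub>R \<omega>))"
proof -
  show 1: "continuous_on A (\<lambda>r. gradient u (r *\<^sub>R \<omega>))"
    by (rule continuous_on_compose2[OF continuous_on_gradient[OF assms, of UNIV]]) (auto intro!: continuous_intros)
  show "continuous_on A (\<lambda>r. u (r *\<^sub>R \<omega>))"
    by (rule continuous_on_compose2[OF smooth_continuous[OF assms, of UNIV]]) (auto intro!: continuous_intros)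
  show "continuous_on A (ray_derivative u \<omega>)"
    unfolding ray_derivative_def[abs_def] by (intro continuous_intros 1)
qed

lemma ray_derivative_le:
  assumes "norm \<omega> = 1"
  shows "(ray_derivative u \<omega> r)\<^sup>2 \<le> (norm (gradient u (r *\<^sub>R \<omega>)))\<^sup>2"
proof -
  have "\<bar>ray_derivative u \<omega> r\<bar> \<le> norm (gradient u (r *\<^sub>R \<omega>)) * 1"
    unfolding ray_derivative_def using Cauchy_Schwarz_ineq2 assms by metis
  then have "\<bar>ray_derivative u \<omega> r\<bar>\<^sup>2 \<le> (norm (gradient u (r *\<^sub>R \<omega>)))\<^sup>2" by (intro power_mono) auto
  then show ?thesis by simp
qed

lemma ray_Hardy:
  fixes u :: "'a::euclidean_space \<Rightarrow> real" and d :: nat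
  assumes u: "smooth u" and d: "d \<ge> 1" and \<omega>: "norm \<omega> = 1"
  shows "(\<integral>\<^sup>+r. ennreal (r ^ (d - 1) * (u (r *\<^sub>R \<omega>))\<^sup>2) * indicator {0..1} r \<partial>lborel)
    \<le> ennreal (4 / real d ^ 2) * (\<integral>\<^sup>+r. ennreal (r ^ (d + 1) * (norm (gradient u (r *\<^sub>R \<omega>)))\<^sup>2) * indicator {0..1} r \<partial>lborel)
      + ennreal (2 / real d * (u \<omega>)\<^sup>2)"
proof -
  let ?U = "\<lambda>r. u (r *\<^sub>R \<omega>)" and ?D = "ray_derivative u \<omega>"
  note ct = continuous_on_ray[OF u, where \<omega>=\<omega>]
  define a where "a r = r ^ (d - 1) * (?U r)\<^sup>2" for r
  define b where "b r = r ^ (d + 1) * (norm (gradient u (r *\<^sub>R \<omega>)))\<^sup>2" for r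
  define F' where "F' r = real d * r ^ (d - 1) * (?U r)\<^sup>2 + r ^ d * (2 * ?U r * ?D r)" for r
  have ca: "continuous_on {0..1} a" and cb: "continuous_on {0..1} b" and cF: "continuous_on {0..1} F'"
    unfolding a_def b_def F'_def by (intro continuous_intros ct)+
  have d': "real d > 0" using d by simp
  have "(F' has_integral 1 ^ d * (?U 1)\<^sup>2 - 0 ^ d * (?U 0)\<^sup>2) {0..1}"
  proof (rule fundamental_theorem_of_calculus[where f="\<lambda>r. r ^ d * (?U r)\<^sup>2"])
    fix r :: real
    have "((\<lambda>r. r ^ d * (?U r)\<^sup>2) has_real_derivative F' r) (at r)"
      unfolding F'_def by (auto intro!: derivative_eq_intros ray_has_derivative[OF u] simp: mult_ac)
    then show "((\<lambda>r. r ^ d * (?U r)\<^sup>2) has_vector_derivative F' r) (at r within {0..1})"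
      unfolding has_real_derivative_iff_has_vector_derivative by (rule has_vector_derivative_at_within)
  qed simp
  then have F: "integral {0..1} F' = (u \<omega>)\<^sup>2" using d by (auto simp: zero_power dest: integral_unique)
  have pw: "real d / 2 * a r \<le> F' r + 2 / real d * b r" if r: "r \<in> {0..1}" for r
  proof -
    have r0: "0 \<le> r" using r by simp
    have rd: "r ^ d = r ^ (d - 1) * r" "r ^ (d + 1) = r ^ (d - 1) * r\<^sup>2"
      using d by (cases d; simp add: power2_eq_square)+
    have "0 \<le> real d / 2 * (?U r + 2 / real d * r * ?D r)\<^sup>2" using d' by simp
    also have "\<dots> = real d / 2 * (?U r)\<^sup>2 + 2 * r * ?U r * ?D r + 2 / real d * r\<^sup>2 * (?D r)\<^sup>2"
      using d' by (simp add: power2_eq_square field_simps)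
    also have "\<dots> \<le> real d / 2 * (?U r)\<^sup>2 + 2 * r * ?U r * ?D r + 2 / real d * r\<^sup>2 * (norm (gradient u (r *\<^sub>R \<omega>)))\<^sup>2"
      using ray_derivative_le[OF \<omega>, of u r] d' by (intro add_left_mono mult_left_mono) auto
    finally have "0 \<le> r ^ (d - 1) * (real d / 2 * (?U r)\<^sup>2 + 2 * r * ?U r * ?D r + 2 / real d * r\<^sup>2 * (norm (gradient u (r *\<^sub>R \<omega>)))\<^sup>2)"
      using r0 by (intro mult_nonneg_nonneg) auto
    then show ?thesis unfolding a_def b_def F'_def rd by (simp add: algebra_simps)
  qed
  have "real d / 2 * integral {0..1} a = integral {0..1} (\<lambda>r. real d / 2 * a r)" by simp
  also have "\<dots> \<le> integral {0..1} (\<lambda>r. F' r + 2 / real d * b r)"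
    by (intro integral_le integrable_continuous_real continuous_intros ca cb cF) (use pw in auto)
  also have "\<dots> = integral {0..1} F' + 2 / real d * integral {0..1} b"
    by (subst Henstock_Kurzweil_Integration.integral_add)
      (use d' in \<open>auto intro!: integrable_continuous_real continuous_intros cb cF\<close>)
  finally have I: "integral {0..1} a \<le> 4 / real d ^ 2 * integral {0..1} b + 2 / real d * (u \<omega>)\<^sup>2"
    using d' by (simp add: F field_simps power2_eq_square)
  have b0: "0 \<le> integral {0..1} b"
    by (intro Henstock_Kurzweil_Integration.integral_nonneg integrable_continuous_real cb) (auto simp: b_def)
  have "ennreal (integral {0..1} a) \<le> ennreal (4 / real d ^ 2) * ennreal (integral {0..1} b) + ennreal (2 / real d * (u \<omega>)\<^sup>2)"
    using I b0 d' by (simp flip: ennreal_mult ennreal_plus)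
  moreover have "(\<integral>\<^sup>+r. ennreal (a r) * indicator {0..1} r \<partial>lborel) = ennreal (integral {0..1} a)"
    by (rule nn_integral_continuous_Icc[OF ca]) (auto simp: a_def)
  moreover have "(\<integral>\<^sup>+r. ennreal (b r) * indicator {0..1} r \<partial>lborel) = ennreal (integral {0..1} b)"
    by (rule nn_integral_continuous_Icc[OF cb]) (auto simp: b_def)
  ultimately show ?thesis unfolding a_def b_def by simp
qed

lemma ball_Hardy:
  fixes u :: "'a::euclidean_space \<Rightarrow> real"
  assumes u: "smooth u" and N: "DIM('a) \<ge> 3"
  defines "d \<equiv> DIM('a) - 2"
  shows "(\<integral>\<^sup>+x. ennreal ((u x)\<^sup>2 / (norm x)\<^sup>2) * indicator (ball 0 1) x \<partial>lborel)
    \<le> ennreal (4 / real d ^ 2) * (\<integral>\<^sup>+x. ennreal ((norm (gradient u x))\<^sup>2) * indicator (ball 0 1) x \<partial>lborel)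
      + ennreal (2 / real d) * (\<integral>\<^sup>+\<omega>. ennreal ((u \<omega>)\<^sup>2) \<partial>sphere_measure)"
proof -
  have d: "d \<ge> 1" "DIM('a) - 1 = d + 1" using N by (auto simp: d_def)
  have [measurable]: "u \<in> borel_measurable borel" "gradient u \<in> borel_measurable borel"
    using u by (auto intro!: borel_measurable_continuous_onI smooth_continuous continuous_on_gradient)
  define A where "A \<omega> = (\<integral>\<^sup>+r. ennreal (r ^ (d + 1) * (norm (gradient u (r *\<^sub>R \<omega>)))\<^sup>2) * indicator {0..1} r \<partial>lborel)" for \<omega>
  have Aeq: "A \<omega> = (\<integral>\<^sup>+r. (ennreal (r ^ (d + 1)) * indicator {0..1} r) * ennreal ((norm (gradient u (r *\<^sub>R \<omega>)))\<^sup>2) \<partial>lborel)" for \<omega>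
    unfolding A_def by (intro nn_integral_cong) (auto simp: ennreal_mult split: split_indicator)
  have Am[measurable]: "A \<in> borel_measurable sphere_measure"
    unfolding Aeq by (rule borel_measurable_sphere_radial) auto
  have um[measurable]: "(\<lambda>\<omega>. ennreal ((u \<omega>)\<^sup>2)) \<in> borel_measurable sphere_measure"
    by (rule borel_measurable_sphere) simp
  have "(\<integral>\<^sup>+x. ennreal ((u x)\<^sup>2 / (norm x)\<^sup>2) * indicator (ball 0 1) x \<partial>lborel)
     = (\<integral>\<^sup>+\<omega>. (\<integral>\<^sup>+r. ennreal (r ^ (d + 1)) * ennreal ((u (r *\<^sub>R \<omega>))\<^sup>2 / (norm (r *\<^sub>R \<omega>))\<^sup>2) * indicator {0..1} r \<partial>lborel) \<partial>sphere_measure)"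
    unfolding d(2)[symmetric] by (rule nn_integral_polar_ball) simp
  also have "\<dots> \<le> (\<integral>\<^sup>+\<omega>. (\<integral>\<^sup>+r. ennreal (r ^ (d - 1) * (u (r *\<^sub>R \<omega>))\<^sup>2) * indicator {0..1} r \<partial>lborel) \<partial>sphere_measure)"
  proof (intro nn_integral_mono)
    fix \<omega> :: 'a and r :: real assume "\<omega> \<in> space sphere_measure"
    then have \<omega>: "norm \<omega> = 1" by simp
    show "ennreal (r ^ (d + 1)) * ennreal ((u (r *\<^sub>R \<omega>))\<^sup>2 / (norm (r *\<^sub>R \<omega>))\<^sup>2) * indicator {0..1} r
        \<le> ennreal (r ^ (d - 1) * (u (r *\<^sub>R \<omega>))\<^sup>2) * indicator {0..1} r"
    proof (cases "r \<in> {0..1}")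
      case True
      have "r ^ (d + 1) * ((u (r *\<^sub>R \<omega>))\<^sup>2 / (norm (r *\<^sub>R \<omega>))\<^sup>2) \<le> r ^ (d - 1) * (u (r *\<^sub>R \<omega>))\<^sup>2"
        using True \<omega> d(1) by (cases d) (auto simp: power2_eq_square)
      then show ?thesis using True by (simp flip: ennreal_mult)
    qed simp
  qed
  also have "\<dots> \<le> (\<integral>\<^sup>+\<omega>. ennreal (4 / real d ^ 2) * A \<omega> + ennreal (2 / real d) * ennreal ((u \<omega>)\<^sup>2) \<partial>sphere_measure)"
  proof (rule nn_integral_mono)
    fix \<omega> :: 'a assume "\<omega> \<in> space sphere_measure"
    then have \<omega>: "norm \<omega> = 1" by simp
    have "ennreal (2 / real d * (u \<omega>)\<^sup>2) = ennreal (2 / real d) * ennreal ((u \<omega>)\<^sup>2)"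
      by (rule ennreal_mult) auto
    then show "(\<integral>\<^sup>+r. ennreal (r ^ (d - 1) * (u (r *\<^sub>R \<omega>))\<^sup>2) * indicator {0..1} r \<partial>lborel)
        \<le> ennreal (4 / real d ^ 2) * A \<omega> + ennreal (2 / real d) * ennreal ((u \<omega>)\<^sup>2)"
      using ray_Hardy[OF u d(1) \<omega>] by (simp only: A_def)
  qed
  also have "\<dots> = (\<integral>\<^sup>+\<omega>. ennreal (4 / real d ^ 2) * A \<omega> \<partial>sphere_measure) + (\<integral>\<^sup>+\<omega>. ennreal (2 / real d) * ennreal ((u \<omega>)\<^sup>2) \<partial>sphere_measure)"
    by (rule nn_integral_add) measurable
  also have "\<dots> = ennreal (4 / real d ^ 2) * (\<integral>\<^sup>+\<omega>. A \<omega> \<partial>sphere_measure) + ennreal (2 / real d) * (\<integral>\<^sup>+\<omega>. ennreal ((u \<omega>)\<^sup>2) \<partial>sphere_measure)"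
    by (simp only: nn_integral_cmult[OF Am] nn_integral_cmult[OF um])
  also have "(\<integral>\<^sup>+\<omega>. A \<omega> \<partial>sphere_measure) = (\<integral>\<^sup>+x. ennreal ((norm (gradient u x))\<^sup>2) * indicator (ball 0 1) x \<partial>lborel)"
    by (subst nn_integral_polar_ball, simp) (rule nn_integral_cong, simp only: Aeq d(2) mult_ac)
  finally show ?thesis .
qed

lemma L2_weak_gradient_unique:
  fixes u :: "'a::euclidean_space \<Rightarrow> real"
  assumes U: "has_L2_weak_gradient (ball 0 1) u U" and U': "has_L2_weak_gradient (ball 0 1) u U'"
  shows "AE x in lebesgue_on (ball 0 1). U x = U' x"
proof -
  let ?B = "lebesgue_on (ball (0::'a) 1)"
  interpret finite_measure ?B by (rule finite_measure_lebesgue_on_ball)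
  have comp: "AE x in ?B. (U x - U' x) \<bullet> b = 0" if b: "b \<in> Basis" for b
  proof -
    have int: "integrable ?B (\<lambda>x. V x \<bullet> b)" if "has_L2_weak_gradient (ball 0 1) u V" for V
    proof (rule square_integrable_imp_integrable)
      have V: "V \<in> borel_measurable ?B" "integrable ?B (\<lambda>x. (norm (V x))\<^sup>2)"
        using that by (auto simp: has_L2_weak_gradient_def square_integrable_def)
      show m: "(\<lambda>x. V x \<bullet> b) \<in> borel_measurable ?B" using V(1) by (intro borel_measurable_inner) auto
      show "integrable ?B (\<lambda>x. (V x \<bullet> b)\<^sup>2)"
      proof (rule Bochner_Integration.integrable_bound[OF V(2)])
        show "AE x in ?B. norm ((V x \<bullet> b)\<^sup>2) \<le> norm ((norm (V x))\<^sup>2)"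
          using Basis_le_norm[OF b] by (intro AE_I2) (simp add: abs_le_square_iff[symmetric])
      qed (use m in auto)
    qed
    define f where "f x = (U x - U' x) \<bullet> b" for x
    have f: "integrable ?B f" unfolding f_def inner_diff_left
      by (intro Bochner_Integration.integrable_diff int U U')
    have z: "(LINT x|?B. f x * \<phi> x) = 0" if \<phi>: "\<phi> \<in> test_functions (ball 0 1)" for \<phi>
    proof -
      obtain R where R: "\<And>x. norm x \<ge> R \<Longrightarrow> \<phi> x = 0" using test_functions_bounded_support[OF \<phi>] by metis
      have c\<phi>: "continuous_on UNIV \<phi>" using \<phi> by (auto simp: test_functions_def intro: smooth_continuous)
      obtain C where C: "\<And>x. norm (\<phi> x) \<le> C"
        using continuous_bounded_support_bounded[OF c\<phi>, of R] R by (metis less_imp_le)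
      have \<phi>m: "\<phi> \<in> borel_measurable ?B"
        using c\<phi> by (intro measurable_restrict_space1 measurable_completion) (auto intro: borel_measurable_continuous_onI)
      have i: "integrable ?B (\<lambda>x. (V x \<bullet> b) * \<phi> x)" if "has_L2_weak_gradient (ball 0 1) u V" for V
      proof (rule Bochner_Integration.integrable_bound[OF integrable_mult_right[OF integrable_norm[OF int[OF that]], of C]])
        show "(\<lambda>x. (V x \<bullet> b) * \<phi> x) \<in> borel_measurable ?B"
          using int[OF that] \<phi>m by (intro borel_measurable_times) auto
        have "0 \<le> C" by (rule order_trans[OF norm_ge_zero C[of 0]])
        show "AE x in ?B. norm ((V x \<bullet> b) * \<phi> x) \<le> norm (C * norm (V x \<bullet> b))"
        proof (intro AE_I2)
          fix x
          have "norm ((V x \<bullet> b) * \<phi> x) \<le> norm (V x \<bullet> b) * C"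
            unfolding norm_mult by (rule mult_left_mono[OF C norm_ge_zero])
          then show "norm ((V x \<bullet> b) * \<phi> x) \<le> norm (C * norm (V x \<bullet> b))"
            using \<open>0 \<le> C\<close> by (metis abs_of_nonneg mult.commute mult_nonneg_nonneg norm_ge_zero real_norm_def)
        qed
      qed
      have "(LINT x|?B. (U x \<bullet> b) * \<phi> x) = (LINT x|?B. (U' x \<bullet> b) * \<phi> x)"
      proof -
        have e: "(LINT x|?B. u x * (gradient \<phi> x \<bullet> b)) = - (LINT x|?B. (V x \<bullet> b) * \<phi> x)"
          if "has_L2_weak_gradient (ball 0 1) u V" for V
          using that b \<phi> unfolding has_L2_weak_gradient_def by blast
        show ?thesis using e[OF U] e[OF U'] by linarith
      qed
      then have "(LINT x|?B. (U x \<bullet> b) * \<phi> x - (U' x \<bullet> b) * \<phi> x) = 0"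
        by (subst Bochner_Integration.integral_diff[OF i[OF U] i[OF U']]) simp
      then show ?thesis by (simp add: f_def inner_diff_left left_diff_distrib)
    qed
    have f1: "integrable lebesgue (\<lambda>x. indicator (ball 0 1) x *\<^sub>R f x)"
      using f by (subst (asm) integrable_restrict_space) auto
    obtain h0 where h0: "h0 \<in> borel_measurable lborel" "AE x in lborel. indicator (ball 0 1) x *\<^sub>R f x = h0 x"
      using completion_ex_borel_measurable_real[OF borel_measurable_integrable[OF f1]] by blast
    define h where "h x = indicator (ball 0 1) x * h0 x" for x
    have [measurable]: "ball (0::'a) 1 \<in> sets borel" by simp
    have hm[measurable]: "h \<in> borel_measurable borel" unfolding h_def using h0(1) by simp
    have hae: "AE x in lebesgue. indicator (ball 0 1) x *\<^sub>R f x = h x"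
      using AE_completion[OF h0(2)] by eventually_elim (auto simp: h_def split: split_indicator)
    have hi: "integrable lborel h"
    proof -
      have "integrable lebesgue h"
        using f1 by (rule integrable_cong_AE_imp) (use hae hm in \<open>auto intro: measurable_completion\<close>)
      then show ?thesis by (simp add: integrable_completion)
    qed
    have "AE x in lborel. h x = 0"
    proof (rule AE_zero_of_test_functions[OF hi, of "ball 0 1"])
      fix \<phi> :: "'a \<Rightarrow> real" assume \<phi>: "\<phi> \<in> test_functions (ball 0 1)"
      have \<phi>m[measurable]: "\<phi> \<in> borel_measurable borel"
        using \<phi> by (auto simp: test_functions_def intro!: borel_measurable_continuous_onI smooth_continuous)
      have "(\<integral>x. h x * \<phi> x \<partial>lborel) = (LINT x|lebesgue. h x * \<phi> x)"
        by (rule integral_completion[symmetric]) measurable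
      also have "\<dots> = (LINT x|lebesgue. indicator (ball 0 1) x *\<^sub>R (f x * \<phi> x))"
      proof (rule integral_cong_AE)
        show "(\<lambda>x. h x * \<phi> x) \<in> borel_measurable lebesgue" by (intro measurable_completion) measurable
        have "(\<lambda>x. (indicator (ball 0 1) x *\<^sub>R f x) * \<phi> x) \<in> borel_measurable lebesgue"
          using f1 \<phi>m by (intro borel_measurable_times) (auto intro: measurable_completion)
        then show "(\<lambda>x. indicator (ball 0 1) x *\<^sub>R (f x * \<phi> x)) \<in> borel_measurable lebesgue" by (simp add: mult.assoc)
        show "AE x in lebesgue. h x * \<phi> x = indicator (ball 0 1) x *\<^sub>R (f x * \<phi> x)"
          using hae by eventually_elim (auto split: split_indicator)
      qed
      also have "\<dots> = (LINT x|?B. f x * \<phi> x)" by (rule integral_restrict_space[symmetric]) simp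
      finally show "(\<integral>x. h x * \<phi> x \<partial>lborel) = 0" using z[OF \<phi>] by simp
    qed (auto simp: h_def)
    then have "AE x in lebesgue. h x = 0" by (rule AE_completion)
    with hae have "AE x in lebesgue. x \<in> ball 0 1 \<longrightarrow> f x = 0"
      by eventually_elim auto
    then show ?thesis unfolding f_def by (subst AE_restrict_space_iff) auto
  qed
  have "AE x in ?B. \<forall>b\<in>Basis. (U x - U' x) \<bullet> b = 0"
    by (rule AE_finite_allI[OF finite_Basis comp])
  then show ?thesis
  proof eventually_elim
    case (elim x)
    then have "U x - U' x = 0" unfolding euclidean_all_zero_iff .
    then show ?case by (rule eq_iff_diff_eq_0[THEN iffD2])
  qed
qed

lemma smooth_has_trace:
  fixes u :: "'a::euclidean_space \<Rightarrow> real"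
  assumes u: "smooth u"
  shows "has_trace u u"
  unfolding has_trace_def
proof (intro conjI exI)
  show "u \<in> H1 (ball 0 1)" by (rule smooth_in_H1[OF u])
  show "has_L2_weak_gradient (ball 0 1) u (gradient u)" by (rule smooth_has_L2_weak_gradient[OF u])
  interpret finite_measure "sphere_measure :: 'a measure" by (rule finite_measure_sphere_measure)
  have cu: "continuous_on UNIV u" by (rule smooth_continuous[OF u])
  have um: "u \<in> borel_measurable sphere_measure"
    using cu by (intro borel_measurable_sphere borel_measurable_continuous_onI)
  have "compact (u ` sphere 0 1)" by (intro compact_continuous_image continuous_on_subset[OF cu]) auto
  then obtain C where C: "\<forall>y\<in>u ` sphere 0 1. norm y \<le> C" using compact_imp_bounded bounded_iff by metis
  have "integrable sphere_measure (\<lambda>x. (norm (u x))\<^sup>2)"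
  proof (rule integrable_const_bound[where B="C\<^sup>2"])
    show "AE x in sphere_measure. norm ((norm (u x))\<^sup>2) \<le> C\<^sup>2"
    proof (rule AE_I2)
      fix x assume "x \<in> space (sphere_measure :: 'a measure)"
      then have "norm (u x) \<le> C" using C by auto
      then have "(norm (u x))\<^sup>2 \<le> C\<^sup>2" by (rule power_mono) simp
      then show "norm ((norm (u x))\<^sup>2) \<le> C\<^sup>2" by (simp only: real_norm_def abs_power2)
    qed
  qed (use um in auto)
  then show "square_integrable sphere_measure u" using um by (simp add: square_integrable_def)
  show "\<forall>n::nat. smooth ((\<lambda>_. u) n)" using u by simp
qed (simp_all add: L2_dist_sq_def)

section \<open>The infimum defining \<open>\<epsilon>\<close>-bar\<close>

lemma norm_sq_le_split:
  fixes a b :: "'a::real_normed_vector"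
  shows "(norm a)\<^sup>2 \<le> 2 * (norm b)\<^sup>2 + 2 * (norm (a - b))\<^sup>2"
proof -
  have "norm a \<le> norm b + norm (a - b)" using norm_triangle_sub .
  then have "(norm a)\<^sup>2 \<le> (norm b + norm (a - b))\<^sup>2" by (intro power_mono) auto
  also have "\<dots> \<le> 2 * (norm b)\<^sup>2 + 2 * (norm (a - b))\<^sup>2"
    using sum_squares_bound[of "norm b" "norm (a - b)"] by (simp add: power2_sum)
  finally show ?thesis .
qed

lemma nn_integral_norm_sq_le_split:
  fixes f h :: "'b \<Rightarrow> 'c::euclidean_space"
  assumes [measurable]: "f \<in> borel_measurable M" "h \<in> borel_measurable M"
  shows "(\<integral>\<^sup>+x. ennreal ((norm (f x))\<^sup>2) \<partial>M) \<le> 2 * (\<integral>\<^sup>+x. ennreal ((norm (h x))\<^sup>2) \<partial>M) + 2 * L2_dist_sq M f h"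
proof -
  have "(\<integral>\<^sup>+x. ennreal ((norm (f x))\<^sup>2) \<partial>M) \<le> (\<integral>\<^sup>+x. 2 * ennreal ((norm (h x))\<^sup>2) + 2 * ennreal ((norm (f x - h x))\<^sup>2) \<partial>M)"
  proof (rule nn_integral_mono)
    fix x
    have "ennreal ((norm (f x))\<^sup>2) \<le> ennreal (2 * (norm (h x))\<^sup>2 + 2 * (norm (f x - h x))\<^sup>2)"
      by (rule ennreal_leI[OF norm_sq_le_split])
    also have "\<dots> = 2 * ennreal ((norm (h x))\<^sup>2) + 2 * ennreal ((norm (f x - h x))\<^sup>2)"
      by (simp add: ennreal_plus ennreal_mult)
    finally show "ennreal ((norm (f x))\<^sup>2) \<le> 2 * ennreal ((norm (h x))\<^sup>2) + 2 * ennreal ((norm (f x - h x))\<^sup>2)" .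
  qed
  also have "\<dots> = (\<integral>\<^sup>+x. 2 * ennreal ((norm (h x))\<^sup>2) \<partial>M) + (\<integral>\<^sup>+x. 2 * ennreal ((norm (f x - h x))\<^sup>2) \<partial>M)"
    by (rule nn_integral_add) measurable
  also have "(\<integral>\<^sup>+x. 2 * ennreal ((norm (h x))\<^sup>2) \<partial>M) = 2 * (\<integral>\<^sup>+x. ennreal ((norm (h x))\<^sup>2) \<partial>M)"
    by (rule nn_integral_cmult) measurable
  also have "(\<integral>\<^sup>+x. 2 * ennreal ((norm (f x - h x))\<^sup>2) \<partial>M) = 2 * L2_dist_sq M f h"
    unfolding L2_dist_sq_def by (rule nn_integral_cmult) measurable
  finally show ?thesis .
qed

lemma weighted_ball_Hardy:
  fixes g :: "'a::euclidean_space \<Rightarrow> real"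
  assumes N: "DIM('a) \<ge> 3" and \<tau>: "\<tau> > 0" and K: "K > 0" and \<sigma>: "\<sigma> > 0"
    and g: "\<And>x. x \<in> ball 0 1 \<Longrightarrow> x \<noteq> 0 \<Longrightarrow> g x \<le> K * norm x powr (- 2 + \<sigma>)"
  obtains C where "C > 0" "\<And>\<phi>. smooth \<phi> \<Longrightarrow>
     (\<integral>\<^sup>+x. ennreal (g x * (\<phi> x)\<^sup>2) \<partial>lebesgue_on (ball 0 1))
       \<le> ennreal C * ((\<integral>\<^sup>+x. ennreal ((norm (gradient \<phi> x))\<^sup>2) \<partial>lebesgue_on (ball 0 1))
          + ennreal \<tau> * (\<integral>\<^sup>+x. ennreal ((\<phi> x)\<^sup>2) \<partial>sphere_measure))"
proof
  define d where "d = DIM('a) - 2"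
  have d: "real d > 0" using N by (simp add: d_def)
  define C where "C = K * (4 / real d ^ 2) + K * (2 / real d) / \<tau>"
  show C: "C > 0" using K d \<tau> by (simp add: C_def add_pos_pos)
  fix \<phi> :: "'a \<Rightarrow> real" assume \<phi>: "smooth \<phi>"
  have [measurable]: "\<phi> \<in> borel_measurable borel" using \<phi> by (intro borel_measurable_continuous_onI smooth_continuous)
  have [measurable]: "ball (0::'a) 1 \<in> sets borel" by simp
  define A where "A = (\<integral>\<^sup>+x. ennreal ((norm (gradient \<phi> x))\<^sup>2) \<partial>lebesgue_on (ball 0 1))"
  define S where "S = (\<integral>\<^sup>+x. ennreal ((\<phi> x)\<^sup>2) \<partial>sphere_measure)"
  have "(\<integral>\<^sup>+x. ennreal (g x * (\<phi> x)\<^sup>2) \<partial>lebesgue_on (ball 0 1)) = (\<integral>\<^sup>+x. ennreal (g x * (\<phi> x)\<^sup>2) * indicator (ball 0 1) x \<partial>lborel)"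
    by (rule nn_integral_on_ball)
  also have "\<dots> \<le> (\<integral>\<^sup>+x. ennreal K * (ennreal ((\<phi> x)\<^sup>2 / (norm x)\<^sup>2) * indicator (ball 0 1) x) \<partial>lborel)"
  proof (rule nn_integral_mono_AE)
    have "AE x in lborel. x \<noteq> (0::'a)" by (rule AE_lborel_singleton)
    then show "AE x in lborel. ennreal (g x * (\<phi> x)\<^sup>2) * indicator (ball 0 1) x
       \<le> ennreal K * (ennreal ((\<phi> x)\<^sup>2 / (norm x)\<^sup>2) * indicator (ball 0 1) x)"
    proof eventually_elim
      case (elim x)
      show ?case
      proof (cases "x \<in> ball 0 1")
        case True
        have n: "0 < norm x" "norm x < 1" using elim True by auto
        have "g x \<le> K * norm x powr (- 2 + \<sigma>)" using g True elim by blast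
        also have "norm x powr (- 2 + \<sigma>) \<le> norm x powr (- 2)"
          using n \<sigma> by (intro powr_mono') auto
        also have "norm x powr (- 2) = 1 / (norm x)\<^sup>2" using n by (simp add: powr_minus divide_inverse)
        finally have "g x \<le> K * (1 / (norm x)\<^sup>2)" using K by simp
        then have "g x * (\<phi> x)\<^sup>2 \<le> K * (1 / (norm x)\<^sup>2) * (\<phi> x)\<^sup>2" by (intro mult_right_mono) auto
        then have "ennreal (g x * (\<phi> x)\<^sup>2) \<le> ennreal (K * ((\<phi> x)\<^sup>2 / (norm x)\<^sup>2))" by (intro ennreal_leI) simp
        also have "\<dots> = ennreal K * ennreal ((\<phi> x)\<^sup>2 / (norm x)\<^sup>2)" using K by (intro ennreal_mult) auto
        finally show ?thesis using True by simp
      qed simp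
    qed
  qed
  also have "\<dots> = ennreal K * (\<integral>\<^sup>+x. ennreal ((\<phi> x)\<^sup>2 / (norm x)\<^sup>2) * indicator (ball 0 1) x \<partial>lborel)"
    by (rule nn_integral_cmult) measurable
  also have "\<dots> \<le> ennreal K * (ennreal (4 / real d ^ 2) * A + ennreal (2 / real d) * S)"
    unfolding A_def S_def nn_integral_on_ball d_def by (intro mult_left_mono ball_Hardy \<phi> N) simp
  also have "\<dots> = ennreal (K * (4 / real d ^ 2)) * A + ennreal (K * (2 / real d) / \<tau>) * (ennreal \<tau> * S)"
  proof -
    have "ennreal K * ennreal (4 / real d ^ 2) = ennreal (K * (4 / real d ^ 2))" using K by (intro ennreal_mult[symmetric]) auto
    moreover have "ennreal K * ennreal (2 / real d) = ennreal (K * (2 / real d) / \<tau>) * ennreal \<tau>"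
      using K d \<tau> by (simp flip: ennreal_mult)
    ultimately show ?thesis by (simp only: distrib_left mult.assoc[symmetric])
  qed
  also have "\<dots> \<le> ennreal C * A + ennreal C * (ennreal \<tau> * S)"
    using K d \<tau> by (intro add_mono mult_right_mono ennreal_leI) (auto simp: C_def)
  finally show "(\<integral>\<^sup>+x. ennreal (g x * (\<phi> x)\<^sup>2) \<partial>lebesgue_on (ball 0 1)) \<le> ennreal C * (A + ennreal \<tau> * S)"
    by (simp only: distrib_left)
qed

lemma trace_Hardy:
  fixes u :: "'a::euclidean_space \<Rightarrow> real"
  assumes C: "C \<ge> 0" and \<tau>: "\<tau> \<ge> 0"
    and smooth_case: "\<And>\<phi>. smooth \<phi> \<Longrightarrow>
     (\<integral>\<^sup>+x. ennreal (g x * (\<phi> x)\<^sup>2) \<partial>lebesgue_on (ball 0 1))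
       \<le> ennreal C * ((\<integral>\<^sup>+x. ennreal ((norm (gradient \<phi> x))\<^sup>2) \<partial>lebesgue_on (ball 0 1))
          + ennreal \<tau> * (\<integral>\<^sup>+x. ennreal ((\<phi> x)\<^sup>2) \<partial>sphere_measure))"
    and g0: "\<And>x. x \<in> ball 0 1 \<Longrightarrow> g x \<ge> 0" and gc: "continuous_on (ball 0 1) g"
    and U: "has_L2_weak_gradient (ball 0 1) u U" and tr: "has_trace u w"
  shows "(\<integral>\<^sup>+x. ennreal (g x * (u x)\<^sup>2) \<partial>lebesgue_on (ball 0 1))
     \<le> ennreal (4 * C) * ((\<integral>\<^sup>+x. ennreal ((norm (U x))\<^sup>2) \<partial>lebesgue_on (ball 0 1))
          + ennreal \<tau> * (\<integral>\<^sup>+x. ennreal ((w x)\<^sup>2) \<partial>sphere_measure))"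
proof -
  let ?B = "lebesgue_on (ball (0::'a) 1)"
  let ?S = "sphere_measure :: 'a measure"
  obtain U' \<phi> where U': "has_L2_weak_gradient (ball 0 1) u U'" and s: "\<And>n::nat. smooth (\<phi> n)"
    and l1: "(\<lambda>n. L2_dist_sq ?B (\<phi> n) u) \<longlonglongrightarrow> 0"
    and l2: "(\<lambda>n. L2_dist_sq ?B (gradient (\<phi> n)) U') \<longlonglongrightarrow> 0"
    and l3: "(\<lambda>n. L2_dist_sq ?S (\<phi> n) w) \<longlonglongrightarrow> 0"
    using tr unfolding has_trace_def by auto
  have um[measurable]: "u \<in> borel_measurable ?B" using tr by (auto simp: has_trace_def H1_def square_integrable_def)
  have wm[measurable]: "w \<in> borel_measurable ?S" using tr by (auto simp: has_trace_def square_integrable_def)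
  have Um[measurable]: "U' \<in> borel_measurable ?B" using U' by (auto simp: has_L2_weak_gradient_def square_integrable_def)
  have gm[measurable]: "g \<in> borel_measurable ?B" by (rule continuous_imp_measurable_on_sets_lebesgue[OF gc]) simp
  have pm[measurable]: "\<phi> n \<in> borel_measurable ?B" "gradient (\<phi> n) \<in> borel_measurable ?B" "\<phi> n \<in> borel_measurable ?S" for n
    using s[of n] by (auto intro!: measurable_restrict_space1 measurable_completion borel_measurable_sphere
        borel_measurable_continuous_onI smooth_continuous continuous_on_gradient)
  define A where "A = (\<integral>\<^sup>+x. ennreal ((norm (U' x))\<^sup>2) \<partial>?B)"
  define W where "W = (\<integral>\<^sup>+x. ennreal ((norm (w x))\<^sup>2) \<partial>?S)"
  have AU: "(\<integral>\<^sup>+x. ennreal ((norm (U x))\<^sup>2) \<partial>?B) = A"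
    unfolding A_def
  proof (rule nn_integral_cong_AE)
    show "AE x in ?B. ennreal ((norm (U x))\<^sup>2) = ennreal ((norm (U' x))\<^sup>2)"
      using L2_weak_gradient_unique[OF U U'] by eventually_elim simp
  qed
  have WW: "(\<integral>\<^sup>+x. ennreal ((w x)\<^sup>2) \<partial>?S) = W" by (simp add: W_def)
  define h where "h M x = min (g x) (real M) * (u x)\<^sup>2" for M :: nat and x
  have hm[measurable]: "h M \<in> borel_measurable ?B" for M unfolding h_def by measurable
  have cut: "(\<integral>\<^sup>+x. ennreal (h M x) \<partial>?B) \<le> ennreal (4 * C) * (A + ennreal \<tau> * W)" for M
  proof -
    have n: "(\<integral>\<^sup>+x. ennreal (h M x) \<partial>?B) \<le> 2 * (ennreal C * ((2 * A + 2 * L2_dist_sq ?B (gradient (\<phi> n)) U')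
        + ennreal \<tau> * (2 * W + 2 * L2_dist_sq ?S (\<phi> n) w))) + ennreal (2 * real M) * L2_dist_sq ?B (\<phi> n) u" for n
    proof -
      have "(\<integral>\<^sup>+x. ennreal (h M x) \<partial>?B) \<le> (\<integral>\<^sup>+x. 2 * ennreal (g x * (\<phi> n x)\<^sup>2) + ennreal (2 * real M) * ennreal ((norm (\<phi> n x - u x))\<^sup>2) \<partial>?B)"
      proof (rule nn_integral_mono)
        fix x assume "x \<in> space ?B"
        then have g: "g x \<ge> 0" using g0 by (simp add: space_restrict_space)
        have "h M x \<le> min (g x) (real M) * (2 * (\<phi> n x)\<^sup>2 + 2 * (norm (\<phi> n x - u x))\<^sup>2)"
          unfolding h_def using norm_sq_le_split[of "u x" "\<phi> n x"] g
          by (intro mult_left_mono) (auto simp: norm_minus_commute power2_commute)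
        also have "\<dots> = min (g x) (real M) * (2 * (\<phi> n x)\<^sup>2) + min (g x) (real M) * (2 * (norm (\<phi> n x - u x))\<^sup>2)"
          by (rule distrib_left)
        also have "\<dots> \<le> g x * (2 * (\<phi> n x)\<^sup>2) + real M * (2 * (norm (\<phi> n x - u x))\<^sup>2)"
          by (intro add_mono mult_right_mono) auto
        finally have "ennreal (h M x) \<le> ennreal (2 * (g x * (\<phi> n x)\<^sup>2) + 2 * real M * (norm (\<phi> n x - u x))\<^sup>2)"
          by (intro ennreal_leI) (simp add: mult_ac)
        also have "\<dots> = 2 * ennreal (g x * (\<phi> n x)\<^sup>2) + ennreal (2 * real M) * ennreal ((norm (\<phi> n x - u x))\<^sup>2)"
          using g by (subst ennreal_plus) (auto simp: ennreal_mult)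
        finally show "ennreal (h M x) \<le> 2 * ennreal (g x * (\<phi> n x)\<^sup>2) + ennreal (2 * real M) * ennreal ((norm (\<phi> n x - u x))\<^sup>2)" .
      qed
      also have "\<dots> = (\<integral>\<^sup>+x. 2 * ennreal (g x * (\<phi> n x)\<^sup>2) \<partial>?B) + (\<integral>\<^sup>+x. ennreal (2 * real M) * ennreal ((norm (\<phi> n x - u x))\<^sup>2) \<partial>?B)"
        by (rule nn_integral_add) measurable
      also have "(\<integral>\<^sup>+x. 2 * ennreal (g x * (\<phi> n x)\<^sup>2) \<partial>?B) = 2 * (\<integral>\<^sup>+x. ennreal (g x * (\<phi> n x)\<^sup>2) \<partial>?B)"
        by (rule nn_integral_cmult) measurable
      also have "(\<integral>\<^sup>+x. ennreal (2 * real M) * ennreal ((norm (\<phi> n x - u x))\<^sup>2) \<partial>?B) = ennreal (2 * real M) * L2_dist_sq ?B (\<phi> n) u"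
        unfolding L2_dist_sq_def by (rule nn_integral_cmult) measurable
      also have "(\<integral>\<^sup>+x. ennreal (g x * (\<phi> n x)\<^sup>2) \<partial>?B) \<le> ennreal C * ((2 * A + 2 * L2_dist_sq ?B (gradient (\<phi> n)) U')
        + ennreal \<tau> * (2 * W + 2 * L2_dist_sq ?S (\<phi> n) w))"
      proof -
        have i1: "(\<integral>\<^sup>+x. ennreal ((norm (gradient (\<phi> n) x))\<^sup>2) \<partial>?B) \<le> 2 * A + 2 * L2_dist_sq ?B (gradient (\<phi> n)) U'"
          unfolding A_def by (rule nn_integral_norm_sq_le_split) measurable
        have i2: "(\<integral>\<^sup>+x. ennreal ((\<phi> n x)\<^sup>2) \<partial>?S) \<le> 2 * W + 2 * L2_dist_sq ?S (\<phi> n) w"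
          using nn_integral_norm_sq_le_split[OF pm(3) wm, of n] by (simp add: W_def)
        show ?thesis
          by (rule order_trans[OF smooth_case[OF s]]) (intro mult_left_mono add_mono i1 i2 zero_le)
      qed
      finally show ?thesis by (simp add: add_mono mult_left_mono)
    qed
    have "(\<lambda>n. 2 * (ennreal C * ((2 * A + 2 * L2_dist_sq ?B (gradient (\<phi> n)) U')
        + ennreal \<tau> * (2 * W + 2 * L2_dist_sq ?S (\<phi> n) w))) + ennreal (2 * real M) * L2_dist_sq ?B (\<phi> n) u)
        \<longlonglongrightarrow> 2 * (ennreal C * ((2 * A + 2 * 0) + ennreal \<tau> * (2 * W + 2 * 0))) + ennreal (2 * real M) * 0"
      by (intro tendsto_add tendsto_const ennreal_tendsto_cmult l1 l2 l3) auto
    then have "(\<integral>\<^sup>+x. ennreal (h M x) \<partial>?B) \<le> 2 * (ennreal C * ((2 * A + 2 * 0) + ennreal \<tau> * (2 * W + 2 * 0))) + ennreal (2 * real M) * 0"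
      by (rule LIMSEQ_le_const) (use n in blast)
    also have "\<dots> = ennreal (4 * C) * (A + ennreal \<tau> * W)"
    proof -
      have "ennreal (4 * C) = 4 * ennreal C" using C by (simp add: ennreal_mult)
      moreover have "(4::ennreal) = 2 * 2" by simp
      ultimately show ?thesis by (simp only: distrib_left mult_zero_right mult_zero_left add_0_right add_0_left mult_ac)
    qed
    finally show ?thesis .
  qed
  have "(\<integral>\<^sup>+x. ennreal (g x * (u x)\<^sup>2) \<partial>?B) = (\<integral>\<^sup>+x. (SUP M. ennreal (h M x)) \<partial>?B)"
  proof (rule nn_integral_cong)
    fix x assume "x \<in> space ?B"
    obtain M :: nat where M: "g x \<le> real M" using real_arch_simple by blast
    show "ennreal (g x * (u x)\<^sup>2) = (SUP M. ennreal (h M x))"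
    proof (rule antisym)
      have "ennreal (g x * (u x)\<^sup>2) = ennreal (h M x)" using M by (simp add: h_def)
      also have "\<dots> \<le> (SUP M. ennreal (h M x))" by (rule SUP_upper) simp
      finally show "ennreal (g x * (u x)\<^sup>2) \<le> (SUP M. ennreal (h M x))" .
      show "(SUP M. ennreal (h M x)) \<le> ennreal (g x * (u x)\<^sup>2)"
        by (intro SUP_least ennreal_leI) (auto simp: h_def intro!: mult_right_mono)
    qed
  qed
  also have "\<dots> = (SUP M. \<integral>\<^sup>+x. ennreal (h M x) \<partial>?B)"
  proof (rule nn_integral_monotone_convergence_SUP)
    show "incseq (\<lambda>M x. ennreal (h M x))"
      by (auto simp: incseq_def le_fun_def h_def intro!: ennreal_leI mult_right_mono min.mono)
  qed measurable
  also have "\<dots> \<le> ennreal (4 * C) * (A + ennreal \<tau> * W)" by (rule SUP_least) (rule cut)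
  finally show ?thesis unfolding AU WW .
qed

lemma square_integrable_nn_integral:
  assumes "square_integrable M f"
  obtains a where "a \<ge> 0" "(\<integral>\<^sup>+x. ennreal ((norm (f x))\<^sup>2) \<partial>M) = ennreal a"
proof
  show "0 \<le> (\<integral>x. (norm (f x))\<^sup>2 \<partial>M)" by simp
  show "(\<integral>\<^sup>+x. ennreal ((norm (f x))\<^sup>2) \<partial>M) = ennreal (\<integral>x. (norm (f x))\<^sup>2 \<partial>M)"
    using assms by (intro nn_integral_eq_integral) (auto simp: square_integrable_def)
qed

lemma eps_bar_pos:
  fixes g :: "real^'n \<Rightarrow> real"
  assumes N: "CARD('n) \<ge> 3" and k: "real k < real CARD('n) - 2"
    and g0: "\<And>x. x \<in> ball 0 1 \<Longrightarrow> g x \<ge> 0" and gc: "continuous_on (ball 0 1) g"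
    and K: "K > 0" and \<sigma>: "\<sigma> > 0"
    and g: "\<And>x. x \<in> ball 0 1 \<Longrightarrow> x \<noteq> 0 \<Longrightarrow> g x \<le> K * norm x powr (- 2 + \<sigma>)"
  shows "eps_bar k g > 0"
proof -
  define \<tau> where "\<tau> = (real CARD('n) - 2 - real k) / 2"
  have \<tau>: "\<tau> > 0" using k by (simp add: \<tau>_def)
  obtain C where C: "C > 0" "\<And>\<phi>. smooth \<phi> \<Longrightarrow>
     (\<integral>\<^sup>+x. ennreal (g x * (\<phi> x)\<^sup>2) \<partial>lebesgue_on (ball 0 1))
       \<le> ennreal C * ((\<integral>\<^sup>+x. ennreal ((norm (gradient \<phi> x))\<^sup>2) \<partial>lebesgue_on (ball 0 1))
          + ennreal \<tau> * (\<integral>\<^sup>+x. ennreal ((\<phi> x)\<^sup>2) \<partial>sphere_measure))"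
    using weighted_ball_Hardy[OF _ \<tau> K \<sigma> g] N by (auto simp: DIM_cart)
  have "ennreal (1 / (4 * C)) \<le> eps_bar k g"
    unfolding eps_bar_def \<tau>_def[symmetric]
  proof (rule Inf_greatest, elim CollectE exE conjE)
    fix q :: ennreal and u U w
    assume q: "q = ((\<integral>\<^sup>+x. ennreal ((norm (U x))\<^sup>2) \<partial>lebesgue_on (ball 0 1))
        + ennreal \<tau> * (\<integral>\<^sup>+x. ennreal ((w x)\<^sup>2) \<partial>sphere_measure))
       / (\<integral>\<^sup>+x. ennreal (g x * (u x)\<^sup>2) \<partial>lebesgue_on (ball 0 1))"
      and U: "has_L2_weak_gradient (ball 0 1) u U" and w: "has_trace u w"
      and pos: "(\<integral>\<^sup>+x. ennreal (g x * (u x)\<^sup>2) \<partial>lebesgue_on (ball 0 1)) > 0"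
    define D where "D = (\<integral>\<^sup>+x. ennreal (g x * (u x)\<^sup>2) \<partial>lebesgue_on (ball 0 1))"
    obtain a where a: "a \<ge> 0" "(\<integral>\<^sup>+x. ennreal ((norm (U x))\<^sup>2) \<partial>lebesgue_on (ball 0 1)) = ennreal a"
      using U square_integrable_nn_integral unfolding has_L2_weak_gradient_def by metis
    obtain s where s: "s \<ge> 0" "(\<integral>\<^sup>+x. ennreal ((w x)\<^sup>2) \<partial>sphere_measure) = ennreal s"
      using w square_integrable_nn_integral[of sphere_measure w] unfolding has_trace_def by auto
    have ns: "ennreal a + ennreal \<tau> * ennreal s = ennreal (a + \<tau> * s)"
      using a s \<tau> by (simp add: ennreal_mult)
    have "D \<le> ennreal (4 * C) * (ennreal a + ennreal \<tau> * ennreal s)"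
      unfolding D_def a(2)[symmetric] s(2)[symmetric]
      by (rule trace_Hardy[OF _ _ C(2) g0 gc U w]) (use C \<tau> in auto)
    then have D: "D \<le> ennreal (4 * C * (a + \<tau> * s))"
      unfolding ns using C a s \<tau> by (simp add: ennreal_mult)
    then obtain b where b: "b \<ge> 0" "D = ennreal b" by (metis ennreal_cases ennreal_less_top leD)
    have b0: "b > 0" using pos b by (simp add: D_def[symmetric])
    have "b \<le> 4 * C * (a + \<tau> * s)" using D b C a s \<tau> by (simp add: ennreal_le_iff)
    then have "1 / (4 * C) \<le> (a + \<tau> * s) / b" using b0 C by (simp add: field_simps)
    then have "ennreal (1 / (4 * C)) \<le> ennreal ((a + \<tau> * s) / b)" by (rule ennreal_leI)
    also have "\<dots> = q" unfolding q D_def[symmetric] a(2) s(2) ns b(2)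
      using a s \<tau> b0 by (intro divide_ennreal[symmetric]) auto
    finally show "ennreal (1 / (4 * C)) \<le> q" .
  qed
  moreover have "0 < ennreal (1 / (4 * C))" using C by simp
  ultimately show ?thesis by (rule less_le_trans[rotated])
qed

lemma smooth_le_eps_bar:
  fixes g :: "real^'n \<Rightarrow> real"
  assumes N: "CARD('n) \<ge> 3" and k: "real k < real CARD('n) - 2"
    and g0: "\<And>x. x \<in> ball 0 1 \<Longrightarrow> g x \<ge> 0"
    and K: "K > 0" and \<sigma>: "\<sigma> > 0"
    and g: "\<And>x. x \<in> ball 0 1 \<Longrightarrow> x \<noteq> 0 \<Longrightarrow> g x \<le> K * norm x powr (- 2 + \<sigma>)"
    and e: "e > 0" "ennreal e \<le> eps_bar k g" and u: "smooth u"
  obtains a s b where "a \<ge> 0" "s \<ge> 0" "b \<ge> 0"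
    "(\<integral>\<^sup>+x. ennreal ((norm (gradient u x))\<^sup>2) \<partial>lebesgue_on (ball 0 1)) = ennreal a"
    "(\<integral>\<^sup>+x. ennreal ((u x)\<^sup>2) \<partial>sphere_measure) = ennreal s"
    "(\<integral>\<^sup>+x. ennreal (g x * (u x)\<^sup>2) \<partial>lebesgue_on (ball 0 1)) = ennreal b"
    "e * b \<le> a + (real CARD('n) - 2 - real k) / 2 * s"
proof -
  define \<tau> where "\<tau> = (real CARD('n) - 2 - real k) / 2"
  have \<tau>: "\<tau> > 0" using k by (simp add: \<tau>_def)
  obtain C where C: "C > 0" "\<And>\<phi>. smooth \<phi> \<Longrightarrow>
     (\<integral>\<^sup>+x. ennreal (g x * (\<phi> x)\<^sup>2) \<partial>lebesgue_on (ball 0 1))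
       \<le> ennreal C * ((\<integral>\<^sup>+x. ennreal ((norm (gradient \<phi> x))\<^sup>2) \<partial>lebesgue_on (ball 0 1))
          + ennreal \<tau> * (\<integral>\<^sup>+x. ennreal ((\<phi> x)\<^sup>2) \<partial>sphere_measure))"
    using weighted_ball_Hardy[OF _ \<tau> K \<sigma> g] N by (auto simp: DIM_cart)
  note wk = smooth_has_L2_weak_gradient[OF u] and tr = smooth_has_trace[OF u]
  define D where "D = (\<integral>\<^sup>+x. ennreal (g x * (u x)\<^sup>2) \<partial>lebesgue_on (ball 0 1))"
  obtain a where a: "a \<ge> 0" "(\<integral>\<^sup>+x. ennreal ((norm (gradient u x))\<^sup>2) \<partial>lebesgue_on (ball 0 1)) = ennreal a"
    using wk square_integrable_nn_integral unfolding has_L2_weak_gradient_def by metis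
  obtain s where s: "s \<ge> 0" "(\<integral>\<^sup>+x. ennreal ((u x)\<^sup>2) \<partial>sphere_measure) = ennreal s"
    using tr square_integrable_nn_integral[of sphere_measure u] unfolding has_trace_def by auto
  have ns: "ennreal a + ennreal \<tau> * ennreal s = ennreal (a + \<tau> * s)"
    using a s \<tau> by (simp add: ennreal_mult)
  have "D \<le> ennreal C * (ennreal a + ennreal \<tau> * ennreal s)"
    unfolding D_def a(2)[symmetric] s(2)[symmetric] by (rule C(2)[OF u])
  then have "D \<le> ennreal (C * (a + \<tau> * s))"
    unfolding ns using C a s \<tau> by (simp add: ennreal_mult)
  then obtain b where b: "b \<ge> 0" "D = ennreal b" by (metis ennreal_cases ennreal_less_top leD)
  have "e * b \<le> a + \<tau> * s"
  proof (cases "b = 0")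
    case True
    then show ?thesis using a s \<tau> by simp
  next
    case False
    then have b0: "b > 0" using b by simp
    have "eps_bar k g \<le> (ennreal a + ennreal \<tau> * ennreal s) / D"
      unfolding eps_bar_def \<tau>_def[symmetric]
    proof (rule Inf_lower, intro CollectI exI conjI)
      show "(ennreal a + ennreal \<tau> * ennreal s) / D = ((\<integral>\<^sup>+x. ennreal ((norm (gradient u x))\<^sup>2) \<partial>lebesgue_on (ball 0 1))
        + ennreal \<tau> * (\<integral>\<^sup>+x. ennreal ((u x)\<^sup>2) \<partial>sphere_measure))
       / (\<integral>\<^sup>+x. ennreal (g x * (u x)\<^sup>2) \<partial>lebesgue_on (ball 0 1))"
        unfolding D_def a(2) s(2) ..
      show "0 < (\<integral>\<^sup>+x. ennreal (g x * (u x)\<^sup>2) \<partial>lebesgue_on (ball 0 1))"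
        using b b0 by (simp add: D_def[symmetric])
    qed (use wk tr smooth_in_H1[OF u] in auto)
    also have "\<dots> = ennreal ((a + \<tau> * s) / b)" unfolding ns b(2)
      using a s \<tau> b0 by (intro divide_ennreal) auto
    finally have "ennreal e \<le> ennreal ((a + \<tau> * s) / b)" using e(2) by (rule order_trans[rotated])
    then have "e \<le> (a + \<tau> * s) / b" using a s \<tau> b0 by (subst (asm) ennreal_le_iff) auto
    then show ?thesis using b0 by (simp add: field_simps)
  qed
  then show thesis using that[OF a(1) s(1) b(1) a(2) s(2)] b(2) by (simp add: D_def \<tau>_def)
qed

section \<open>Iterated logarithms and the ground state on a ray\<close>

fun iter_log :: "nat \<Rightarrow> real \<Rightarrow> real" where
  "iter_log 0 r = r"
| "iter_log (Suc j) r = 1 + ln (iter_log j r)"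

fun iter_exp :: "nat \<Rightarrow> real \<Rightarrow> real" where
  "iter_exp 0 z = z"
| "iter_exp (Suc j) z = exp (iter_exp j z - 1)"

lemma iter_log_ge_1: "r \<ge> 1 \<Longrightarrow> iter_log j r \<ge> 1"
  by (induction j) auto

lemma iter_log_pos [simp]: "r \<ge> 1 \<Longrightarrow> iter_log j r > 0"
  using iter_log_ge_1[of r j] by linarith

lemma iter_log_nonzero [simp]: "r \<ge> 1 \<Longrightarrow> iter_log j r \<noteq> 0"
  using iter_log_pos by (metis less_irrefl)

lemma iter_log_at_1 [simp]: "iter_log j 1 = 1"
  by (induction j) auto

lemma iter_log_shift: "iter_log (Suc j) r = iter_log j (1 + ln r)"
  by (induction j) auto

lemma iter_log_iter_exp: "iter_log j (iter_exp j z) = z"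
proof (induction j)
  case (Suc j)
  then show ?case unfolding iter_log_shift by simp
qed simp

lemma iter_exp_iter_log: "r \<ge> 1 \<Longrightarrow> iter_exp j (iter_log j r) = r"
proof (induction j arbitrary: r)
  case (Suc j)
  then show ?case unfolding iter_log_shift by simp
qed simp

lemma iter_exp_ge_1: "z \<ge> 1 \<Longrightarrow> iter_exp j z \<ge> 1"
  by (induction j) auto

lemma iter_exp_mono: "z \<le> w \<Longrightarrow> iter_exp j z \<le> iter_exp j w"
  by (induction j) auto

lemma continuous_on_iter_exp: "continuous_on A (iter_exp j)"
  by (induction j) (auto intro!: continuous_intros)

lemma X_eq_iter_log: "r > 1 \<Longrightarrow> X j (1 / r) = 1 / iter_log j r"
proof (induction j)
  case (Suc j)
  then have "X (Suc j) (1 / r) = X_one (1 / iter_log j r)" by (simp add: X_def)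
  also have "\<dots> = 1 / iter_log (Suc j) r" using Suc.prems by (simp add: X_one_def ln_div)
  finally show ?case .
qed (simp add: X_def)

definition log_weight :: "nat \<Rightarrow> real \<Rightarrow> real" where
  "log_weight i r = (\<Prod>j=1..i. 1 / iter_log j r)"

definition log_sum :: "nat \<Rightarrow> real \<Rightarrow> real" where
  "log_sum k r = (\<Sum>i=1..k. log_weight i r)"

lemma log_weight_0 [simp]: "log_weight 0 r = 1"
  by (simp add: log_weight_def)

lemma log_weight_Suc: "log_weight (Suc i) r = log_weight i r / iter_log (Suc i) r"
  by (simp add: log_weight_def)

lemma log_sum_0 [simp]: "log_sum 0 r = 0"
  by (simp add: log_sum_def)

lemma log_sum_Suc: "log_sum (Suc k) r = log_sum k r + log_weight (Suc k) r"
  by (simp add: log_sum_def)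

lemma log_weight_pos [simp]: "r \<ge> 1 \<Longrightarrow> log_weight i r > 0"
  by (simp add: log_weight_def prod_pos)

lemma log_weight_le_1: "r \<ge> 1 \<Longrightarrow> log_weight i r \<le> 1"
  unfolding log_weight_def
proof (rule prod_le_1)
  fix j assume "r \<ge> 1"
  then show "0 \<le> 1 / iter_log j r \<and> 1 / iter_log j r \<le> 1"
    using iter_log_ge_1[of r j] by simp
qed

lemma log_weight_at_1 [simp]: "log_weight i 1 = 1"
  by (simp add: log_weight_def)

lemma log_sum_at_1 [simp]: "log_sum k 1 = real k"
  by (simp add: log_sum_def)

lemma iter_log_Suc_has_derivative:
  "r \<ge> 1 \<Longrightarrow> (iter_log (Suc j) has_real_derivative log_weight j r / r) (at r)"
proof (induction j)
  case 0
  have "iter_log (Suc 0) = (\<lambda>r. 1 + ln r)" by (simp add: fun_eq_iff)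
  with 0 show ?case by (auto intro!: derivative_eq_intros simp: divide_inverse)
next
  case (Suc j)
  have "iter_log (Suc (Suc j)) = (\<lambda>r. 1 + ln (iter_log (Suc j) r))" by (simp add: fun_eq_iff)
  moreover have "((\<lambda>r. 1 + ln (iter_log (Suc j) r)) has_real_derivative log_weight (Suc j) r / r) (at r)"
    using Suc.prems iter_log_pos[OF Suc.prems, of "Suc j"]
    by (auto intro!: derivative_eq_intros Suc.IH simp: log_weight_Suc simp del: iter_log.simps)
  ultimately show ?case by simp
qed

lemma log_weight_has_derivative:
  "r \<ge> 1 \<Longrightarrow> (log_weight i has_real_derivative - log_weight i r * log_sum i r / r) (at r)"
proof (induction i)
  case 0
  have "log_weight 0 = (\<lambda>r. 1)" by (simp add: fun_eq_iff)
  then show ?case by simp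
next
  case (Suc i)
  note IH = Suc.IH[OF Suc.prems] and L = iter_log_Suc_has_derivative[OF Suc.prems, of i]
  have p: "iter_log (Suc i) r \<noteq> 0" using Suc.prems by (rule iter_log_nonzero)
  have "((\<lambda>r. log_weight i r / iter_log (Suc i) r) has_real_derivative
      ((- log_weight i r * log_sum i r / r) * iter_log (Suc i) r - log_weight i r * (log_weight i r / r))
      / (iter_log (Suc i) r * iter_log (Suc i) r)) (at r)"
    by (rule DERIV_divide[OF IH L p])
  moreover have "((- log_weight i r * log_sum i r / r) * iter_log (Suc i) r - log_weight i r * (log_weight i r / r))
      / (iter_log (Suc i) r * iter_log (Suc i) r) = - log_weight (Suc i) r * log_sum (Suc i) r / r"
    using p Suc.prems by (simp add: log_weight_Suc log_sum_Suc field_simps del: iter_log.simps)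
  moreover have "log_weight (Suc i) = (\<lambda>r. log_weight i r / iter_log (Suc i) r)"
    by (simp add: fun_eq_iff log_weight_Suc)
  ultimately show ?case by simp
qed

lemma log_sum_has_derivative:
  assumes "r \<ge> 1"
  shows "(log_sum k has_real_derivative - ((log_sum k r)\<^sup>2 + (\<Sum>i=1..k. (log_weight i r)\<^sup>2)) / (2 * r)) (at r)"
proof (induction k)
  case 0
  have "log_sum 0 = (\<lambda>r. 0)" by (simp add: fun_eq_iff)
  then show ?case by simp
next
  case (Suc k)
  have "log_sum (Suc k) = (\<lambda>r. log_sum k r + log_weight (Suc k) r)" by (simp add: fun_eq_iff log_sum_Suc)
  moreover have "((\<lambda>r. log_sum k r + log_weight (Suc k) r) has_real_derivative
      - ((log_sum k r)\<^sup>2 + (\<Sum>i=1..k. (log_weight i r)\<^sup>2)) / (2 * r)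
      + - log_weight (Suc k) r * log_sum (Suc k) r / r) (at r)"
    by (intro DERIV_add Suc log_weight_has_derivative assms)
  moreover have "- ((log_sum k r)\<^sup>2 + (\<Sum>i=1..k. (log_weight i r)\<^sup>2)) / (2 * r)
      + - log_weight (Suc k) r * log_sum (Suc k) r / r
     = - ((log_sum (Suc k) r)\<^sup>2 + (\<Sum>i=1..Suc k. (log_weight i r)\<^sup>2)) / (2 * r)"
    using assms by (simp add: log_sum_Suc field_simps power2_eq_square)
  ultimately show ?case by simp
qed

lemma continuous_on_log_functions:
  "continuous_on {1..} (iter_log j)" "continuous_on {1..} (log_weight i)" "continuous_on {1..} (log_sum k)"
proof -
  show "continuous_on {1..} (log_weight i)"
    by (meson log_weight_has_derivative DERIV_isCont continuous_at_imp_continuous_on atLeast_iff)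
  show "continuous_on {1..} (log_sum k)"
    by (meson log_sum_has_derivative DERIV_isCont continuous_at_imp_continuous_on atLeast_iff)
  show "continuous_on {1..} (iter_log j)"
  proof (cases j)
    case 0
    then have "iter_log j = (\<lambda>r. r)" by (simp add: fun_eq_iff)
    then show ?thesis by (simp add: continuous_on_id)
  next
    case (Suc i)
    then show ?thesis
      by (meson iter_log_Suc_has_derivative DERIV_isCont continuous_at_imp_continuous_on atLeast_iff)
  qed
qed

text \<open>For \<open>c = 0\<close> and \<open>c = 2\<close> this is the logarithmic derivative of the two radial solutions
  \<open>r\<^bsup>-d/2\<^esup>(Y\<^sub>1\<cdots>Y\<^sub>k)\<^bsup>-1/2\<^esup>\<close> and \<open>r\<^bsup>-d/2\<^esup>(Y\<^sub>1\<cdots>Y\<^sub>k)\<^bsup>-1/2\<^esup>Y\<^sub>k\<^sub>+\<^sub>1\<^bsup>-1\<^esup>\<close>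
  of \<open>-\<Delta>\<phi> = V\<phi>\<close> in dimension \<open>d + 2\<close>.\<close>

definition log_deriv :: "nat \<Rightarrow> nat \<Rightarrow> real \<Rightarrow> real \<Rightarrow> real" where
  "log_deriv d k c r = (- real d + log_sum k r + c * log_weight (Suc k) r) / (2 * r)"

definition ext_potential :: "nat \<Rightarrow> nat \<Rightarrow> real \<Rightarrow> real" where
  "ext_potential d k r = ((real d)\<^sup>2 + (\<Sum>i=1..k. (log_weight i r)\<^sup>2)) / (4 * r\<^sup>2)"

lemma log_deriv_Riccati:
  assumes r: "r \<ge> 1" and c: "c = 0 \<or> c = 2"
  shows "(log_deriv d k c has_real_derivative
    - ext_potential d k r - (log_deriv d k c r)\<^sup>2 - (real d + 1) * log_deriv d k c r / r) (at r)"
proof -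
  let ?a = "log_weight (Suc k) r" and ?e = "log_sum k r" and ?Q = "\<Sum>i=1..k. (log_weight i r)\<^sup>2"
  define num where "num = - real d + ?e + c * ?a"
  define num' where "num' = - (?e\<^sup>2 + ?Q) / (2 * r) + c * (- ?a * (?e + ?a) / r)"
  have r0: "r > 0" using r by simp
  have "((\<lambda>r. (- real d + log_sum k r + c * log_weight (Suc k) r) / (2 * r)) has_real_derivative
      (num' * (2 * r) - num * 2) / (2 * r * (2 * r))) (at r)"
    unfolding num_def num'_def
    by (rule DERIV_divide)
      (use r0 in \<open>auto intro!: derivative_eq_intros log_sum_has_derivative log_weight_has_derivative r simp: log_sum_Suc\<close>)
  moreover have "(num' * (2 * r) - num * 2) / (2 * r * (2 * r))
     = - ext_potential d k r - (log_deriv d k c r)\<^sup>2 - (real d + 1) * log_deriv d k c r / r"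
  proof -
    have cc: "c * c = 2 * c" using c by auto
    have n': "num' * (2 * r) = - (?e\<^sup>2 + ?Q) - 2 * c * ?a * (?e + ?a)"
      using r0 by (simp add: num'_def field_simps)
    have "num\<^sup>2 + 2 * (real d + 1) * num + (num' * (2 * r) - num * 2) + (real d)\<^sup>2 + ?Q = 0"
    proof -
      have "num\<^sup>2 = (real d)\<^sup>2 + ?e\<^sup>2 + (c * c) * ?a\<^sup>2 - 2 * real d * ?e - 2 * real d * c * ?a + 2 * c * ?a * ?e"
        by (simp add: num_def power2_eq_square algebra_simps)
      then show ?thesis unfolding n' cc by (simp add: num_def power2_eq_square algebra_simps)
    qed
    then have "num' * (2 * r) - num * 2 = - ((real d)\<^sup>2 + ?Q) - num\<^sup>2 - 2 * (real d + 1) * num" by linarith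
    then have "(num' * (2 * r) - num * 2) / (2 * r * (2 * r)) = (- ((real d)\<^sup>2 + ?Q) - num\<^sup>2 - 2 * (real d + 1) * num) / (4 * r\<^sup>2)"
      by (simp add: power2_eq_square)
    also have "\<dots> = - ((real d)\<^sup>2 + ?Q) / (4 * r\<^sup>2) - (num / (2 * r))\<^sup>2 - (real d + 1) * (num / (2 * r)) / r"
      using r0 by (simp add: power2_eq_square field_simps)
    finally show ?thesis unfolding ext_potential_def log_deriv_def num_def[symmetric] minus_divide_left .
  qed
  ultimately show ?thesis by (simp add: log_deriv_def[abs_def])
qed

lemma continuous_on_log_deriv: "continuous_on {1..} (log_deriv d k c)" "continuous_on {1..} (ext_potential d k)"
  unfolding log_deriv_def[abs_def] ext_potential_def[abs_def]
  by (intro continuous_intros continuous_on_log_functions; force)+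

lemma ext_potential_nonneg: "0 \<le> ext_potential d k r"
  unfolding ext_potential_def by (intro divide_nonneg_nonneg add_nonneg_nonneg sum_nonneg) auto

lemma ray_ground_state:
  assumes R: "R \<ge> 1" and c: "c = 0 \<or> c = 2"
    and U: "\<And>r. (U has_real_derivative U' r) (at r)" and U'c: "continuous_on UNIV U'" and UR: "U R = 0"
  shows "integral {1..R} (\<lambda>r. r ^ (d + 1) * (U' r)\<^sup>2)
    = integral {1..R} (\<lambda>r. r ^ (d + 1) * (U' r - log_deriv d k c r * U r)\<^sup>2)
    + integral {1..R} (\<lambda>r. r ^ (d + 1) * (ext_potential d k r * (U r)\<^sup>2))
    + (real d - real k - c) / 2 * (U 1)\<^sup>2"
proof -
  let ?q = "log_deriv d k c" and ?V = "ext_potential d k"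
  have Uc: "continuous_on A U" for A by (meson U DERIV_isCont continuous_at_imp_continuous_on)
  have U'c': "continuous_on A U'" for A using U'c by (rule continuous_on_subset) simp
  have qc: "continuous_on {1..R} ?q" "continuous_on {1..R} ?V"
    by (rule continuous_on_subset[OF continuous_on_log_deriv(1)] continuous_on_subset[OF continuous_on_log_deriv(2)]; simp)+
  define f where "f r = r ^ (d + 1) * (U' r)\<^sup>2" for r
  define h where "h r = r ^ (d + 1) * (U' r - ?q r * U r)\<^sup>2" for r
  define v where "v r = r ^ (d + 1) * (?V r * (U r)\<^sup>2)" for r
  have i: "f integrable_on {1..R}" "h integrable_on {1..R}" "v integrable_on {1..R}"
    unfolding f_def h_def v_def by (intro integrable_continuous_real continuous_intros Uc U'c' qc)+
  have "((\<lambda>r. f r - h r - v r) has_integral (R ^ (d + 1) * (?q R * (U R)\<^sup>2) - 1 ^ (d + 1) * (?q 1 * (U 1)\<^sup>2))) {1..R}"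
  proof (rule fundamental_theorem_of_calculus[where f="\<lambda>r. r ^ (d + 1) * (?q r * (U r)\<^sup>2)"])
    fix r assume r: "r \<in> {1..R}"
    then have r1: "r \<ge> 1" "r \<noteq> 0" by auto
    have "((\<lambda>r. r ^ (d + 1) * (?q r * (U r)\<^sup>2)) has_real_derivative
       (real d + 1) * r ^ d * (?q r * (U r)\<^sup>2) + r ^ (d + 1) * ((- ?V r - (?q r)\<^sup>2 - (real d + 1) * ?q r / r) * (U r)\<^sup>2 + ?q r * (2 * U r * U' r))) (at r)"
    proof (rule DERIV_cong[OF DERIV_mult])
      show "((\<lambda>r. r ^ (d + 1)) has_real_derivative (real d + 1) * r ^ d) (at r)"
        using DERIV_pow[of "d + 1" r] by (simp add: add.commute)
      show "((\<lambda>r. ?q r * (U r)\<^sup>2) has_real_derivative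
          (- ?V r - (?q r)\<^sup>2 - (real d + 1) * ?q r / r) * (U r)\<^sup>2 + (2 * U r * U' r) * ?q r) (at r)"
        by (rule DERIV_mult[OF log_deriv_Riccati[OF r1(1) c]]) (auto intro!: derivative_eq_intros U)
    qed (simp add: algebra_simps)
    also have "(real d + 1) * r ^ d * (?q r * (U r)\<^sup>2) + r ^ (d + 1) * ((- ?V r - (?q r)\<^sup>2 - (real d + 1) * ?q r / r) * (U r)\<^sup>2 + ?q r * (2 * U r * U' r))
      = f r - h r - v r"
      using r1(2) by (simp add: f_def h_def v_def power2_eq_square field_simps)
    finally show "((\<lambda>r. r ^ (d + 1) * (?q r * (U r)\<^sup>2)) has_vector_derivative (f r - h r - v r)) (at r within {1..R})"
      unfolding has_real_derivative_iff_has_vector_derivative by (rule has_vector_derivative_at_within)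
  qed (rule R)
  moreover have "?q 1 = - ((real d - real k - c) / 2)" by (simp add: log_deriv_def field_simps)
  ultimately have "integral {1..R} (\<lambda>r. f r - h r - v r) = (real d - real k - c) / 2 * (U 1)\<^sup>2"
    using UR by (simp add: integral_unique)
  moreover have "integral {1..R} (\<lambda>r. f r - h r - v r) = integral {1..R} f - integral {1..R} h - integral {1..R} v"
    using i by (simp add: Henstock_Kurzweil_Integration.integral_diff integrable_diff)
  ultimately show ?thesis unfolding f_def h_def v_def by linarith
qed

text \<open>The change of variables \<open>\<rho> = kap r\<close> and the multiplier \<open>mul r\<close> turn the weighted inequality
  on the exterior domain into the plain Sobolev inequality: \<open>W (kap r \<omega>) = mul r * u (r \<omega>)\<close>.\<close>

definition kap :: "nat \<Rightarrow> nat \<Rightarrow> real \<Rightarrow> real" where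
  "kap d k r = iter_log (Suc k) r powr (1 / real d)"

definition kap' :: "nat \<Rightarrow> nat \<Rightarrow> real \<Rightarrow> real" where
  "kap' d k r = kap d k r * log_weight (Suc k) r / (real d * r)"

definition mul :: "nat \<Rightarrow> nat \<Rightarrow> real \<Rightarrow> real" where
  "mul d k r = sqrt (r ^ d * log_weight k r) / iter_log (Suc k) r"

definition kap_inv :: "nat \<Rightarrow> nat \<Rightarrow> real \<Rightarrow> real" where
  "kap_inv d k \<rho> = iter_exp (Suc k) (\<rho> ^ d)"

definition mul_inv :: "nat \<Rightarrow> nat \<Rightarrow> real \<Rightarrow> real" where
  "mul_inv d k \<rho> = mul d k (kap_inv d k \<rho>)"

definition mul_inv' :: "nat \<Rightarrow> nat \<Rightarrow> real \<Rightarrow> real" where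
  "mul_inv' d k \<rho> = - log_deriv d k 2 (kap_inv d k \<rho>) * mul_inv d k \<rho> / kap' d k (kap_inv d k \<rho>)"

definition dil :: "nat \<Rightarrow> nat \<Rightarrow> real \<Rightarrow> real" where
  "dil d k \<rho> = kap_inv d k \<rho> / \<rho>"

definition dil' :: "nat \<Rightarrow> nat \<Rightarrow> real \<Rightarrow> real" where
  "dil' d k \<rho> = (1 / kap' d k (kap_inv d k \<rho>) - dil d k \<rho>) / \<rho>"

lemma kap_pos: "r \<ge> 1 \<Longrightarrow> kap d k r > 0"
  by (simp add: kap_def del: iter_log.simps)

lemma kap'_pos: "d \<ge> 1 \<Longrightarrow> r \<ge> 1 \<Longrightarrow> kap' d k r > 0"
  by (simp add: kap'_def kap_pos)

lemma mul_pos: "r \<ge> 1 \<Longrightarrow> mul d k r > 0"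
  by (simp add: mul_def del: iter_log.simps)

lemma kap_power:
  assumes d: "d \<ge> 1" and r: "r \<ge> 1"
  shows "kap d k r ^ d = iter_log (Suc k) r"
proof -
  note p = iter_log_pos[OF r, of "Suc k"]
  have "kap d k r ^ d = kap d k r powr real d" using kap_pos[OF r] by (simp add: powr_realpow)
  also have "\<dots> = iter_log (Suc k) r" unfolding kap_def powr_powr using d abs_of_pos[OF p] by (simp del: iter_log.simps)
  finally show ?thesis .
qed

lemma kap_ge_1: "r \<ge> 1 \<Longrightarrow> kap d k r \<ge> 1"
  unfolding kap_def using iter_log_ge_1[of r "Suc k"] by (intro ge_one_powr_ge_zero) auto

lemma kap_at_1 [simp]: "kap d k 1 = 1"
  by (simp add: kap_def)

lemma kap_has_derivative:
  assumes d: "d \<ge> 1" and r: "r \<ge> 1"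
  shows "(kap d k has_real_derivative kap' d k r) (at r)"
proof -
  note p = iter_log_pos[OF r, of "Suc k"]
  have "((\<lambda>r. iter_log (Suc k) r powr (1 / real d)) has_real_derivative
      (1 / real d) * iter_log (Suc k) r powr (1 / real d - 1) * (log_weight k r / r)) (at r)"
    by (rule DERIV_chain2[OF has_real_derivative_powr[OF p] iter_log_Suc_has_derivative[OF r]])
  moreover have "(1 / real d) * iter_log (Suc k) r powr (1 / real d - 1) * (log_weight k r / r) = kap' d k r"
    using p by (simp add: kap'_def kap_def log_weight_Suc powr_diff del: iter_log.simps)
  ultimately show ?thesis by (simp add: kap_def[abs_def])
qed

lemma mul_has_derivative:
  assumes d: "d \<ge> 1" and r: "r \<ge> 1"
  shows "(mul d k has_real_derivative - log_deriv d k 2 r * mul d k r) (at r)"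
proof -
  note p = iter_log_pos[OF r, of "Suc k"] and L = iter_log_Suc_has_derivative[OF r, of k]
  have r0: "r > 0" using r by simp
  have w: "log_weight k r > 0" using r by simp
  define h where "h r = r ^ d * log_weight k r" for r
  have hp: "h r > 0" using r0 w by (simp add: h_def)
  have rd: "r * r ^ (d - Suc 0) = r ^ d" using d by (cases d) auto
  have h': "(h has_real_derivative h r * (real d - log_sum k r) / r) (at r)"
    unfolding h_def
  proof (rule DERIV_cong[OF DERIV_mult[OF DERIV_pow log_weight_has_derivative[OF r]]])
    show "real d * r ^ (d - Suc 0) * log_weight k r + - log_weight k r * log_sum k r / r * r ^ d
       = r ^ d * log_weight k r * (real d - log_sum k r) / r"
      using rd r0 by (simp add: field_simps)
  qed
  have sq: "((\<lambda>r. sqrt (h r)) has_real_derivative (h r * (real d - log_sum k r) / r) * (inverse (sqrt (h r)) / 2)) (at r)"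
    using DERIV_chain2[OF DERIV_real_sqrt[OF hp] h'] by (simp add: mult.commute)
  have ih: "h r * inverse (sqrt (h r)) = sqrt (h r)"
    using hp by (metis divide_inverse real_div_sqrt less_imp_le)
  have me: "mul d k = (\<lambda>r. sqrt (h r) / iter_log (Suc k) r)" by (rule ext) (simp only: mul_def h_def)
  have D: "(mul d k has_real_derivative
      ((h r * (real d - log_sum k r) / r) * (inverse (sqrt (h r)) / 2) * iter_log (Suc k) r - sqrt (h r) * (log_weight k r / r))
      / (iter_log (Suc k) r * iter_log (Suc k) r)) (at r)"
    unfolding me by (rule DERIV_divide[OF sq L]) (use p in auto)
  have e1: "(h r * (real d - log_sum k r) / r) * (inverse (sqrt (h r)) / 2) = sqrt (h r) * (real d - log_sum k r) / (2 * r)"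
  proof -
    have "(h r * (real d - log_sum k r) / r) * (inverse (sqrt (h r)) / 2) = (h r * inverse (sqrt (h r))) * (real d - log_sum k r) / (2 * r)"
      by (simp add: mult_ac)
    then show ?thesis by (simp only: ih)
  qed
  have e2: "(sqrt (h r) * (real d - log_sum k r) / (2 * r) * iter_log (Suc k) r - sqrt (h r) * (log_weight k r / r))
      / (iter_log (Suc k) r * iter_log (Suc k) r) = - log_deriv d k 2 r * mul d k r"
    using p r0 by (simp add: log_deriv_def mul_def h_def[symmetric] log_weight_Suc field_simps del: iter_log.simps)
  show ?thesis using D unfolding e1 e2 .
qed

lemma kap_kap_inv: "d \<ge> 1 \<Longrightarrow> \<rho> > 0 \<Longrightarrow> kap d k (kap_inv d k \<rho>) = \<rho>"
  unfolding kap_def kap_inv_def iter_log_iter_exp by (simp add: powr_powr flip: powr_realpow)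

lemma kap_inv_kap: "d \<ge> 1 \<Longrightarrow> r \<ge> 1 \<Longrightarrow> kap_inv d k (kap d k r) = r"
  unfolding kap_inv_def by (simp only: kap_power iter_exp_iter_log)

lemma kap_inv_ge_1: "\<rho> \<ge> 1 \<Longrightarrow> kap_inv d k \<rho> \<ge> 1"
  unfolding kap_inv_def by (rule iter_exp_ge_1) simp

lemma continuous_on_kap_inv: "continuous_on A (kap_inv d k)"
  unfolding kap_inv_def[abs_def]
  by (rule continuous_on_compose2[OF continuous_on_iter_exp[of UNIV]]) (auto intro!: continuous_intros)

lemma kap_inv_has_derivative:
  assumes d: "d \<ge> 1" and \<rho>: "\<rho> \<ge> 1"
  shows "(kap_inv d k has_real_derivative 1 / kap' d k (kap_inv d k \<rho>)) (at \<rho>)"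
proof -
  note th = kap_inv_ge_1[OF \<rho>, of d k]
  have "(kap_inv d k has_real_derivative inverse (kap' d k (kap_inv d k \<rho>))) (at \<rho>)"
  proof (rule DERIV_inverse_function[where f="kap d k" and a=0 and b="\<rho> + 1"])
    show "(kap d k has_real_derivative kap' d k (kap_inv d k \<rho>)) (at (kap_inv d k \<rho>))"
      by (rule kap_has_derivative[OF d th])
    show "kap' d k (kap_inv d k \<rho>) \<noteq> 0" using kap'_pos[OF d th, of k] by simp
    show "isCont (kap_inv d k) \<rho>"
      using continuous_on_kap_inv[of UNIV d k] by (simp add: continuous_on_eq_continuous_at)
  qed (use \<rho> kap_kap_inv[OF d] in auto)
  then show ?thesis by (simp add: divide_inverse)
qed

lemma mul_inv_has_derivative:
  assumes d: "d \<ge> 1" and \<rho>: "\<rho> \<ge> 1"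
  shows "(mul_inv d k has_real_derivative mul_inv' d k \<rho>) (at \<rho>)"
  using DERIV_chain2[OF mul_has_derivative[OF d kap_inv_ge_1[OF \<rho>]] kap_inv_has_derivative[OF d \<rho>]]
  by (simp add: mul_inv_def[abs_def] mul_inv'_def)

lemma dil_has_derivative:
  assumes d: "d \<ge> 1" and \<rho>: "\<rho> \<ge> 1"
  shows "(dil d k has_real_derivative dil' d k \<rho>) (at \<rho>)"
proof -
  have "((\<lambda>\<rho>. kap_inv d k \<rho> / \<rho>) has_real_derivative (1 / kap' d k (kap_inv d k \<rho>) * \<rho> - kap_inv d k \<rho> * 1) / (\<rho> * \<rho>)) (at \<rho>)"
    by (rule DERIV_divide[OF kap_inv_has_derivative[OF d \<rho>] DERIV_ident]) (use \<rho> in auto)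
  moreover have "(1 / kap' d k (kap_inv d k \<rho>) * \<rho> - kap_inv d k \<rho> * 1) / (\<rho> * \<rho>) = dil' d k \<rho>"
    using \<rho> by (simp add: dil'_def dil_def diff_divide_distrib)
  ultimately show ?thesis by (simp add: dil_def[abs_def])
qed

lemma continuous_on_mul_dil:
  assumes d: "d \<ge> 1"
  shows "continuous_on {1..} (mul_inv d k)" "continuous_on {1..} (mul_inv' d k)"
    "continuous_on {1..} (dil d k)" "continuous_on {1..} (dil' d k)"
proof -
  show m: "continuous_on {1..} (mul_inv d k)"
    by (meson mul_inv_has_derivative[OF d] DERIV_isCont continuous_at_imp_continuous_on atLeast_iff)
  show dl: "continuous_on {1..} (dil d k)"
    by (meson dil_has_derivative[OF d] DERIV_isCont continuous_at_imp_continuous_on atLeast_iff)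
  have im: "kap_inv d k ` {1..} \<subseteq> {1..}" using kap_inv_ge_1 by auto
  have kc: "continuous_on {1..} (kap d k)"
    by (meson kap_has_derivative[OF d] DERIV_isCont continuous_at_imp_continuous_on atLeast_iff)
  have k'c: "continuous_on {1..} (kap' d k)"
    unfolding kap'_def[abs_def]
    by (intro continuous_intros kc continuous_on_log_functions) (use d in auto)
  have 1: "continuous_on {1..} (\<lambda>\<rho>. kap' d k (kap_inv d k \<rho>))"
    by (rule continuous_on_compose2[OF k'c continuous_on_kap_inv im])
  have 2: "continuous_on {1..} (\<lambda>\<rho>. log_deriv d k 2 (kap_inv d k \<rho>))"
    by (rule continuous_on_compose2[OF continuous_on_log_deriv(1) continuous_on_kap_inv im])
  have nz: "kap' d k (kap_inv d k \<rho>) \<noteq> 0" if "\<rho> \<ge> 1" for \<rho>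
    using kap'_pos[OF d kap_inv_ge_1[OF that, of d k], of k] by simp
  show "continuous_on {1..} (mul_inv' d k)"
    unfolding mul_inv'_def[abs_def] by (intro continuous_intros 1 2 m) (use nz in auto)
  show "continuous_on {1..} (dil' d k)"
    unfolding dil'_def[abs_def] by (intro continuous_intros 1 dl) (use nz in auto)
qed

lemma kap_mul_radial:
  assumes d: "d \<ge> 1" and r: "r \<ge> 1"
  shows "kap d k r ^ (d + 1) * (mul d k r / kap' d k r)\<^sup>2 * kap' d k r = real d * r ^ (d + 1)"
proof -
  note p = iter_log_pos[OF r, of "Suc k"] and kp = kap_pos[OF r, of d k]
  have w: "log_weight k r > 0" using r by simp
  have r0: "r > 0" and d0: "real d > 0" using r d by auto
  have m2: "(mul d k r)\<^sup>2 = r ^ d * log_weight k r / (iter_log (Suc k) r)\<^sup>2"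
    using r0 w by (simp add: mul_def power_divide del: iter_log.simps)
  have "kap d k r ^ (d + 1) * (mul d k r / kap' d k r)\<^sup>2 * kap' d k r = kap d k r ^ d * kap d k r * (mul d k r)\<^sup>2 / kap' d k r"
    using kap'_pos[OF d r, of k] by (simp add: power2_eq_square field_simps)
  also have "\<dots> = real d * r ^ (d + 1)"
    unfolding kap_power[OF d r] m2 kap'_def log_weight_Suc
    using kp p w r0 d0 by (simp add: power2_eq_square field_simps del: iter_log.simps)
  finally show ?thesis .
qed

lemma kap_mul_tangential:
  assumes d: "d \<ge> 1" and r: "r \<ge> 1"
  shows "kap d k r ^ (d + 1) * (mul d k r * (r / kap d k r))\<^sup>2 * kap' d k r = 1 / real d * r ^ (d + 1) * (log_weight (Suc k) r)\<^sup>2"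
proof -
  note p = iter_log_pos[OF r, of "Suc k"] and kp = kap_pos[OF r, of d k]
  have w: "log_weight k r > 0" using r by simp
  have r0: "r > 0" and d0: "real d > 0" using r d by auto
  have m2: "(mul d k r)\<^sup>2 = r ^ d * log_weight k r / (iter_log (Suc k) r)\<^sup>2"
    using r0 w by (simp add: mul_def power_divide del: iter_log.simps)
  have "kap d k r ^ (d + 1) * (mul d k r * (r / kap d k r))\<^sup>2 * kap' d k r = kap d k r ^ d * (mul d k r)\<^sup>2 * r\<^sup>2 * (kap' d k r / kap d k r)"
    using kp by (simp add: power2_eq_square field_simps)
  also have "\<dots> = 1 / real d * r ^ (d + 1) * (log_weight (Suc k) r)\<^sup>2"
    unfolding kap_power[OF d r] m2 kap'_def log_weight_Suc
    using kp p w r0 d0 by (simp add: power2_eq_square field_simps del: iter_log.simps)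
  finally show ?thesis .
qed

lemma kap_mul_powr:
  assumes d: "d \<ge> 1" and r: "r \<ge> 1"
  shows "kap d k r ^ (d + 1) * mul d k r powr (2 * (real d + 2) / real d) * kap' d k r
    = 1 / real d * r ^ (d + 1) * log_weight (Suc k) r powr ((2 * (real d + 2) - 2) / real d)"
proof -
  note p = iter_log_pos[OF r, of "Suc k"] and kp = kap_pos[OF r, of d k]
  define s where "s = iter_log (Suc k) r"
  define a where "a = log_weight k r"
  define e where "e = (real d + 2) / real d"
  have sa: "s > 0" "a > 0" using p r by (auto simp: s_def a_def)
  have r0: "r > 0" and d0: "real d > 0" using r d by auto
  have w: "log_weight (Suc k) r = a / s" by (simp only: log_weight_Suc a_def s_def)
  have "mul d k r = (r ^ d * a / s\<^sup>2) powr (1 / 2)"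
    using r0 sa by (simp add: mul_def a_def[symmetric] s_def[symmetric] powr_half_sqrt real_sqrt_divide del: iter_log.simps)
  moreover have half_e: "1 / 2 * (2 * (real d + 2) / real d) = e" using d0 by (simp add: e_def field_simps)
  ultimately have "mul d k r powr (2 * (real d + 2) / real d) = (r ^ d * a / s\<^sup>2) powr e"
    by (simp only: powr_powr half_e)
  also have "\<dots> = (r ^ d) powr e * a powr e / (s\<^sup>2) powr e"
    using r0 sa by (simp add: powr_mult powr_divide)
  also have "(r ^ d) powr e = r ^ (d + 2)"
  proof -
    have "(r ^ d) powr e = r powr (real d * e)" using r0 by (simp add: powr_powr flip: powr_realpow)
    also have "real d * e = real (d + 2)" using d0 by (simp add: e_def)
    finally show ?thesis using r0 by (simp only: powr_realpow)
  qed
  also have "(s\<^sup>2) powr e = s powr e * s powr e"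
    using sa by (simp add: power2_eq_square powr_mult)
  finally have m: "mul d k r powr (2 * (real d + 2) / real d) = r ^ (d + 2) * a powr e / (s powr e * s powr e)" .
  have kk: "kap d k r ^ (d + 1) * kap d k r = s powr e"
  proof -
    have "kap d k r ^ (d + 1) * kap d k r = kap d k r powr real (d + 2)" using kp by (simp add: powr_realpow[OF kp, of "d + 2", simplified] powr_realpow)
    also have "\<dots> = s powr e" unfolding kap_def powr_powr by (simp add: s_def e_def add.commute del: iter_log.simps)
    finally show ?thesis .
  qed
  have ex: "(2 * (real d + 2) - 2) / real d = 1 + e" using d0 by (simp add: e_def field_simps)
  have "kap d k r ^ (d + 1) * mul d k r powr (2 * (real d + 2) / real d) * kap' d k r
    = (kap d k r ^ (d + 1) * kap d k r) * (mul d k r powr (2 * (real d + 2) / real d)) * (a / s) / (real d * r)"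
    unfolding kap'_def w by simp
  also have "\<dots> = 1 / real d * r ^ (d + 1) * ((a / s) * (a powr e / s powr e))"
    unfolding kk m using sa r0 d0 by (simp add: field_simps)
  also have "(a / s) * (a powr e / s powr e) = (a / s) powr (1 + e)"
    using sa by (simp add: powr_add powr_divide)
  finally show ?thesis unfolding w ex .
qed

section \<open>The transported function\<close>

definition tr_fun :: "nat \<Rightarrow> nat \<Rightarrow> ('a::euclidean_space \<Rightarrow> real) \<Rightarrow> 'a \<Rightarrow> real" where
  "tr_fun d k u y = (if norm y \<le> 1 then u y else mul_inv d k (norm y) * u (dil d k (norm y) *\<^sub>R y))"

definition ext_grad :: "nat \<Rightarrow> nat \<Rightarrow> ('a::euclidean_space \<Rightarrow> real) \<Rightarrow> 'a \<Rightarrow> 'a" where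
  "ext_grad d k u y = (mul_inv' d k (norm y) * u (dil d k (norm y) *\<^sub>R y)
      + mul_inv d k (norm y) * dil' d k (norm y) * norm y * (gradient u (dil d k (norm y) *\<^sub>R y) \<bullet> sgn y)) *\<^sub>R sgn y
    + (mul_inv d k (norm y) * dil d k (norm y)) *\<^sub>R gradient u (dil d k (norm y) *\<^sub>R y)"

definition tr_grad :: "nat \<Rightarrow> nat \<Rightarrow> ('a::euclidean_space \<Rightarrow> real) \<Rightarrow> 'a \<Rightarrow> 'a" where
  "tr_grad d k u y = (if norm y \<le> 1 then gradient u y else ext_grad d k u y)"

lemma kap_inv_at_1: "d \<ge> 1 \<Longrightarrow> kap_inv d k 1 = 1"
  using kap_inv_kap[of d 1 k] by simp

lemma mul_inv_at_1: "d \<ge> 1 \<Longrightarrow> mul_inv d k 1 = 1"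
  by (simp add: mul_inv_def kap_inv_at_1 mul_def)

lemma dil_at_1: "d \<ge> 1 \<Longrightarrow> dil d k 1 = 1"
  by (simp add: dil_def kap_inv_at_1)

lemma norm_dil:
  assumes "norm y \<ge> 1"
  shows "norm (dil d k (norm y) *\<^sub>R y) = kap_inv d k (norm y)"
proof -
  have "norm y \<noteq> 0" using assms by auto
  then show ?thesis using kap_inv_ge_1[OF assms, of d k] by (simp add: dil_def)
qed

lemma continuous_on_exterior_comp:
  fixes f :: "real \<Rightarrow> 'b::topological_space"
  assumes "continuous_on {1..} f"
  shows "continuous_on {y::'a::euclidean_space. norm y \<ge> 1} (\<lambda>y. f (norm y))"
  by (rule continuous_on_compose2[OF assms]) (auto intro!: continuous_intros)

lemma continuous_on_dil:
  assumes "d \<ge> 1"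
  shows "continuous_on {y::'a::euclidean_space. norm y \<ge> 1} (\<lambda>y. dil d k (norm y) *\<^sub>R y)"
  by (intro continuous_intros continuous_on_exterior_comp continuous_on_mul_dil assms)

lemma continuous_on_tr_fun:
  fixes u :: "'a::euclidean_space \<Rightarrow> real"
  assumes d: "d \<ge> 1" and u: "smooth u"
  shows "continuous_on UNIV (tr_fun d k u)"
proof -
  have "continuous_on ({y. norm y \<le> 1} \<union> {y. norm y \<ge> 1}) (tr_fun d k u)"
    unfolding tr_fun_def[abs_def]
  proof (rule continuous_on_cases)
    show "closed {y::'a. norm y \<le> 1}" "closed {y::'a. norm y \<ge> 1}"
      by (intro closed_Collect_le continuous_intros)+
    show "continuous_on {y. norm y \<le> 1} u" by (rule smooth_continuous[OF u])
    show "continuous_on {y. norm y \<ge> 1} (\<lambda>y. mul_inv d k (norm y) * u (dil d k (norm y) *\<^sub>R y))"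
      by (intro continuous_on_mult continuous_on_exterior_comp continuous_on_mul_dil d
          continuous_on_compose2[OF smooth_continuous[OF u, of UNIV] continuous_on_dil[OF d]]) auto
    show "\<forall>x. x \<in> {y. norm y \<le> 1} \<and> \<not> norm x \<le> 1 \<or> x \<in> {y. norm y \<ge> 1} \<and> norm x \<le> 1 \<longrightarrow>
        u x = mul_inv d k (norm x) * u (dil d k (norm x) *\<^sub>R x)"
      using mul_inv_at_1[OF d] dil_at_1[OF d] by auto
  qed
  moreover have "{y. norm y \<le> 1} \<union> {y. norm y \<ge> 1} = (UNIV :: 'a set)" by auto
  ultimately show ?thesis by simp
qed

lemma continuous_on_ext_grad:
  fixes u :: "'a::euclidean_space \<Rightarrow> real"
  assumes d: "d \<ge> 1" and u: "smooth u"
  shows "continuous_on {y. norm y \<ge> 1} (ext_grad d k u)"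
proof -
  have s: "continuous_on {y::'a. norm y \<ge> 1} sgn"
    by (intro continuous_on_sgn continuous_intros) auto
  have 1: "continuous_on {y::'a. norm y \<ge> 1} (\<lambda>y. u (dil d k (norm y) *\<^sub>R y))"
    by (rule continuous_on_compose2[OF smooth_continuous[OF u, of UNIV] continuous_on_dil[OF d]]) auto
  have 2: "continuous_on {y::'a. norm y \<ge> 1} (\<lambda>y. gradient u (dil d k (norm y) *\<^sub>R y))"
    by (rule continuous_on_compose2[OF continuous_on_gradient[OF u, of UNIV] continuous_on_dil[OF d]]) auto
  note c = continuous_on_exterior_comp[OF continuous_on_mul_dil(1)[OF d, of k]]
    continuous_on_exterior_comp[OF continuous_on_mul_dil(2)[OF d, of k]]
    continuous_on_exterior_comp[OF continuous_on_mul_dil(3)[OF d, of k]]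
    continuous_on_exterior_comp[OF continuous_on_mul_dil(4)[OF d, of k]]
  show ?thesis unfolding ext_grad_def[abs_def]
    by (intro continuous_on_add continuous_on_scaleR continuous_on_mult continuous_on_inner continuous_on_norm continuous_on_id s 1 2 c)
qed

lemma tr_fun_has_derivative:
  fixes u :: "'a::euclidean_space \<Rightarrow> real"
  assumes d: "d \<ge> 1" and u: "smooth u" and y: "norm y \<noteq> 1"
  shows "(tr_fun d k u has_derivative (\<lambda>h. tr_grad d k u y \<bullet> h)) (at y)"
proof (cases "norm y < 1")
  case True
  have "(u has_derivative (\<lambda>h. tr_grad d k u y \<bullet> h)) (at y)"
    using smooth_has_derivative[OF u, of y] True by (simp add: tr_grad_def)
  then show ?thesis
    by (rule has_derivative_transform_within_open[where s="ball 0 1"]) (use True in \<open>auto simp: tr_fun_def\<close>)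
next
  case False
  then have y1: "norm y > 1" using y by simp
  then have y0: "y \<noteq> 0" by auto
  let ?\<rho> = "norm y" and ?z = "dil d k (norm y) *\<^sub>R y"
  have n: "(norm has_derivative (\<lambda>h. h \<bullet> sgn y)) (at y)" using has_derivative_norm[OF y0] .
  have M: "((\<lambda>y. mul_inv d k (norm y)) has_derivative (\<lambda>h. mul_inv' d k ?\<rho> * (h \<bullet> sgn y))) (at y)"
    using diff_chain_at[OF n] mul_inv_has_derivative[OF d, of ?\<rho> k] y1
    unfolding has_field_derivative_def o_def by (metis less_imp_le)
  have B: "((\<lambda>y. dil d k (norm y)) has_derivative (\<lambda>h. dil' d k ?\<rho> * (h \<bullet> sgn y))) (at y)"
    using diff_chain_at[OF n] dil_has_derivative[OF d, of ?\<rho> k] y1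
    unfolding has_field_derivative_def o_def by (metis less_imp_le)
  have Z: "((\<lambda>y. dil d k (norm y) *\<^sub>R y) has_derivative (\<lambda>h. dil d k ?\<rho> *\<^sub>R h + (dil' d k ?\<rho> * (h \<bullet> sgn y)) *\<^sub>R y)) (at y)"
    by (rule has_derivative_scaleR[OF B has_derivative_ident])
  have Uz: "((\<lambda>y. u (dil d k (norm y) *\<^sub>R y)) has_derivative
      (\<lambda>h. gradient u ?z \<bullet> (dil d k ?\<rho> *\<^sub>R h + (dil' d k ?\<rho> * (h \<bullet> sgn y)) *\<^sub>R y))) (at y)"
    using diff_chain_at[OF Z smooth_has_derivative[OF u]] by (simp add: o_def)
  have ys: "y = ?\<rho> *\<^sub>R sgn y" by (simp add: sgn_div_norm y0)
  have gy: "gradient u ?z \<bullet> y = ?\<rho> * (gradient u ?z \<bullet> sgn y)" by (subst (2) ys) simp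
  have "((\<lambda>y. mul_inv d k (norm y) * u (dil d k (norm y) *\<^sub>R y)) has_derivative (\<lambda>h. tr_grad d k u y \<bullet> h)) (at y)"
  proof (rule has_derivative_eq_rhs[OF has_derivative_mult[OF M Uz]], rule ext)
    fix h
    show "mul_inv d k ?\<rho> * (gradient u ?z \<bullet> (dil d k ?\<rho> *\<^sub>R h + (dil' d k ?\<rho> * (h \<bullet> sgn y)) *\<^sub>R y))
       + mul_inv' d k ?\<rho> * (h \<bullet> sgn y) * u ?z = tr_grad d k u y \<bullet> h"
      using y1 by (simp add: tr_grad_def ext_grad_def inner_add_left inner_add_right gy inner_commute[of h] algebra_simps)
  qed
  then show ?thesis
  proof (rule has_derivative_transform_within_open)
    show "open {y::'a. norm y > 1}" by (intro open_Collect_less continuous_intros)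
  qed (use y1 in \<open>auto simp: tr_fun_def\<close>)
qed

lemma borel_measurable_ext_grad:
  fixes u :: "'a::euclidean_space \<Rightarrow> real"
  assumes d: "d \<ge> 1" and u: "smooth u"
  shows "(\<lambda>y. indicator {y. norm y > 1} y *\<^sub>R ext_grad d k u y) \<in> borel_measurable borel"
    and "tr_grad d k u \<in> borel_measurable borel"
proof -
  have o: "{y::'a. norm y > 1} \<in> sets borel"
    by (intro borel_open open_Collect_less continuous_intros)
  have c: "{y::'a. norm y \<le> 1} \<in> sets borel"
    by (intro borel_closed closed_Collect_le continuous_intros)
  show 1: "(\<lambda>y. indicator {y. norm y > 1} y *\<^sub>R ext_grad d k u y) \<in> borel_measurable borel"
    by (rule borel_measurable_continuous_on_indicator[OF o continuous_on_subset[OF continuous_on_ext_grad[OF d u]]]) auto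
  have 2: "(\<lambda>y. indicator {y. norm y \<le> 1} y *\<^sub>R gradient u y) \<in> borel_measurable borel"
    by (rule borel_measurable_continuous_on_indicator[OF c continuous_on_gradient[OF u]])
  have "tr_grad d k u = (\<lambda>y. indicator {y. norm y \<le> 1} y *\<^sub>R gradient u y + indicator {y. norm y > 1} y *\<^sub>R ext_grad d k u y)"
    by (rule ext) (auto simp: tr_grad_def indicator_def)
  then show "tr_grad d k u \<in> borel_measurable borel" using 1 2 by simp
qed

lemma kap_inv_ge:
  assumes "d \<ge> 1" "R \<ge> 1" "\<rho> \<ge> kap d k R"
  shows "kap_inv d k \<rho> \<ge> R"
proof -
  have "kap d k R ^ d \<le> \<rho> ^ d" using assms kap_pos[of R d k] by (intro power_mono) auto
  then have "kap_inv d k (kap d k R) \<le> kap_inv d k \<rho>"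
    unfolding kap_inv_def by (rule iter_exp_mono)
  then show ?thesis using kap_inv_kap assms by simp
qed

lemma ext_zero:
  fixes u :: "'a::euclidean_space \<Rightarrow> real"
  assumes d: "d \<ge> 1" and R: "R \<ge> 1" and supp: "\<And>x. norm x \<ge> R \<Longrightarrow> u x = 0 \<and> gradient u x = 0"
    and y: "norm y \<ge> kap d k R"
  shows "u (dil d k (norm y) *\<^sub>R y) = 0" "ext_grad d k u y = 0"
proof -
  have y1: "norm y \<ge> 1" using kap_ge_1[OF R, of d k] y by linarith
  have "norm (dil d k (norm y) *\<^sub>R y) \<ge> R" unfolding norm_dil[OF y1] by (rule kap_inv_ge[OF d R y])
  from supp[OF this] show "u (dil d k (norm y) *\<^sub>R y) = 0" "ext_grad d k u y = 0"
    by (auto simp: ext_grad_def)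
qed

lemma tr_support:
  fixes u :: "'a::euclidean_space \<Rightarrow> real"
  assumes d: "d \<ge> 1" and R: "R \<ge> 1" and supp: "\<And>x. norm x \<ge> R \<Longrightarrow> u x = 0 \<and> gradient u x = 0"
    and y: "norm y \<ge> kap d k R + 1"
  shows "tr_fun d k u y = 0 \<and> tr_grad d k u y = 0"
proof -
  have "\<not> norm y \<le> 1" "norm y \<ge> kap d k R" using kap_ge_1[OF R, of d k] y by linarith+
  then show ?thesis using ext_zero[OF d R supp, where y=y and k=k] by (simp add: tr_fun_def tr_grad_def)
qed

lemma tr_grad_bounded:
  fixes u :: "'a::euclidean_space \<Rightarrow> real"
  assumes d: "d \<ge> 1" and u: "smooth u" and R: "R \<ge> 1" and supp: "\<And>x. norm x \<ge> R \<Longrightarrow> u x = 0 \<and> gradient u x = 0"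
  obtains B where "\<And>y. norm (tr_grad d k u y) \<le> B"
proof -
  have "compact (gradient u ` cball 0 1)"
    by (intro compact_continuous_image continuous_on_gradient u) auto
  then obtain B1 where B1: "\<forall>y\<in>gradient u ` cball 0 1. norm y \<le> B1" using compact_imp_bounded bounded_iff by metis
  let ?A = "cball 0 (kap d k R) \<inter> {y::'a. norm y \<ge> 1}"
  have "compact ?A" by (intro compact_Int_closed compact_cball closed_Collect_le continuous_intros)
  then have "compact (ext_grad d k u ` ?A)"
    by (intro compact_continuous_image continuous_on_subset[OF continuous_on_ext_grad[OF d u]]) auto
  then obtain B2 where B2: "\<forall>y\<in>ext_grad d k u ` ?A. norm y \<le> B2" using compact_imp_bounded bounded_iff by metis
  have "norm (tr_grad d k u y) \<le> \<bar>B1\<bar> + \<bar>B2\<bar>" for y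
  proof -
    consider "norm y \<le> 1" | "norm y > 1" "norm y \<le> kap d k R" | "norm y > 1" "norm y \<ge> kap d k R" by linarith
    then show ?thesis
    proof cases
      case 1
      then have "norm (gradient u y) \<le> B1" using B1 by auto
      then show ?thesis using 1 by (simp add: tr_grad_def)
    next
      case 2
      then have "norm (ext_grad d k u y) \<le> B2" using B2 by auto
      then show ?thesis using 2 by (simp add: tr_grad_def)
    next
      case 3
      then show ?thesis using ext_zero(2)[OF d R supp, where y=y and k=k] by (simp add: tr_grad_def)
    qed
  qed
  then show ?thesis by (rule that)
qed

lemma tr_on_ray:
  fixes u :: "'a::euclidean_space \<Rightarrow> real"
  assumes d: "d \<ge> 1" and \<omega>: "norm \<omega> = 1" and r: "r \<ge> 1"
  shows "mul_inv d k (norm (kap d k r *\<^sub>R \<omega>)) * u (dil d k (norm (kap d k r *\<^sub>R \<omega>)) *\<^sub>R (kap d k r *\<^sub>R \<omega>))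
      = mul d k r * u (r *\<^sub>R \<omega>)"
    and "(norm (ext_grad d k u (kap d k r *\<^sub>R \<omega>)))\<^sup>2
      = (mul d k r / kap' d k r)\<^sup>2 * (ray_derivative u \<omega> r - log_deriv d k 2 r * u (r *\<^sub>R \<omega>))\<^sup>2
        + (mul d k r * (r / kap d k r))\<^sup>2 * ((norm (gradient u (r *\<^sub>R \<omega>)))\<^sup>2 - (ray_derivative u \<omega> r)\<^sup>2)"
proof -
  have kp: "kap d k r > 0" using kap_pos[OF r] .
  have k'p: "kap' d k r > 0" using kap'_pos[OF d r] .
  have n: "norm (kap d k r *\<^sub>R \<omega>) = kap d k r" using kp \<omega> by simp
  have s: "sgn (kap d k r *\<^sub>R \<omega>) = \<omega>" using kp \<omega> by (simp add: sgn_scaleR sgn_div_norm)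
  have ki: "kap_inv d k (kap d k r) = r" by (rule kap_inv_kap[OF d r])
  have z: "dil d k (kap d k r) *\<^sub>R (kap d k r *\<^sub>R \<omega>) = r *\<^sub>R \<omega>" using kp by (simp add: dil_def ki)
  have M: "mul_inv d k (kap d k r) = mul d k r" by (simp add: mul_inv_def ki)
  show "mul_inv d k (norm (kap d k r *\<^sub>R \<omega>)) * u (dil d k (norm (kap d k r *\<^sub>R \<omega>)) *\<^sub>R (kap d k r *\<^sub>R \<omega>))
      = mul d k r * u (r *\<^sub>R \<omega>)" unfolding n z M ..
  define v where "v = gradient u (r *\<^sub>R \<omega>)"
  define D where "D = ray_derivative u \<omega> r"
  have vD: "v \<bullet> \<omega> = D" by (simp add: v_def D_def ray_derivative_def)
  define \<alpha> where "\<alpha> = mul_inv' d k (kap d k r) * u (r *\<^sub>R \<omega>) + mul d k r * dil' d k (kap d k r) * kap d k r * D"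
  define \<beta> where "\<beta> = mul d k r * dil d k (kap d k r)"
  have G: "ext_grad d k u (kap d k r *\<^sub>R \<omega>) = \<alpha> *\<^sub>R \<omega> + \<beta> *\<^sub>R v"
    unfolding ext_grad_def n z M s \<alpha>_def \<beta>_def v_def[symmetric] vD ..
  have be: "\<beta> = mul d k r * (r / kap d k r)" by (simp add: \<beta>_def dil_def ki)
  have ww: "\<omega> \<bullet> \<omega> = 1" using \<omega> by (simp add: norm_eq_1)
  have "(norm (\<alpha> *\<^sub>R \<omega> + \<beta> *\<^sub>R v))\<^sup>2 = \<alpha>\<^sup>2 * (\<omega> \<bullet> \<omega>) + 2 * \<alpha> * \<beta> * (v \<bullet> \<omega>) + \<beta>\<^sup>2 * (v \<bullet> v)"
    unfolding power2_norm_eq_inner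
    by (simp add: inner_add_left inner_add_right inner_commute[of \<omega> v] power2_eq_square algebra_simps)
  also have "\<dots> = (\<alpha> + \<beta> * D)\<^sup>2 + \<beta>\<^sup>2 * ((norm v)\<^sup>2 - D\<^sup>2)"
    unfolding ww vD power2_norm_eq_inner by (simp add: power2_eq_square algebra_simps)
  also have "\<alpha> + \<beta> * D = mul d k r / kap' d k r * (D - log_deriv d k 2 r * u (r *\<^sub>R \<omega>))"
  proof -
    have "dil' d k (kap d k r) * kap d k r + dil d k (kap d k r) = 1 / kap' d k r"
      using kp by (simp add: dil'_def ki)
    moreover have "\<alpha> + \<beta> * D = mul_inv' d k (kap d k r) * u (r *\<^sub>R \<omega>)
        + mul d k r * (dil' d k (kap d k r) * kap d k r + dil d k (kap d k r)) * D"
      by (simp add: \<alpha>_def \<beta>_def algebra_simps)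
    ultimately have "\<alpha> + \<beta> * D = mul_inv' d k (kap d k r) * u (r *\<^sub>R \<omega>) + mul d k r * (1 / kap' d k r) * D" by simp
    also have "mul_inv' d k (kap d k r) = - log_deriv d k 2 r * mul d k r / kap' d k r"
      by (simp add: mul_inv'_def ki M)
    finally show ?thesis using k'p by (simp add: field_simps)
  qed
  finally show "(norm (ext_grad d k u (kap d k r *\<^sub>R \<omega>)))\<^sup>2
      = (mul d k r / kap' d k r)\<^sup>2 * (ray_derivative u \<omega> r - log_deriv d k 2 r * u (r *\<^sub>R \<omega>))\<^sup>2
        + (mul d k r * (r / kap d k r))\<^sup>2 * ((norm (gradient u (r *\<^sub>R \<omega>)))\<^sup>2 - (ray_derivative u \<omega> r)\<^sup>2)"
    unfolding G D_def v_def by (simp only: be power_mult_distrib)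
qed

lemma nn_integral_kap_substitution:
  fixes f :: "real \<Rightarrow> real"
  assumes d: "d \<ge> 1" and R: "R \<ge> 1" and f[measurable]: "f \<in> borel_measurable borel"
    and z: "\<And>\<rho>. \<rho> \<ge> kap d k R \<Longrightarrow> f \<rho> = 0"
  shows "(\<integral>\<^sup>+\<rho>. ennreal (f \<rho>) * indicator {1..} \<rho> \<partial>lborel)
    = (\<integral>\<^sup>+r. ennreal (f (kap d k r) * kap' d k r) * indicator {1..R} r \<partial>lborel)"
proof -
  have "(\<integral>\<^sup>+\<rho>. ennreal (f \<rho>) * indicator {1..} \<rho> \<partial>lborel) = (\<integral>\<^sup>+\<rho>. ennreal (f \<rho> * indicator {kap d k 1..kap d k R} \<rho>) \<partial>lborel)"
    using z by (intro nn_integral_cong) (auto split: split_indicator)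
  also have "\<dots> = (\<integral>\<^sup>+r. ennreal (f (kap d k r) * kap' d k r * indicator {1..R} r) \<partial>lborel)"
  proof (rule nn_integral_substitution)
    show "set_borel_measurable borel {kap d k 1..kap d k R} f" by (simp add: set_borel_measurable_def)
    show "(kap d k has_real_derivative kap' d k r) (at r)" if "r \<in> {1..R}" for r
      using that by (intro kap_has_derivative d) auto
    show "0 \<le> kap' d k r" if "r \<in> {1..R}" for r
      using that kap'_pos[OF d, of r k] by auto
    have kc: "continuous_on {1..R} (kap d k)"
      by (meson kap_has_derivative[OF d] DERIV_isCont continuous_at_imp_continuous_on atLeastAtMost_iff)
    have "continuous_on {1..R} (log_weight (Suc k))" by (rule continuous_on_subset[OF continuous_on_log_functions(2)]) auto
    then show "continuous_on {1..R} (kap' d k)"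
      unfolding kap'_def[abs_def] by (intro continuous_intros kc) (use d in auto)
  qed (rule R)
  also have "\<dots> = (\<integral>\<^sup>+r. ennreal (f (kap d k r) * kap' d k r) * indicator {1..R} r \<partial>lborel)"
    by (intro nn_integral_cong) (auto split: split_indicator)
  finally show ?thesis .
qed

lemma borel_measurable_log_functions [measurable]:
  "iter_log j \<in> borel_measurable borel" "log_weight i \<in> borel_measurable borel" "ext_potential d k \<in> borel_measurable borel"
proof -
  have *: "iter_log j \<in> borel_measurable borel" for j
  proof (induction j)
    case 0
    have "iter_log 0 = (\<lambda>r. r)" by (simp add: fun_eq_iff)
    then show ?case by simp
  next
    case (Suc j)
    have "iter_log (Suc j) = (\<lambda>r. 1 + ln (iter_log j r))" by (simp add: fun_eq_iff)
    then show ?case using Suc by simp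
  qed
  show "iter_log j \<in> borel_measurable borel" by (rule *)
  have **: "log_weight i \<in> borel_measurable borel" for i
    unfolding log_weight_def[abs_def] using * by (intro borel_measurable_prod borel_measurable_divide) auto
  show "log_weight i \<in> borel_measurable borel" by (rule **)
  show "ext_potential d k \<in> borel_measurable borel"
    unfolding ext_potential_def[abs_def]
    using ** by (intro borel_measurable_divide borel_measurable_add borel_measurable_sum borel_measurable_power) auto
qed

lemma ray_inequalities:
  fixes u :: "'a::euclidean_space \<Rightarrow> real"
  assumes d: "d \<ge> 1" and u: "smooth u" and R: "R \<ge> 1" and \<omega>: "norm \<omega> = 1"
    and supp: "\<And>x. norm x \<ge> R \<Longrightarrow> u x = 0 \<and> gradient u x = 0" and kd: "k < d"
  defines "\<tau> \<equiv> (real d - real k) / 2"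
  defines "E \<equiv> (\<integral>\<^sup>+r. ennreal (r ^ (d + 1)) * ennreal ((norm (gradient u (r *\<^sub>R \<omega>)))\<^sup>2) * indicator {1..} r \<partial>lborel)"
  defines "P \<equiv> (\<integral>\<^sup>+r. ennreal (r ^ (d + 1)) * ennreal (ext_potential d k (norm (r *\<^sub>R \<omega>)) * (u (r *\<^sub>R \<omega>))\<^sup>2) * indicator {1..} r \<partial>lborel)"
  defines "T \<equiv> (\<integral>\<^sup>+\<rho>. ennreal (\<rho> ^ (d + 1)) * ennreal ((norm (indicator {y. norm y > 1} (\<rho> *\<^sub>R \<omega>) *\<^sub>R ext_grad d k u (\<rho> *\<^sub>R \<omega>)))\<^sup>2) * indicator {1..} \<rho> \<partial>lborel)"
  shows "P + ennreal \<tau> * ennreal ((u \<omega>)\<^sup>2) \<le> E"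
    and "T + ennreal (real d) * P + ennreal (real d * \<tau>) * ennreal ((u \<omega>)\<^sup>2) \<le> ennreal (real d) * E + ennreal (real d) * ennreal ((u \<omega>)\<^sup>2)"
proof -
  let ?U = "\<lambda>r. u (r *\<^sub>R \<omega>)" and ?D = "ray_derivative u \<omega>" and ?g = "\<lambda>r. (norm (gradient u (r *\<^sub>R \<omega>)))\<^sup>2"
  note ct = continuous_on_ray[OF u, where \<omega>=\<omega>]
  have d0: "real d \<ge> 1" using d by simp
  have \<tau>: "\<tau> \<ge> 0" using kd by (simp add: \<tau>_def)
  have z: "?U r = 0" "gradient u (r *\<^sub>R \<omega>) = 0" if "r \<ge> R" for r
    using that supp[of "r *\<^sub>R \<omega>"] \<omega> R by auto
  have cV: "continuous_on {1..R} (ext_potential d k)" and cq: "continuous_on {1..R} (log_deriv d k c)"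
    and cw: "continuous_on {1..R} (log_weight i)" for c i
    by (rule continuous_on_subset[OF continuous_on_log_deriv(2)] continuous_on_subset[OF continuous_on_log_deriv(1)]
        continuous_on_subset[OF continuous_on_log_functions(2)]; simp)+
  define e where "e r = r ^ (d + 1) * ?g r" for r
  define v where "v r = r ^ (d + 1) * (ext_potential d k r * (?U r)\<^sup>2)" for r
  define f where "f r = r ^ (d + 1) * (?D r)\<^sup>2" for r
  define h where "h c r = r ^ (d + 1) * (?D r - log_deriv d k c r * ?U r)\<^sup>2" for c r
  define w where "w r = (log_weight (Suc k) r)\<^sup>2" for r
  define t where "t r = real d * h 2 r + 1 / real d * (w r * (e r - f r))" for r
  have c: "continuous_on {1..R} e" "continuous_on {1..R} v" "continuous_on {1..R} f" "continuous_on {1..R} (h c)" for c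
    unfolding e_def v_def f_def h_def by (intro continuous_intros ct cV cq)+
  have cwt: "continuous_on {1..R} w" unfolding w_def by (intro continuous_intros cw)
  have ctt: "continuous_on {1..R} t" unfolding t_def by (intro continuous_intros c cwt) (use d in auto)
  note i = c[THEN integrable_continuous_real] ctt[THEN integrable_continuous_real]
  have fe: "f r \<le> e r" if "r \<in> {1..R}" for r
    unfolding f_def e_def using that ray_derivative_le[OF \<omega>] by (intro mult_left_mono) auto
  have nn: "0 \<le> e r" "0 \<le> v r" "0 \<le> h c r" "0 \<le> t r" if "r \<in> {1..R}" for c r
  proof -
    have "0 \<le> r" using that by simp
    then show a: "0 \<le> e r" "0 \<le> v r" "0 \<le> h c r" for c
      by (auto simp: e_def v_def h_def intro!: mult_nonneg_nonneg ext_potential_nonneg)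
    show "0 \<le> t r" unfolding t_def using a(3)[of 2] fe[OF that] by (intro add_nonneg_nonneg mult_nonneg_nonneg) (auto simp: w_def)
  qed
  have E: "E = ennreal (integral {1..R} e)"
  proof -
    have "E = (\<integral>\<^sup>+r. ennreal (e r) * indicator {1..R} r \<partial>lborel)"
      unfolding E_def e_def by (intro nn_integral_cong) (auto simp: ennreal_mult z split: split_indicator)
    also have "\<dots> = ennreal (integral {1..R} e)" by (rule nn_integral_continuous_Icc[OF c(1) nn(1)])
    finally show ?thesis .
  qed
  have P: "P = ennreal (integral {1..R} v)"
  proof -
    have "P = (\<integral>\<^sup>+r. ennreal (v r) * indicator {1..R} r \<partial>lborel)"
      unfolding P_def v_def using \<omega> ext_potential_nonneg by (intro nn_integral_cong) (auto simp: ennreal_mult z split: split_indicator)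
    also have "\<dots> = ennreal (integral {1..R} v)" by (rule nn_integral_continuous_Icc[OF c(2) nn(2)])
    finally show ?thesis .
  qed
  have gs: "integral {1..R} f = integral {1..R} (h c) + integral {1..R} v + (real d - real k - c) / 2 * (u \<omega>)\<^sup>2"
    if "c = 0 \<or> c = 2" for c
    unfolding f_def h_def v_def
    using ray_ground_state[OF R that, where U="?U" and U'="?D" and d=d and k=k] ray_has_derivative[OF u] ct(2) z(1)[of R] by simp
  have "integral {1..R} f \<le> integral {1..R} e" by (rule integral_le[OF i(3) i(1) fe])
  moreover have "0 \<le> integral {1..R} (h 0)" by (rule Henstock_Kurzweil_Integration.integral_nonneg[OF i(4) nn(3)])
  ultimately have A: "integral {1..R} v + \<tau> * (u \<omega>)\<^sup>2 \<le> integral {1..R} e"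
    using gs[of 0] by (simp add: \<tau>_def)
  have v0: "0 \<le> integral {1..R} v" by (rule Henstock_Kurzweil_Integration.integral_nonneg[OF i(2) nn(2)])
  have e0: "0 \<le> integral {1..R} e" by (rule Henstock_Kurzweil_Integration.integral_nonneg[OF i(1) nn(1)])
  have t0: "0 \<le> integral {1..R} t" by (rule Henstock_Kurzweil_Integration.integral_nonneg[OF i(5) nn(4)])
  show "P + ennreal \<tau> * ennreal ((u \<omega>)\<^sup>2) \<le> E"
    unfolding E P using ennreal_leI[OF A] v0 \<tau> by (simp add: ennreal_mult)
  have T: "T = ennreal (integral {1..R} t)"
  proof -
    define F where "F \<rho> = \<rho> ^ (d + 1) * (norm (indicator {y. norm y > 1} (\<rho> *\<^sub>R \<omega>) *\<^sub>R ext_grad d k u (\<rho> *\<^sub>R \<omega>)))\<^sup>2" for \<rho>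
    have Fm: "F \<in> borel_measurable borel"
    proof -
      have "(\<lambda>\<rho>. (\<lambda>y. indicator {y. norm y > 1} y *\<^sub>R ext_grad d k u y) (\<rho> *\<^sub>R \<omega>)) \<in> borel_measurable borel"
        by (rule measurable_compose[OF _ borel_measurable_ext_grad(1)[OF d u]]) simp
      from measurable_compose[OF this borel_measurable_continuous_onI[OF continuous_on_norm_id]]
      show ?thesis unfolding F_def by (intro borel_measurable_times borel_measurable_power) simp_all
    qed
    have "T = (\<integral>\<^sup>+\<rho>. ennreal (F \<rho>) * indicator {1..} \<rho> \<partial>lborel)"
      unfolding T_def F_def by (intro nn_integral_cong) (auto simp: ennreal_mult split: split_indicator)
    also have "\<dots> = (\<integral>\<^sup>+r. ennreal (F (kap d k r) * kap' d k r) * indicator {1..R} r \<partial>lborel)"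
    proof (rule nn_integral_kap_substitution[OF d R Fm])
      fix \<rho> assume \<rho>: "\<rho> \<ge> kap d k R"
      then have "norm (\<rho> *\<^sub>R \<omega>) \<ge> kap d k R" using \<omega> kap_pos[OF R, of d k] by simp
      from ext_zero(2)[OF d R supp this] show "F \<rho> = 0" by (simp add: F_def)
    qed
    also have "\<dots> = (\<integral>\<^sup>+r. ennreal (t r) * indicator {1..R} r \<partial>lborel)"
    proof (rule nn_integral_cong_AE)
      have "AE r in lborel. r \<noteq> (1::real)" by (rule AE_lborel_singleton)
      then show "AE r in lborel. ennreal (F (kap d k r) * kap' d k r) * indicator {1..R} r = ennreal (t r) * indicator {1..R} r"
      proof eventually_elim
        case (elim r)
        show ?case
        proof (cases "r \<in> {1..R}")
          case True
          then have r: "r \<ge> 1" "r > 1" using elim by auto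
          have "iter_log j r > 1" for j using r(2) by (induction j) auto
          from this[of "Suc k"] have "kap d k r > 1" unfolding kap_def using d by (intro gr_one_powr) auto
          then have "norm (kap d k r *\<^sub>R \<omega>) > 1" using \<omega> by simp
          then have "F (kap d k r) = kap d k r ^ (d + 1) * (norm (ext_grad d k u (kap d k r *\<^sub>R \<omega>)))\<^sup>2" by (simp add: F_def)
          also have "\<dots> * kap' d k r = (kap d k r ^ (d + 1) * (mul d k r / kap' d k r)\<^sup>2 * kap' d k r) * (?D r - log_deriv d k 2 r * ?U r)\<^sup>2
             + (kap d k r ^ (d + 1) * (mul d k r * (r / kap d k r))\<^sup>2 * kap' d k r) * (?g r - (?D r)\<^sup>2)"
            unfolding tr_on_ray(2)[OF d \<omega> r(1)] by (simp only: algebra_simps)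
          also have "\<dots> = t r"
            unfolding kap_mul_radial[OF d r(1)] kap_mul_tangential[OF d r(1)] t_def h_def e_def f_def w_def
            by (simp add: algebra_simps)
          finally show ?thesis by simp
        qed simp
      qed
    qed
    also have "\<dots> = ennreal (integral {1..R} t)" by (rule nn_integral_continuous_Icc[OF ctt nn(4)])
    finally show ?thesis .
  qed
  have "integral {1..R} t \<le> integral {1..R} (\<lambda>r. real d * (h 2 r + (e r - f r)))"
  proof (rule integral_le[OF i(5)])
    show "(\<lambda>r. real d * (h 2 r + (e r - f r))) integrable_on {1..R}"
      by (intro integrable_continuous_real continuous_intros c)
    fix r assume r: "r \<in> {1..R}"
    have "w r \<le> 1" unfolding w_def
      by (intro power_le_one less_imp_le[OF log_weight_pos] log_weight_le_1) (use r in auto)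
    moreover have "1 / real d \<le> 1" using d0 by simp
    then have "1 / real d \<le> real d" using d0 by linarith
    ultimately have "1 / real d * (w r * (e r - f r)) \<le> real d * (1 * (e r - f r))"
      using fe[OF r] d0 by (intro mult_mono) (auto simp: w_def)
    then show "t r \<le> real d * (h 2 r + (e r - f r))" by (simp add: t_def algebra_simps)
  qed
  also have "\<dots> = real d * (integral {1..R} (h 2) + (integral {1..R} e - integral {1..R} f))"
    using i(1,3) i(4)[of 2]
    by (simp add: Henstock_Kurzweil_Integration.integral_add Henstock_Kurzweil_Integration.integral_diff integrable_diff)
  also have "\<dots> = real d * (integral {1..R} e - integral {1..R} v - (\<tau> - 1) * (u \<omega>)\<^sup>2)"
  proof -
    have "(real d - real k - 2) / 2 = \<tau> - 1" by (simp add: \<tau>_def field_simps)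
    with gs[of 2] have "integral {1..R} f = integral {1..R} (h 2) + integral {1..R} v + (\<tau> - 1) * (u \<omega>)\<^sup>2"
      by (simp only: simp_thms)
    then have "integral {1..R} (h 2) + (integral {1..R} e - integral {1..R} f)
      = integral {1..R} e - integral {1..R} v - (\<tau> - 1) * (u \<omega>)\<^sup>2" by linarith
    then show ?thesis by (simp only:)
  qed
  finally have B: "integral {1..R} t + real d * integral {1..R} v + real d * \<tau> * (u \<omega>)\<^sup>2
      \<le> real d * integral {1..R} e + real d * (u \<omega>)\<^sup>2"
    by (simp add: algebra_simps)
  show "T + ennreal (real d) * P + ennreal (real d * \<tau>) * ennreal ((u \<omega>)\<^sup>2) \<le> ennreal (real d) * E + ennreal (real d) * ennreal ((u \<omega>)\<^sup>2)"
    unfolding E P T using ennreal_leI[OF B] v0 \<tau> e0 t0 by (simp add: ennreal_mult)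
qed

lemma borel_measurable_sphere_radial_set:
  fixes f :: "'a::euclidean_space \<Rightarrow> ennreal"
  assumes "f \<in> borel_measurable borel"
  shows "(\<lambda>\<omega>. \<integral>\<^sup>+r. ennreal (r ^ n) * f (r *\<^sub>R \<omega>) * indicator {1..} r \<partial>lborel) \<in> borel_measurable sphere_measure"
proof -
  have "(\<lambda>\<omega>. \<integral>\<^sup>+r. (ennreal (r ^ n) * indicator {1..} r) * f (r *\<^sub>R \<omega>) \<partial>lborel) \<in> borel_measurable sphere_measure"
    by (rule borel_measurable_sphere_radial[OF assms]) simp
  then show ?thesis by (simp add: mult_ac)
qed

lemma exterior_inequalities:
  fixes u :: "'a::euclidean_space \<Rightarrow> real"
  assumes N: "DIM('a) = d + 2" and d: "d \<ge> 1" and u: "smooth u" and R: "R \<ge> 1"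
    and supp: "\<And>x. norm x \<ge> R \<Longrightarrow> u x = 0 \<and> gradient u x = 0" and kd: "k < d"
  defines "\<tau> \<equiv> (real d - real k) / 2"
  defines "A \<equiv> (\<integral>\<^sup>+x. ennreal ((norm (gradient u x))\<^sup>2) * indicator {x. norm x > 1} x \<partial>lborel)"
  defines "P \<equiv> (\<integral>\<^sup>+x. ennreal (ext_potential d k (norm x) * (u x)\<^sup>2) * indicator {x. norm x > 1} x \<partial>lborel)"
  defines "T \<equiv> (\<integral>\<^sup>+x. ennreal ((norm (tr_grad d k u x))\<^sup>2) * indicator {x. norm x > 1} x \<partial>lborel)"
  defines "S \<equiv> (\<integral>\<^sup>+\<omega>. ennreal ((u \<omega>)\<^sup>2) \<partial>sphere_measure)"
  shows "P + ennreal \<tau> * S \<le> A"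
    and "T + ennreal (real d) * P + ennreal (real d * \<tau>) * S \<le> ennreal (real d) * A + ennreal (real d) * S"
proof -
  have um[measurable]: "u \<in> borel_measurable borel" and gm[measurable]: "gradient u \<in> borel_measurable borel"
    using u by (auto intro!: borel_measurable_continuous_onI smooth_continuous continuous_on_gradient)
  note [measurable] = borel_measurable_ext_grad(1)[OF d u, of k]
  define fA where "fA x = ennreal ((norm (gradient u x))\<^sup>2)" for x
  define fP where "fP x = ennreal (ext_potential d k (norm x) * (u x)\<^sup>2)" for x
  define fT where "fT x = ennreal ((norm (indicator {y. norm y > 1} x *\<^sub>R ext_grad d k u x))\<^sup>2)" for x
  have m: "fA \<in> borel_measurable borel" "fP \<in> borel_measurable borel" "fT \<in> borel_measurable borel"
    unfolding fA_def fP_def fT_def by measurable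
  define rA where "rA \<omega> = (\<integral>\<^sup>+r. ennreal (r ^ (d + 1)) * fA (r *\<^sub>R \<omega>) * indicator {1..} r \<partial>lborel)" for \<omega>
  define rP where "rP \<omega> = (\<integral>\<^sup>+r. ennreal (r ^ (d + 1)) * fP (r *\<^sub>R \<omega>) * indicator {1..} r \<partial>lborel)" for \<omega>
  define rT where "rT \<omega> = (\<integral>\<^sup>+r. ennreal (r ^ (d + 1)) * fT (r *\<^sub>R \<omega>) * indicator {1..} r \<partial>lborel)" for \<omega>
  define s where "s \<omega> = ennreal ((u \<omega>)\<^sup>2)" for \<omega>
  have rm[measurable]: "rA \<in> borel_measurable sphere_measure" "rP \<in> borel_measurable sphere_measure" "rT \<in> borel_measurable sphere_measure"
    unfolding rA_def rP_def rT_def by (intro borel_measurable_sphere_radial_set m)+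
  have sm[measurable]: "s \<in> borel_measurable sphere_measure"
    unfolding s_def by (rule borel_measurable_sphere) measurable
  have N1: "DIM('a) - 1 = d + 1" using N by simp
  have A: "A = (\<integral>\<^sup>+\<omega>. rA \<omega> \<partial>sphere_measure)"
    unfolding A_def rA_def fA_def[symmetric] using nn_integral_polar_exterior[OF m(1)] unfolding N1 .
  have P: "P = (\<integral>\<^sup>+\<omega>. rP \<omega> \<partial>sphere_measure)"
    unfolding P_def rP_def fP_def[symmetric] using nn_integral_polar_exterior[OF m(2)] unfolding N1 .
  have "T = (\<integral>\<^sup>+x. fT x * indicator {x. norm x > 1} x \<partial>lborel)"
    unfolding T_def fT_def by (intro nn_integral_cong) (auto simp: tr_grad_def split: split_indicator)
  also have "\<dots> = (\<integral>\<^sup>+\<omega>. rT \<omega> \<partial>sphere_measure)"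
    unfolding rT_def using nn_integral_polar_exterior[OF m(3)] unfolding N1 .
  finally have T: "T = (\<integral>\<^sup>+\<omega>. rT \<omega> \<partial>sphere_measure)" .
  have S: "S = (\<integral>\<^sup>+\<omega>. s \<omega> \<partial>sphere_measure)" by (simp add: S_def s_def)
  have r1: "rP \<omega> + ennreal \<tau> * s \<omega> \<le> rA \<omega>" and
    r2: "rT \<omega> + ennreal (real d) * rP \<omega> + ennreal (real d * \<tau>) * s \<omega> \<le> ennreal (real d) * rA \<omega> + ennreal (real d) * s \<omega>"
    if "\<omega> \<in> space sphere_measure" for \<omega>
  proof -
    have \<omega>: "norm \<omega> = 1" using that by simp
    show "rP \<omega> + ennreal \<tau> * s \<omega> \<le> rA \<omega>"
      unfolding rP_def rA_def s_def fP_def fA_def \<tau>_def by (rule ray_inequalities(1)[OF d u R \<omega> supp kd])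
    show "rT \<omega> + ennreal (real d) * rP \<omega> + ennreal (real d * \<tau>) * s \<omega> \<le> ennreal (real d) * rA \<omega> + ennreal (real d) * s \<omega>"
      unfolding rP_def rA_def rT_def s_def fP_def fA_def fT_def \<tau>_def by (rule ray_inequalities(2)[OF d u R \<omega> supp kd])
  qed
  have "P + ennreal \<tau> * S = (\<integral>\<^sup>+\<omega>. rP \<omega> + ennreal \<tau> * s \<omega> \<partial>sphere_measure)"
    unfolding P S by (subst nn_integral_add) (simp_all add: nn_integral_cmult)
  also have "\<dots> \<le> A" unfolding A by (rule nn_integral_mono) (rule r1)
  finally show "P + ennreal \<tau> * S \<le> A" .
  have "T + ennreal (real d) * P + ennreal (real d * \<tau>) * S
     = (\<integral>\<^sup>+\<omega>. rT \<omega> + ennreal (real d) * rP \<omega> + ennreal (real d * \<tau>) * s \<omega> \<partial>sphere_measure)"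
    unfolding P S T by (simp add: nn_integral_add nn_integral_cmult)
  also have "\<dots> \<le> (\<integral>\<^sup>+\<omega>. ennreal (real d) * rA \<omega> + ennreal (real d) * s \<omega> \<partial>sphere_measure)"
    by (rule nn_integral_mono) (rule r2)
  also have "\<dots> = ennreal (real d) * A + ennreal (real d) * S"
    unfolding A S by (simp add: nn_integral_add nn_integral_cmult)
  finally show "T + ennreal (real d) * P + ennreal (real d * \<tau>) * S \<le> ennreal (real d) * A + ennreal (real d) * S" .
qed

lemma exterior_power:
  fixes u :: "'a::euclidean_space \<Rightarrow> real"
  assumes N: "DIM('a) = d + 2" and d: "d \<ge> 1" and u: "smooth u" and R: "R \<ge> 1"
    and supp: "\<And>x. norm x \<ge> R \<Longrightarrow> u x = 0 \<and> gradient u x = 0"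
  defines "p \<equiv> 2 * (real d + 2) / real d" and "q \<equiv> (2 * (real d + 2) - 2) / real d"
  shows "(\<integral>\<^sup>+x. ennreal (\<bar>u x\<bar> powr p * log_weight (Suc k) (norm x) powr q) * indicator {x. norm x > 1} x \<partial>lborel)
    = ennreal (real d) * (\<integral>\<^sup>+x. ennreal (\<bar>tr_fun d k u x\<bar> powr p) * indicator {x. norm x > 1} x \<partial>lborel)"
proof -
  have d0: "real d > 0" using d by simp
  have p: "p > 0" using d0 by (simp add: p_def)
  have um[measurable]: "u \<in> borel_measurable borel"
    using u by (intro borel_measurable_continuous_onI smooth_continuous)
  have tm[measurable]: "tr_fun d k u \<in> borel_measurable borel"
    by (rule borel_measurable_continuous_onI[OF continuous_on_tr_fun[OF d u]])
  define f where "f x = ennreal (\<bar>u x\<bar> powr p * log_weight (Suc k) (norm x) powr q)" for x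
  define h where "h x = ennreal (\<bar>tr_fun d k u x\<bar> powr p)" for x
  have fm: "f \<in> borel_measurable borel" and hm: "h \<in> borel_measurable borel"
    unfolding f_def h_def by measurable
  have N1: "DIM('a) - 1 = d + 1" using N by simp
  have ray: "(\<integral>\<^sup>+r. ennreal (r ^ (d + 1)) * f (r *\<^sub>R \<omega>) * indicator {1..} r \<partial>lborel)
      = ennreal (real d) * (\<integral>\<^sup>+\<rho>. ennreal (\<rho> ^ (d + 1)) * h (\<rho> *\<^sub>R \<omega>) * indicator {1..} \<rho> \<partial>lborel)"
    if \<omega>: "norm \<omega> = 1" for \<omega> :: 'a
  proof -
    define F where "F \<rho> = \<rho> ^ (d + 1) * \<bar>tr_fun d k u (\<rho> *\<^sub>R \<omega>)\<bar> powr p" for \<rho>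
    have tr: "tr_fun d k u (\<rho> *\<^sub>R \<omega>) = mul_inv d k (norm (\<rho> *\<^sub>R \<omega>)) * u (dil d k (norm (\<rho> *\<^sub>R \<omega>)) *\<^sub>R (\<rho> *\<^sub>R \<omega>))"
      if "\<rho> \<ge> 1" for \<rho>
    proof (cases "\<rho> = 1")
      case True
      then show ?thesis using \<omega> by (simp add: tr_fun_def mul_inv_at_1[OF d] dil_at_1[OF d])
    next
      case False
      then have "\<not> norm (\<rho> *\<^sub>R \<omega>) \<le> 1" using that \<omega> by simp
      then show ?thesis by (simp only: tr_fun_def if_False)
    qed
    have "(\<integral>\<^sup>+\<rho>. ennreal (\<rho> ^ (d + 1)) * h (\<rho> *\<^sub>R \<omega>) * indicator {1..} \<rho> \<partial>lborel) = (\<integral>\<^sup>+\<rho>. ennreal (F \<rho>) * indicator {1..} \<rho> \<partial>lborel)"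
      unfolding F_def h_def by (intro nn_integral_cong) (auto simp: ennreal_mult split: split_indicator)
    also have "\<dots> = (\<integral>\<^sup>+r. ennreal (F (kap d k r) * kap' d k r) * indicator {1..R} r \<partial>lborel)"
    proof (rule nn_integral_kap_substitution[OF d R])
      show "F \<in> borel_measurable borel" unfolding F_def by measurable
      fix \<rho> assume \<rho>: "\<rho> \<ge> kap d k R"
      have \<rho>1: "\<rho> \<ge> 1" using \<rho> kap_ge_1[OF R, of d k] by linarith
      then have "norm (\<rho> *\<^sub>R \<omega>) \<ge> kap d k R" using \<omega> \<rho> by simp
      from ext_zero(1)[OF d R supp this] show "F \<rho> = 0" unfolding F_def tr[OF \<rho>1] using p by simp
    qed
    also have "\<dots> = (\<integral>\<^sup>+r. ennreal (1 / real d) * (ennreal (r ^ (d + 1)) * f (r *\<^sub>R \<omega>) * indicator {1..} r) \<partial>lborel)"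
    proof (rule nn_integral_cong)
      fix r
      show "ennreal (F (kap d k r) * kap' d k r) * indicator {1..R} r
        = ennreal (1 / real d) * (ennreal (r ^ (d + 1)) * f (r *\<^sub>R \<omega>) * indicator {1..} r)"
      proof (cases "r \<ge> 1")
        case True
        have "F (kap d k r) * kap' d k r = kap d k r ^ (d + 1) * \<bar>mul d k r * u (r *\<^sub>R \<omega>)\<bar> powr p * kap' d k r"
          unfolding F_def tr[OF kap_ge_1[OF True]] tr_on_ray(1)[OF d \<omega> True] ..
        also have "\<bar>mul d k r * u (r *\<^sub>R \<omega>)\<bar> powr p = mul d k r powr p * \<bar>u (r *\<^sub>R \<omega>)\<bar> powr p"
          using mul_pos[OF True, of d k] by (simp add: abs_mult powr_mult)
        also have "kap d k r ^ (d + 1) * (mul d k r powr p * \<bar>u (r *\<^sub>R \<omega>)\<bar> powr p) * kap' d k r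
           = (kap d k r ^ (d + 1) * mul d k r powr p * kap' d k r) * \<bar>u (r *\<^sub>R \<omega>)\<bar> powr p" by (simp only: mult_ac)
        also have "\<dots> = 1 / real d * (r ^ (d + 1) * (\<bar>u (r *\<^sub>R \<omega>)\<bar> powr p * log_weight (Suc k) (norm (r *\<^sub>R \<omega>)) powr q))"
          unfolding p_def q_def kap_mul_powr[OF d True] using \<omega> True by simp
        finally have eq: "F (kap d k r) * kap' d k r
          = 1 / real d * (r ^ (d + 1) * (\<bar>u (r *\<^sub>R \<omega>)\<bar> powr p * log_weight (Suc k) (norm (r *\<^sub>R \<omega>)) powr q))" .
        have r0: "0 \<le> r ^ (d + 1)" using True by simp
        have e: "ennreal (F (kap d k r) * kap' d k r) = ennreal (1 / real d) * (ennreal (r ^ (d + 1)) * f (r *\<^sub>R \<omega>))"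
          unfolding eq f_def ennreal_mult'[OF r0, symmetric] by (rule ennreal_mult') simp
        show ?thesis
        proof (cases "r \<le> R")
          case False
          then have "u (r *\<^sub>R \<omega>) = 0" using supp[of "r *\<^sub>R \<omega>"] \<omega> True by simp
          then show ?thesis using p False by (simp add: f_def)
        qed (use True e in \<open>simp add: mult.assoc\<close>)
      qed simp
    qed
    also have "\<dots> = ennreal (1 / real d) * (\<integral>\<^sup>+r. ennreal (r ^ (d + 1)) * f (r *\<^sub>R \<omega>) * indicator {1..} r \<partial>lborel)"
    proof (rule nn_integral_cmult)
      have "(\<lambda>r. f (r *\<^sub>R \<omega>)) \<in> borel_measurable borel" by (rule measurable_compose[OF _ fm]) simp
      then show "(\<lambda>r. ennreal (r ^ (d + 1)) * f (r *\<^sub>R \<omega>) * indicator {1..} r) \<in> borel_measurable lborel" by simp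
    qed
    finally have "ennreal (real d) * (\<integral>\<^sup>+\<rho>. ennreal (\<rho> ^ (d + 1)) * h (\<rho> *\<^sub>R \<omega>) * indicator {1..} \<rho> \<partial>lborel)
       = (ennreal (real d) * ennreal (1 / real d)) * (\<integral>\<^sup>+r. ennreal (r ^ (d + 1)) * f (r *\<^sub>R \<omega>) * indicator {1..} r \<partial>lborel)"
      by (simp only: mult.assoc)
    also have "ennreal (real d) * ennreal (1 / real d) = 1" using d0 by (simp flip: ennreal_mult)
    finally show ?thesis by simp
  qed
  have "(\<integral>\<^sup>+x. f x * indicator {x. norm x > 1} x \<partial>lborel)
     = (\<integral>\<^sup>+\<omega>. (\<integral>\<^sup>+r. ennreal (r ^ (d + 1)) * f (r *\<^sub>R \<omega>) * indicator {1..} r \<partial>lborel) \<partial>sphere_measure)"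
    using nn_integral_polar_exterior[OF fm] unfolding N1 .
  also have "\<dots> = (\<integral>\<^sup>+\<omega>. ennreal (real d) * (\<integral>\<^sup>+\<rho>. ennreal (\<rho> ^ (d + 1)) * h (\<rho> *\<^sub>R \<omega>) * indicator {1..} \<rho> \<partial>lborel) \<partial>sphere_measure)"
    by (rule nn_integral_cong) (rule ray, simp)
  also have "\<dots> = ennreal (real d) * (\<integral>\<^sup>+\<omega>. (\<integral>\<^sup>+\<rho>. ennreal (\<rho> ^ (d + 1)) * h (\<rho> *\<^sub>R \<omega>) * indicator {1..} \<rho> \<partial>lborel) \<partial>sphere_measure)"
    by (rule nn_integral_cmult[OF borel_measurable_sphere_radial_set[OF hm]])
  also have "\<dots> = ennreal (real d) * (\<integral>\<^sup>+x. h x * indicator {x. norm x > 1} x \<partial>lborel)"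
    using nn_integral_polar_exterior[OF hm] unfolding N1 by simp
  finally show ?thesis by (simp only: f_def h_def)
qed

lemma nn_integral_split_sphere:
  fixes f :: "'a::euclidean_space \<Rightarrow> ennreal"
  assumes [measurable]: "f \<in> borel_measurable borel"
  shows "(\<integral>\<^sup>+x. f x \<partial>lborel) = (\<integral>\<^sup>+x. f x * indicator (ball 0 1) x \<partial>lborel)
    + (\<integral>\<^sup>+x. f x * indicator {x. norm x > 1} x \<partial>lborel)"
proof -
  have [measurable]: "ball (0::'a) 1 \<in> sets borel" by simp
  have "sphere (0::'a) 1 \<in> null_sets lborel"
    using negligible_sphere[of "0::'a" 1] by (simp add: negligible_iff_null_sets null_sets_completion_iff)
  then have "AE x in lborel. x \<notin> sphere (0::'a) 1" by (rule AE_not_in)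
  then have "AE x in lborel. f x = f x * indicator (ball 0 1) x + f x * indicator {x. norm x > 1} x"
    by eventually_elim (auto split: split_indicator)
  then have "(\<integral>\<^sup>+x. f x \<partial>lborel) = (\<integral>\<^sup>+x. f x * indicator (ball 0 1) x + f x * indicator {x. norm x > 1} x \<partial>lborel)"
    by (rule nn_integral_cong_AE)
  also have "\<dots> = (\<integral>\<^sup>+x. f x * indicator (ball 0 1) x \<partial>lborel) + (\<integral>\<^sup>+x. f x * indicator {x. norm x > 1} x \<partial>lborel)"
    by (rule nn_integral_add) measurable
  finally show ?thesis .
qed

lemma integral_lebesgue_eqI:
  fixes f :: "'a::euclidean_space \<Rightarrow> real"
  assumes "f \<in> borel_measurable borel" "\<And>x. 0 \<le> f x"
    and "(\<integral>\<^sup>+x. ennreal (f x) \<partial>lborel) = ennreal c" "0 \<le> c"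
  shows "(LINT x|lebesgue. f x) = c"
proof -
  have "(LINT x|lebesgue. f x) = enn2real (\<integral>\<^sup>+x. ennreal (f x) \<partial>lborel)"
    using assms(1,2) by (subst integral_eq_nn_integral) (auto intro: measurable_completion simp: nn_integral_completion)
  then show ?thesis using assms(3,4) by simp
qed

lemma transported_Sobolev:
  fixes u :: "'a::euclidean_space \<Rightarrow> real"
  assumes N: "DIM('a) = d + 2" and d: "d \<ge> 1" and u: "smooth u" and kd: "k < d" and R: "R \<ge> 1"
    and supp: "\<And>x. norm x \<ge> R \<Longrightarrow> u x = 0 \<and> gradient u x = 0"
    and a: "a \<ge> 0" "(\<integral>\<^sup>+x. ennreal ((norm (gradient u x))\<^sup>2) * indicator (ball 0 1) x \<partial>lborel) = ennreal a"
    and s: "s \<ge> 0" "(\<integral>\<^sup>+x. ennreal ((u x)\<^sup>2) \<partial>sphere_measure) = ennreal s"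
  defines "\<tau> \<equiv> (real d - real k) / 2"
  defines "w x \<equiv> (if norm x > 1 then log_weight (Suc k) (norm x) else 1) powr ((2 * (real d + 2) - 2) / real d)"
  obtains A P Z where "A \<ge> 0" "P \<ge> 0" "Z \<ge> 0"
    "(\<integral>\<^sup>+x. ennreal ((norm (gradient u x))\<^sup>2) * indicator {x. norm x > 1} x \<partial>lborel) = ennreal A"
    "(\<integral>\<^sup>+x. ennreal (ext_potential d k (norm x) * (u x)\<^sup>2) * indicator {x. norm x > 1} x \<partial>lborel) = ennreal P"
    "(\<integral>\<^sup>+x. ennreal (\<bar>u x\<bar> powr (2 * (real d + 2) / real d) * w x) \<partial>lborel) = ennreal Z"
    "P + \<tau> * s \<le> A"
    "Z powr (real d / (real d + 2)) \<le> real d * (2 * (real d + 1) / real d)\<^sup>2 * (a + real d * (A - P - \<tau> * s + s))"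
proof -
  define p where "p = 2 * (real d + 2) / real d"
  define q where "q = (2 * (real d + 2) - 2) / real d"
  define e where "e = real d / (real d + 2)"
  have d0: "real d \<ge> 1" using d by simp
  have \<tau>: "\<tau> \<ge> 0" using kd by (simp add: \<tau>_def)
  have um[measurable]: "u \<in> borel_measurable borel" and gm[measurable]: "gradient u \<in> borel_measurable borel"
    using u by (auto intro!: borel_measurable_continuous_onI smooth_continuous continuous_on_gradient)
  define W where "W = tr_fun d k u"
  define G where "G = tr_grad d k u"
  obtain B where B: "\<And>y. norm (G y) \<le> B" unfolding G_def using tr_grad_bounded[OF d u R supp] by metis
  have Wc: "continuous_on UNIV W" unfolding W_def by (rule continuous_on_tr_fun[OF d u])
  have Wm[measurable]: "W \<in> borel_measurable borel" by (rule borel_measurable_continuous_onI[OF Wc])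
  have Gm[measurable]: "G \<in> borel_measurable borel" unfolding G_def by (rule borel_measurable_ext_grad(2)[OF d u])
  have kp: "kap d k R + 1 > 0" using kap_pos[OF R, of d k] by linarith
  have n: "real DIM('a) = real d + 2" using N by simp
  have sob: "(\<integral>x. \<bar>W x\<bar> powr p \<partial>lborel) powr e \<le> (2 * (real d + 1) / real d)\<^sup>2 * (\<integral>x. (norm (G x))\<^sup>2 \<partial>lborel)"
     "integrable lborel (\<lambda>x. \<bar>W x\<bar> powr p)" "integrable lborel (\<lambda>x. (norm (G x))\<^sup>2)"
  proof -
    have N3: "DIM('a) \<ge> 3" using N d by simp
    have sp: "W x = 0 \<and> G x = 0" if "norm x \<ge> kap d k R + 1" for x
      unfolding W_def G_def by (rule tr_support[OF d R supp that])
    have dr: "(W has_derivative (\<lambda>v. G x \<bullet> v)) (at x)" if "norm x \<noteq> 1" for x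
      unfolding W_def G_def by (rule tr_fun_has_derivative[OF d u that])
    note S = Sobolev_inequality[OF N3 kp Wc sp dr Gm B]
    have ee: "2 * (real d + 2) / (real d + 2 - 2) = p" "(real d + 2 - 2) / (real d + 2) = e"
      "2 * (real d + 2 - 1) / (real d + 2 - 2) = 2 * (real d + 1) / real d"
      by (auto simp: p_def e_def)
    show "(\<integral>x. \<bar>W x\<bar> powr p \<partial>lborel) powr e \<le> (2 * (real d + 1) / real d)\<^sup>2 * (\<integral>x. (norm (G x))\<^sup>2 \<partial>lborel)"
      using S(1) unfolding n ee .
    show "integrable lborel (\<lambda>x. \<bar>W x\<bar> powr p)" using S(2) unfolding n ee .
    show "integrable lborel (\<lambda>x. (norm (G x))\<^sup>2)" by (rule S(3))
  qed
  define D where "D = (\<integral>x. \<bar>W x\<bar> powr p \<partial>lborel)"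
  define E where "E = (\<integral>x. (norm (G x))\<^sup>2 \<partial>lborel)"
  have D: "D \<ge> 0" "(\<integral>\<^sup>+x. ennreal (\<bar>W x\<bar> powr p) \<partial>lborel) = ennreal D"
    unfolding D_def using sob(2) by (auto intro: nn_integral_eq_integral)
  have E: "E \<ge> 0" "(\<integral>\<^sup>+x. ennreal ((norm (G x))\<^sup>2) \<partial>lborel) = ennreal E"
    unfolding E_def using sob(3) by (auto intro: nn_integral_eq_integral)
  let ?A = "\<integral>\<^sup>+x. ennreal ((norm (gradient u x))\<^sup>2) * indicator {x. norm x > 1} x \<partial>lborel"
  let ?P = "\<integral>\<^sup>+x. ennreal (ext_potential d k (norm x) * (u x)\<^sup>2) * indicator {x. norm x > 1} x \<partial>lborel"
  let ?T = "\<integral>\<^sup>+x. ennreal ((norm (G x))\<^sup>2) * indicator {x. norm x > 1} x \<partial>lborel"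
  note ext = exterior_inequalities[OF N d u R supp kd, folded \<tau>_def G_def, unfolded s(2)]
  have "?A < \<infinity>"
  proof -
    obtain C where C: "\<And>x. norm (gradient u x) \<le> C"
      using continuous_bounded_support_bounded[OF continuous_on_gradient[OF u], of R] supp by (metis less_imp_le)
    have "integrable lborel (\<lambda>x. (norm (gradient u x))\<^sup>2)"
      by (rule integrable_bounded_support[where D="C\<^sup>2" and R=R]) (use C supp in \<open>auto intro!: power_mono\<close>)
    then have fin: "(\<integral>\<^sup>+x. ennreal ((norm (gradient u x))\<^sup>2) \<partial>lborel) < \<infinity>"
      by (simp add: nn_integral_eq_integral)
    have "?A \<le> (\<integral>\<^sup>+x. ennreal ((norm (gradient u x))\<^sup>2) \<partial>lborel)"
      by (intro nn_integral_mono) (auto split: split_indicator)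
    then show ?thesis using fin by (rule le_less_trans)
  qed
  then obtain A where A: "A \<ge> 0" "?A = ennreal A" by (cases ?A) auto
  have "?P + 0 \<le> ?P + ennreal \<tau> * ennreal s" by (intro add_left_mono zero_le)
  also note ext(1)
  finally have "?P \<le> ?A" by simp
  then have "?P < \<infinity>" using A by (simp add: le_less_trans)
  then obtain P where P: "P \<ge> 0" "?P = ennreal P" by (cases ?P) auto
  have "?T \<le> (\<integral>\<^sup>+x. ennreal ((norm (G x))\<^sup>2) \<partial>lborel)"
    by (intro nn_integral_mono) (auto split: split_indicator)
  then have "?T < \<infinity>" using E by (simp add: le_less_trans)
  then obtain T where T: "T \<ge> 0" "?T = ennreal T" by (cases ?T) auto
  have i1: "P + \<tau> * s \<le> A"
    using ext(1) A P s(1) \<tau> by (simp flip: ennreal_mult ennreal_plus)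
  have i2: "T + real d * P + real d * \<tau> * s \<le> real d * A + real d * s"
    using ext(2) A P T s(1) \<tau> by (simp flip: ennreal_mult ennreal_plus)
  have "(\<integral>\<^sup>+x. ennreal ((norm (G x))\<^sup>2) * indicator (ball 0 1) x \<partial>lborel) = ennreal a"
    unfolding a(2)[symmetric] by (intro nn_integral_cong) (auto simp: G_def tr_grad_def split: split_indicator)
  then have "ennreal E = ennreal a + ennreal T"
    using nn_integral_split_sphere[of "\<lambda>x. ennreal ((norm (G x))\<^sup>2)"] E T by simp
  then have ET: "E = a + T" using a T E by (simp flip: ennreal_plus)
  define F where "F x = ennreal (\<bar>u x\<bar> powr p * w x)" for x
  have wm[measurable]: "w \<in> borel_measurable borel" unfolding w_def by measurable
  have Fm[measurable]: "F \<in> borel_measurable borel" unfolding F_def by measurable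
  let ?D1 = "\<integral>\<^sup>+x. ennreal (\<bar>W x\<bar> powr p) * indicator (ball 0 1) x \<partial>lborel"
  let ?D2 = "\<integral>\<^sup>+x. ennreal (\<bar>W x\<bar> powr p) * indicator {x. norm x > 1} x \<partial>lborel"
  have F1: "(\<integral>\<^sup>+x. F x * indicator (ball 0 1) x \<partial>lborel) = ?D1"
    by (intro nn_integral_cong) (auto simp: F_def w_def W_def tr_fun_def split: split_indicator)
  have F2: "(\<integral>\<^sup>+x. F x * indicator {x. norm x > 1} x \<partial>lborel) = ennreal (real d) * ?D2"
  proof -
    have "(\<integral>\<^sup>+x. F x * indicator {x. norm x > 1} x \<partial>lborel)
      = (\<integral>\<^sup>+x. ennreal (\<bar>u x\<bar> powr p * log_weight (Suc k) (norm x) powr q) * indicator {x. norm x > 1} x \<partial>lborel)"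
      unfolding F_def w_def q_def by (intro nn_integral_cong) (auto split: split_indicator)
    also have "\<dots> = ennreal (real d) * ?D2"
      unfolding W_def p_def q_def by (rule exterior_power[OF N d u R supp])
    finally show ?thesis .
  qed
  have "(\<integral>\<^sup>+x. F x \<partial>lborel) = ?D1 + ennreal (real d) * ?D2"
    unfolding nn_integral_split_sphere[OF Fm] F1 F2 ..
  also have "\<dots> \<le> ennreal (real d) * ?D1 + ennreal (real d) * ?D2"
  proof (rule add_right_mono)
    have "1 * ?D1 \<le> ennreal (real d) * ?D1" using d0 by (intro mult_right_mono) (auto simp flip: ennreal_1)
    then show "?D1 \<le> ennreal (real d) * ?D1" by simp
  qed
  also have "\<dots> = ennreal (real d) * (\<integral>\<^sup>+x. ennreal (\<bar>W x\<bar> powr p) \<partial>lborel)"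
    by (subst (3) nn_integral_split_sphere) (simp_all add: distrib_left)
  also have "\<dots> = ennreal (real d * D)" unfolding D(2) using D(1) by (simp add: ennreal_mult)
  finally have FD: "(\<integral>\<^sup>+x. F x \<partial>lborel) \<le> ennreal (real d * D)" .
  then have "(\<integral>\<^sup>+x. F x \<partial>lborel) < \<infinity>" by (simp add: le_less_trans)
  then obtain Z where Z: "Z \<ge> 0" "(\<integral>\<^sup>+x. F x \<partial>lborel) = ennreal Z" by (cases "\<integral>\<^sup>+x. F x \<partial>lborel") auto
  have ZD: "Z \<le> real d * D" using FD Z D(1) by simp
  have e: "0 \<le> e" "e \<le> 1" using d0 by (auto simp: e_def)
  have "Z powr e \<le> (real d * D) powr e" using ZD Z e by (intro powr_mono2) auto
  also have "\<dots> = real d powr e * D powr e" using D(1) by (simp add: powr_mult)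
  also have "\<dots> \<le> real d powr 1 * D powr e" using d0 e by (intro mult_right_mono powr_mono) auto
  also have "\<dots> \<le> real d * ((2 * (real d + 1) / real d)\<^sup>2 * E)"
    using sob(1) d0 unfolding D_def[symmetric] E_def[symmetric] by simp
  also have "\<dots> \<le> real d * ((2 * (real d + 1) / real d)\<^sup>2 * (a + real d * (A - P - \<tau> * s + s)))"
    using i2 d0 unfolding ET by (intro mult_left_mono) (auto simp: algebra_simps)
  finally have fin: "Z powr e \<le> real d * (2 * (real d + 1) / real d)\<^sup>2 * (a + real d * (A - P - \<tau> * s + s))"
    by (simp only: mult.assoc)
  show thesis
    by (rule that[OF A(1) P(1) Z(1) A(2) P(2) _ i1])
      (use Z(2) fin in \<open>simp_all only: F_def p_def e_def\<close>)
qed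

section \<open>The main inequality\<close>

lemma V_hat_exterior:
  fixes x :: "real^'n"
  assumes N: "CARD('n) = d + 2" and x: "norm x > 1"
  shows "V_hat k \<epsilon> g x = ext_potential d k (norm x)"
proof -
  have "Y j (norm x) = 1 / iter_log j (norm x)" for j
    using X_eq_iter_log[OF x] by (simp add: Y_def)
  then have "(\<Sum>i=1..k. \<Prod>j=1..i. (Y j (norm x))\<^sup>2) = (\<Sum>i=1..k. (log_weight i (norm x))\<^sup>2)"
    by (simp only: log_weight_def prod_power_distrib)
  moreover have "((real CARD('n) - 2) / 2)\<^sup>2 / (norm x)\<^sup>2 + 1 / (4 * (norm x)\<^sup>2) * Q = ((real d)\<^sup>2 + Q) / (4 * (norm x)\<^sup>2)" for Q
    using N by (simp add: power_divide add_divide_distrib)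
  ultimately show ?thesis using x by (simp only: V_hat_def ext_potential_def) simp
qed

lemma prod_Y_tilde:
  "(\<Prod>j=1..k+1. Y_tilde j r) = (if r > 1 then log_weight (Suc k) r else 1)"
proof (cases "r > 1")
  case True
  then have "Y_tilde j r = 1 / iter_log j r" for j
    using X_eq_iter_log[OF True] by (simp add: Y_tilde_def)
  then show ?thesis using True by (simp only: log_weight_def Suc_eq_plus1 if_True)
next
  case False
  then show ?thesis by (simp add: Y_tilde_def)
qed

theorem theorem5p2:
  fixes g :: "real^'n \<Rightarrow> real" and k :: nat and K \<sigma> :: real
  assumes "CARD('n) \<ge> 3"
    and "k > 0" and "real k < real CARD('n) - 2"
    and "\<And>x. x \<in> ball 0 1 \<Longrightarrow> g x \<ge> 0"
    and "continuous_on (ball 0 1) g"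
    and "\<And>x y. x \<in> ball 0 1 \<Longrightarrow> y \<in> ball 0 1 \<Longrightarrow> norm x = norm y \<Longrightarrow> g x = g y"
    and "\<sigma> > 0" and "K > 0"
    and "\<And>x. x \<in> ball 0 1 \<Longrightarrow> x \<noteq> 0 \<Longrightarrow> g x \<le> K * norm x powr (- 2 + \<sigma>)"
  shows "eps_bar k g > 0 \<and>
    (\<forall>\<epsilon>::real. \<epsilon> > 0 \<longrightarrow> ennreal \<epsilon> < eps_bar k g \<longrightarrow>
      (\<exists>c::real. c > 0 \<and> (\<forall>u \<in> test_functions UNIV.
        (LINT x|lebesgue. (norm (gradient u x))\<^sup>2) - (LINT x|lebesgue. V_hat k \<epsilon> g x * (u x)\<^sup>2)
        \<ge> c * (LINT x|lebesgue. \<bar>u x\<bar> powr (2 * real CARD('n) / (real CARD('n) - 2))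
                * (\<Prod>j=1..k+1. Y_tilde j (norm x)) powr ((2 * real CARD('n) - 2) / (real CARD('n) - 2)))
              powr ((real CARD('n) - 2) / real CARD('n)))))"
proof (intro conjI allI impI)
  note N3 = assms(1) and kN = assms(3) and g0 = assms(4) and gc = assms(5)
    and \<sigma> = assms(7) and K = assms(8) and gK = assms(9)
  show "eps_bar k g > 0" by (rule eps_bar_pos[OF N3 kN g0 gc K \<sigma> gK])
  fix \<epsilon> :: real assume \<epsilon>: "\<epsilon> > 0" and \<epsilon>b: "ennreal \<epsilon> < eps_bar k g"
  obtain z where z: "ennreal \<epsilon> < z" "z < eps_bar k g" using dense[OF \<epsilon>b] by blast
  then obtain \<epsilon>' where \<epsilon>': "\<epsilon>' \<ge> 0" "z = ennreal \<epsilon>'" by (cases z) auto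
  have \<epsilon>\<epsilon>': "\<epsilon> < \<epsilon>'" using z(1) \<epsilon>'(1) \<epsilon> unfolding \<epsilon>'(2) by (simp add: ennreal_less_iff)
  define d where "d = CARD('n) - 2"
  have N: "CARD('n) = d + 2" and d: "d \<ge> 1" using N3 by (auto simp: d_def)
  have rN: "real CARD('n) = real d + 2" using N by simp
  have DN: "DIM(real^'n) = d + 2" using N by (simp add: DIM_cart)
  have kd: "k < d" using kN rN by simp
  define \<tau> where "\<tau> = (real d - real k) / 2"
  have \<tau>: "\<tau> > 0" using kd by (simp add: \<tau>_def)
  have d0: "real d \<ge> 1" using d by simp
  define C where "C = real d * (2 * (real d + 1) / real d)\<^sup>2 * (real d + real d / \<tau>)"
  define \<delta> where "\<delta> = 1 - \<epsilon> / \<epsilon>'"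
  have C: "C > 0" using d0 \<tau> by (simp add: C_def add_pos_pos)
  have \<delta>: "\<delta> > 0" "\<delta> \<le> 1" using \<epsilon> \<epsilon>\<epsilon>' by (auto simp: \<delta>_def)
  show "\<exists>c::real. c > 0 \<and> (\<forall>u \<in> test_functions UNIV.
        (LINT x|lebesgue. (norm (gradient u x))\<^sup>2) - (LINT x|lebesgue. V_hat k \<epsilon> g x * (u x)\<^sup>2)
        \<ge> c * (LINT x|lebesgue. \<bar>u x\<bar> powr (2 * real CARD('n) / (real CARD('n) - 2))
                * (\<Prod>j=1..k+1. Y_tilde j (norm x)) powr ((2 * real CARD('n) - 2) / (real CARD('n) - 2)))
              powr ((real CARD('n) - 2) / real CARD('n)))"
  proof (intro exI conjI ballI)
    show "\<delta> / C > 0" using \<delta> C by simp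
    fix u :: "real^'n \<Rightarrow> real" assume ut: "u \<in> test_functions UNIV"
    have u: "smooth u" using ut by (simp add: test_functions_def)
    obtain R0 where R0: "R0 > 0" "\<And>x. norm x \<ge> R0 \<Longrightarrow> u x = 0" using test_functions_bounded_support[OF ut] by metis
    define R where "R = R0 + 1"
    have R: "R \<ge> 1" using R0 by (simp add: R_def)
    have supp: "u x = 0 \<and> gradient u x = 0" if "norm x \<ge> R" for x
    proof
      show "u x = 0" using that R0(2) by (simp add: R_def)
      show "gradient u x = 0"
        by (rule gradient_zero_outside[OF smooth_has_derivative[OF u], where R=R0])
          (use that R_def R0(2) in auto)
    qed
    have um[measurable]: "u \<in> borel_measurable borel" and gm[measurable]: "gradient u \<in> borel_measurable borel"
      using u by (auto intro!: borel_measurable_continuous_onI smooth_continuous continuous_on_gradient)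
    have e1: "\<epsilon>' > 0" using \<epsilon> \<epsilon>\<epsilon>' by simp
    have e2: "ennreal \<epsilon>' \<le> eps_bar k g" using z(2) \<epsilon>'(2) by simp
    obtain a s b where a: "a \<ge> 0" and s: "s \<ge> 0" and b: "b \<ge> 0"
      and ia: "(\<integral>\<^sup>+x. ennreal ((norm (gradient u x))\<^sup>2) \<partial>lebesgue_on (ball 0 1)) = ennreal a"
      and iS: "(\<integral>\<^sup>+x. ennreal ((u x)\<^sup>2) \<partial>sphere_measure) = ennreal s"
      and ib: "(\<integral>\<^sup>+x. ennreal (g x * (u x)\<^sup>2) \<partial>lebesgue_on (ball 0 1)) = ennreal b"
      and ineq: "\<epsilon>' * b \<le> a + (real CARD('n) - 2 - real k) / 2 * s"
      by (rule smooth_le_eps_bar[OF N3 kN g0 K \<sigma> gK e1 e2 u])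
    have \<tau>N: "(real CARD('n) - 2 - real k) / 2 = \<tau>" using rN by (simp add: \<tau>_def)
    define w where "w x = (if norm x > 1 then log_weight (Suc k) (norm x) else 1) powr ((2 * (real d + 2) - 2) / real d)" for x :: "real^'n"
    obtain A P Z where A: "A \<ge> 0" and P: "P \<ge> 0" and Z: "Z \<ge> 0"
      and iA: "(\<integral>\<^sup>+x. ennreal ((norm (gradient u x))\<^sup>2) * indicator {x. norm x > 1} x \<partial>lborel) = ennreal A"
      and iP: "(\<integral>\<^sup>+x. ennreal (ext_potential d k (norm x) * (u x)\<^sup>2) * indicator {x. norm x > 1} x \<partial>lborel) = ennreal P"
      and iZ: "(\<integral>\<^sup>+x. ennreal (\<bar>u x\<bar> powr (2 * (real d + 2) / real d) * w x) \<partial>lborel) = ennreal Z"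
      and PA: "P + \<tau> * s \<le> A"
      and ZA: "Z powr (real d / (real d + 2)) \<le> real d * (2 * (real d + 1) / real d)\<^sup>2 * (a + real d * (A - P - \<tau> * s + s))"
      by (rule transported_Sobolev[OF DN d u kd R supp a ia[unfolded nn_integral_on_ball] s iS, folded w_def \<tau>_def])
    define H where "H = A - P"
    have Hs: "\<tau> * s \<le> H" using PA by (simp add: H_def)
    have H0: "0 \<le> H" using Hs s \<tau> by (smt (verit) mult_nonneg_nonneg)
    have L1: "(LINT x|lebesgue. (norm (gradient u x))\<^sup>2) = a + A"
    proof -
      have "(\<integral>\<^sup>+x. ennreal ((norm (gradient u x))\<^sup>2) \<partial>lborel) = ennreal a + ennreal A"
        by (subst nn_integral_split_sphere) (simp_all add: iA ia[unfolded nn_integral_on_ball])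
      also have "\<dots> = ennreal (a + A)" using a A by simp
      finally show ?thesis by (intro integral_lebesgue_eqI) (use a A in \<open>simp_all del: ennreal_plus\<close>)
    qed
    have L2: "(LINT x|lebesgue. V_hat k \<epsilon> g x * (u x)\<^sup>2) = \<epsilon> * b + P"
    proof -
      have [measurable]: "ball (0::real^'n) 1 \<in> sets borel" by simp
      have gi[measurable]: "(\<lambda>x. indicator (ball 0 1) x *\<^sub>R g x) \<in> borel_measurable borel"
        by (rule borel_measurable_continuous_on_indicator[OF _ gc]) simp
      have Veq: "V_hat k \<epsilon> g = (\<lambda>x. \<epsilon> * (indicator (ball 0 1) x *\<^sub>R g x) + indicator {x. norm x > 1} x * ext_potential d k (norm x))"
      proof
        fix x :: "real^'n"
        consider "norm x < 1" | "norm x = 1" | "norm x > 1" by linarith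
        then show "V_hat k \<epsilon> g x = \<epsilon> * (indicator (ball 0 1) x *\<^sub>R g x) + indicator {x. norm x > 1} x * ext_potential d k (norm x)"
        proof cases
          case 3
          then show ?thesis by (simp add: V_hat_exterior[OF N])
        qed (simp_all add: V_hat_def)
      qed
      have Vm[measurable]: "V_hat k \<epsilon> g \<in> borel_measurable borel" unfolding Veq by measurable
      have V0: "0 \<le> V_hat k \<epsilon> g x" for x
        unfolding Veq using g0[of x] \<epsilon> by (intro add_nonneg_nonneg mult_nonneg_nonneg ext_potential_nonneg) (auto split: split_indicator)
      have "(\<integral>\<^sup>+x. ennreal (V_hat k \<epsilon> g x * (u x)\<^sup>2) * indicator (ball 0 1) x \<partial>lborel)
         = (\<integral>\<^sup>+x. ennreal \<epsilon> * (ennreal (indicator (ball 0 1) x *\<^sub>R g x * (u x)\<^sup>2)) \<partial>lborel)"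
        using \<epsilon> g0 by (intro nn_integral_cong) (auto simp: V_hat_def mult.assoc ennreal_mult split: split_indicator)
      also have "\<dots> = ennreal \<epsilon> * (\<integral>\<^sup>+x. ennreal (indicator (ball 0 1) x *\<^sub>R g x * (u x)\<^sup>2) \<partial>lborel)"
        by (rule nn_integral_cmult) measurable
      also have "(\<integral>\<^sup>+x. ennreal (indicator (ball 0 1) x *\<^sub>R g x * (u x)\<^sup>2) \<partial>lborel) = ennreal b"
        unfolding ib[symmetric] nn_integral_on_ball by (intro nn_integral_cong) (auto split: split_indicator)
      finally have 1: "(\<integral>\<^sup>+x. ennreal (V_hat k \<epsilon> g x * (u x)\<^sup>2) * indicator (ball 0 1) x \<partial>lborel) = ennreal (\<epsilon> * b)"
        using \<epsilon> b by (simp add: ennreal_mult)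
      have 2: "(\<integral>\<^sup>+x. ennreal (V_hat k \<epsilon> g x * (u x)\<^sup>2) * indicator {x. norm x > 1} x \<partial>lborel) = ennreal P"
        unfolding iP[symmetric] by (intro nn_integral_cong) (auto simp: V_hat_exterior[OF N] split: split_indicator)
      show ?thesis
      proof (rule integral_lebesgue_eqI)
        show "(\<integral>\<^sup>+x. ennreal (V_hat k \<epsilon> g x * (u x)\<^sup>2) \<partial>lborel) = ennreal (\<epsilon> * b + P)"
          by (subst nn_integral_split_sphere) (use \<epsilon> b P in \<open>simp_all add: 1 2\<close>)
        show "0 \<le> \<epsilon> * b + P" using \<epsilon> b P by simp
      qed (simp_all add: V0)
    qed
    have L3: "(LINT x|lebesgue. \<bar>u x\<bar> powr (2 * real CARD('n) / (real CARD('n) - 2))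
                * (\<Prod>j=1..k+1. Y_tilde j (norm x)) powr ((2 * real CARD('n) - 2) / (real CARD('n) - 2))) = Z"
    proof -
      have wm[measurable]: "w \<in> borel_measurable borel" unfolding w_def by measurable
      have w0: "0 \<le> w x" for x by (simp add: w_def)
      have dd: "real d + 2 - 2 = real d" by simp
      have "(LINT x|lebesgue. \<bar>u x\<bar> powr (2 * real CARD('n) / (real CARD('n) - 2))
                * (\<Prod>j=1..k+1. Y_tilde j (norm x)) powr ((2 * real CARD('n) - 2) / (real CARD('n) - 2)))
          = (LINT x|lebesgue. \<bar>u x\<bar> powr (2 * (real d + 2) / real d) * w x)"
        unfolding prod_Y_tilde rN dd w_def ..
      also have "\<dots> = Z"
        by (rule integral_lebesgue_eqI[OF _ _ iZ Z]) (use w0 in auto)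
      finally show ?thesis .
    qed
    have e: "(real CARD('n) - 2) / real CARD('n) = real d / (real d + 2)" using rN by simp
    have sH: "s \<le> H / \<tau>" using Hs \<tau> by (simp add: field_simps)
    have "a + real d * (A - P - \<tau> * s + s) \<le> (real d + real d / \<tau>) * (a + H)"
    proof -
      have "A - P - \<tau> * s + s \<le> H + H / \<tau>" using sH s \<tau> by (simp add: H_def) (smt (verit) mult_nonneg_nonneg)
      then have "real d * (A - P - \<tau> * s + s) \<le> real d * (H + H / \<tau>)" using d0 by (intro mult_left_mono) auto
      also have "\<dots> = (real d + real d / \<tau>) * H" by (simp add: algebra_simps)
      finally have "real d * (A - P - \<tau> * s + s) \<le> (real d + real d / \<tau>) * H" .
      moreover have "1 * a \<le> (real d + real d / \<tau>) * a"
      proof (rule mult_right_mono[OF _ a])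
        have "0 \<le> real d / \<tau>" using \<tau> by simp
        then show "1 \<le> real d + real d / \<tau>" using d0 by linarith
      qed
      ultimately show ?thesis by (simp add: distrib_left)
    qed
    then have "real d * (2 * (real d + 1) / real d)\<^sup>2 * (a + real d * (A - P - \<tau> * s + s)) \<le> C * (a + H)"
      unfolding C_def mult.assoc by (intro mult_left_mono) auto
    with ZA have ZC: "Z powr (real d / (real d + 2)) \<le> C * (a + H)" by linarith
    have "\<epsilon> * b \<le> (1 - \<delta>) * (a + \<tau> * s)"
    proof -
      have "\<epsilon> * b = \<epsilon> / \<epsilon>' * (\<epsilon>' * b)" using \<epsilon> \<epsilon>\<epsilon>' by simp
      also have "\<dots> \<le> \<epsilon> / \<epsilon>' * (a + \<tau> * s)" using ineq[unfolded \<tau>N] \<epsilon> \<epsilon>\<epsilon>' by (intro mult_left_mono) auto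
      finally show ?thesis by (simp add: \<delta>_def)
    qed
    also have "\<dots> \<le> (1 - \<delta>) * (a + H)" using Hs \<delta> by (intro mult_left_mono) auto
    finally have "\<delta> * (a + H) \<le> a + A - (\<epsilon> * b + P)" by (simp add: H_def algebra_simps)
    moreover have "\<delta> / C * Z powr (real d / (real d + 2)) \<le> \<delta> / C * (C * (a + H))"
      using ZC \<delta> C by (intro mult_left_mono) auto
    moreover have "\<delta> / C * (C * (a + H)) = \<delta> * (a + H)" using C by simp
    ultimately show "(LINT x|lebesgue. (norm (gradient u x))\<^sup>2) - (LINT x|lebesgue. V_hat k \<epsilon> g x * (u x)\<^sup>2)
        \<ge> \<delta> / C * (LINT x|lebesgue. \<bar>u x\<bar> powr (2 * real CARD('n) / (real CARD('n) - 2))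
                * (\<Prod>j=1..k+1. Y_tilde j (norm x)) powr ((2 * real CARD('n) - 2) / (real CARD('n) - 2)))
              powr ((real CARD('n) - 2) / real CARD('n))"
      unfolding L1 L2 L3 e by linarith
  qed
qed

end
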